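(* Let $\Omega=(0,1)^2$ with the uniform structured meshes described in the context. Assume that $a\in C^2(\overline\Omega)$ with $a(\mathbf{x})\ge a_0>0$, that $\vec\beta\in C^1(\overline\Omega)$ is a vector field with $\operatorname{div}\vec\beta\ge0$ pointwise in $\Omega$, and that $f\in L^2(\Omega)$; let $\{\mathrm{Re}(A_n(a,\vec\beta))\}$ and $\{P_n(a)\}$ be the Hermitian positive definite matrix sequences defined in the context. Then, with the choice $\alpha=1$, the PHSS method with preconditioner $P_n(a)$ applied to the linear systems with coefficient matrix $A_n(a,\vec\beta)$ is optimally convergent (linearly, but with a convergence independent of the matrix dimension $n=n(h)$), i.e., the number of PHSS iterations for reaching the solution within a fixed accuracy can be bounded from above by a constant independent of the dimension $n=n(h)$.
   Context: Mesh: for each integer $m\ge1$, $[0,1]^2$ is divided into $(m+1)^2$ equal squares of side $1/(m+1)$ and each square is divided into two triangles by a diagonal, all diagonals being parallel to one fixed direction. The mesh is denoted $\mathcal{T}_h$, with $h$ the maximum diameter of its triangles; $n=n(h)=m^2$ is the number of internal nodes, and the matrix sequences are indexed by these $n$ as $m\to\infty$. Let $\varphi_1,\dots,\varphi_n$ be the nodal basis of the continuous piecewise linear functions on $\mathcal{T}_h$ vanishing on $\partial\Omega$ ($\varphi_i$ equals $1$ at internal node $i$ and $0$ at every other node). Matrices (arising from the finite element approximation of $\operatorname{div}(-a\nabla u+\vec\beta u)=f$ in $\Omega$, $u=0$ on $\partial\Omega$): $A_n=A_n(a,\vec\beta)=\Theta_n(a)+\Psi_n(\vec\beta)\in\mathbb{R}^{n\times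 n}$ with $$(\Theta_n(a))_{i,j}=\int_\Omega a\,\nabla\varphi_i\cdot\nabla\varphi_j,\qquad(\Psi_n(\vec\beta))_{i,j}=-\int_\Omega(\nabla\varphi_i\cdot\vec\beta)\,\varphi_j.$$ The linear systems are $A_n\mathbf{x}=\mathbf{b}$ with $\mathbf{b}_i=\int_\Omega f\varphi_i$. With $\mathrm{i}^2=-1$, $\mathrm{Re}(A_n)=\frac12(A_n+A_n^T)$ and $\mathrm{Im}(A_n)=\frac1{2\mathrm{i}}(A_n-A_n^T)$. The preconditioner is $$P_n=P_n(a)=D_n^{1/2}(a)\,A_n(1,0)\,D_n^{1/2}(a),\qquad D_n(a)=\mathrm{diag}(A_n(a,0))\,\mathrm{diag}^{-1}(A_n(1,0)),$$ where $\mathrm{diag}(X)$ is the diagonal matrix with the same main diagonal as $X$. PHSS (Preconditioned Hermitian/Skew-Hermitian Splitting) method: for a positive parameter $\alpha$ and a given initial guess $\mathbf{x}^0$, the iteration for $A_n\mathbf{x}=\mathbf{b}$ is $$(\alpha I+P_n^{-1}\mathrm{Re}(A_n))\mathbf{x}^{k+1/2}=(\alpha I-P_n^{-1}\mathrm{i}\,\mathrm{Im}(A_n))\mathbf{x}^{k}+P_n^{-1}\mathbf{b},$$ $$(\alpha I+P_n^{-1}\mathrm{i}\,\mathrm{Im}(A_n))\mathbf{x}^{k+1}=(\alpha I-P_n^{-1}\mathrm{Re}(A_n))\mathbf{x}^{k+1/2}+P_n^{-1}\mathbf{b}.$$ *)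

theory Defs
  imports "HOL-Analysis.Analysis" "Jordan_Normal_Form.Gauss_Jordan_Elimination"
begin

no_notation inner (infix \<open>\<bullet>\<close> 70)

type_synonym point = "real \<times> real"

definition Omega :: "point set" where
  "Omega = {0<..<1} \<times> {0<..<1}"

text \<open>\<^term>\<open>f\<close> is $C^k$ on the closure of the open set \<^term>\<open>S\<close>: all partial derivatives of order
  at most \<^term>\<open>k\<close> exist in \<^term>\<open>S\<close> and extend continuously to the closure.
  The witnesses \<^term>\<open>g\<close> and \<^term>\<open>h\<close> are these extensions of the two first-order partial derivatives.\<close>

primrec Ck_closure :: "nat \<Rightarrow> point set \<Rightarrow> (point \<Rightarrow> real) \<Rightarrow> bool" where
  "Ck_closure 0 S f \<longleftrightarrow> continuous_on (closure S) f"
| "Ck_closure (Suc k) S f \<longleftrightarrow> continuous_on (closure S) f \<and>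
     (\<exists>g h. Ck_closure k S g \<and> Ck_closure k S h \<and>
        (\<forall>x\<in>S. (f has_derivative (\<lambda>v. g x * fst v + h x * snd v)) (at x)))"

definition Ck_closure_field :: "nat \<Rightarrow> point set \<Rightarrow> (point \<Rightarrow> point) \<Rightarrow> bool" where
  "Ck_closure_field k S \<beta> \<longleftrightarrow>
     Ck_closure k S (\<lambda>x. fst (\<beta> x)) \<and> Ck_closure k S (\<lambda>x. snd (\<beta> x))"

definition divergence :: "(point \<Rightarrow> point) \<Rightarrow> point \<Rightarrow> real" where
  "divergence \<beta> x = (\<Sum>e\<in>Basis. inner (frechet_derivative \<beta> (at x) e) e)"

text \<open>The value at points of non-differentiability is irrelevant: the gradient is only applied to
  piecewise linear functions, and only under an integral.\<close>

definition gradient :: "(point \<Rightarrow> real) \<Rightarrow> point \<Rightarrow> point" where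
  "gradient v x = (if v differentiable (at x)
     then (\<Sum>e\<in>Basis. frechet_derivative v (at x) e *\<^sub>R e) else 0)"

definition L2_on :: "point set \<Rightarrow> (point \<Rightarrow> real) \<Rightarrow> bool" where
  "L2_on S f \<longleftrightarrow> f \<in> borel_measurable (lebesgue_on S) \<and> integrable (lebesgue_on S) (\<lambda>x. (f x)\<^sup>2)"

text \<open>The common direction of the diagonals of the mesh: $(1,1)$ or $(1,-1)$.\<close>

datatype diagonal = Rising | Falling

definition grid_point :: "nat \<Rightarrow> nat \<Rightarrow> nat \<Rightarrow> point" where
  "grid_point m p q = (real p / real (m + 1), real q / real (m + 1))"

fun cell_triangles :: "diagonal \<Rightarrow> nat \<Rightarrow> nat \<Rightarrow> nat \<Rightarrow> point set set" where
  "cell_triangles Rising m p q =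
     {convex hull {grid_point m p q, grid_point m (p+1) q, grid_point m (p+1) (q+1)},
      convex hull {grid_point m p q, grid_point m p (q+1), grid_point m (p+1) (q+1)}}"
| "cell_triangles Falling m p q =
     {convex hull {grid_point m p q, grid_point m (p+1) q, grid_point m p (q+1)},
      convex hull {grid_point m (p+1) q, grid_point m p (q+1), grid_point m (p+1) (q+1)}}"

definition mesh :: "diagonal \<Rightarrow> nat \<Rightarrow> point set set" where
  "mesh d m = (\<Union>p\<le>m. \<Union>q\<le>m. cell_triangles d m p q)"

text \<open>Functions are total, so the elements of the finite element space are extended by zero outside
  \<^term>\<open>Omega\<close>; this makes the nodal basis functions unique.\<close>

definition fe_space :: "diagonal \<Rightarrow> nat \<Rightarrow> (point \<Rightarrow> real) set" where
  "fe_space d m = {v. continuous_on (closure Omega) v \<and>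
     (\<forall>T\<in>mesh d m. \<exists>c w. \<forall>x\<in>T. v x = c + inner w x) \<and>
     (\<forall>x. x \<notin> Omega \<longrightarrow> v x = 0)}"

text \<open>Internal nodes are numbered lexicographically by \<^term>\<open>i < m\<^sup>2\<close>.\<close>

definition node :: "nat \<Rightarrow> nat \<Rightarrow> point" where
  "node m i = grid_point m (i mod m + 1) (i div m + 1)"

definition nodal_basis :: "diagonal \<Rightarrow> nat \<Rightarrow> nat \<Rightarrow> point \<Rightarrow> real" where
  "nodal_basis d m i =
     (THE v. v \<in> fe_space d m \<and> (\<forall>j<m\<^sup>2. v (node m j) = (if j = i then 1 else 0)))"

definition Theta :: "diagonal \<Rightarrow> nat \<Rightarrow> (point \<Rightarrow> real) \<Rightarrow> real mat" where
  "Theta d m a = Matrix.mat (m\<^sup>2) (m\<^sup>2) (\<lambda>(i, j). LINT x|lebesgue_on Omega.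
     a x * inner (gradient (nodal_basis d m i) x) (gradient (nodal_basis d m j) x))"

definition Psi :: "diagonal \<Rightarrow> nat \<Rightarrow> (point \<Rightarrow> point) \<Rightarrow> real mat" where
  "Psi d m \<beta> = Matrix.mat (m\<^sup>2) (m\<^sup>2) (\<lambda>(i, j). - (LINT x|lebesgue_on Omega.
     inner (gradient (nodal_basis d m i) x) (\<beta> x) * nodal_basis d m j x))"

definition fem_matrix :: "diagonal \<Rightarrow> nat \<Rightarrow> (point \<Rightarrow> real) \<Rightarrow> (point \<Rightarrow> point) \<Rightarrow> real mat" where
  "fem_matrix d m a \<beta> = Theta d m a + Psi d m \<beta>"

definition fem_rhs :: "diagonal \<Rightarrow> nat \<Rightarrow> (point \<Rightarrow> real) \<Rightarrow> real vec" where
  "fem_rhs d m f = Matrix.vec (m\<^sup>2) (\<lambda>i. LINT x|lebesgue_on Omega. f x * nodal_basis d m i x)"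

definition diag_part :: "real mat \<Rightarrow> real mat" where
  "diag_part X = mat_diag (dim_row X) (\<lambda>i. X $$ (i, i))"

definition diag_part_inv :: "real mat \<Rightarrow> real mat" where
  "diag_part_inv X = mat_diag (dim_row X) (\<lambda>i. inverse (X $$ (i, i)))"

text \<open>Square root of a diagonal matrix with nonnegative entries.\<close>

definition diag_sqrt :: "real mat \<Rightarrow> real mat" where
  "diag_sqrt X = mat_diag (dim_row X) (\<lambda>i. sqrt (X $$ (i, i)))"

definition scaling :: "diagonal \<Rightarrow> nat \<Rightarrow> (point \<Rightarrow> real) \<Rightarrow> real mat" where
  "scaling d m a =
     diag_part (fem_matrix d m a (\<lambda>_. 0)) * diag_part_inv (fem_matrix d m (\<lambda>_. 1) (\<lambda>_. 0))"

definition preconditioner :: "diagonal \<Rightarrow> nat \<Rightarrow> (point \<Rightarrow> real) \<Rightarrow> real mat" where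
  "preconditioner d m a =
     diag_sqrt (scaling d m a) * fem_matrix d m (\<lambda>_. 1) (\<lambda>_. 0) * diag_sqrt (scaling d m a)"

text \<open>For matrices with real entries, to which these are applied, the transpose is the adjoint.\<close>

definition Re_mat :: "complex mat \<Rightarrow> complex mat" where
  "Re_mat A = (1 / 2) \<cdot>\<^sub>m (A + transpose_mat A)"

definition Im_mat :: "complex mat \<Rightarrow> complex mat" where
  "Im_mat A = (1 / (2 * \<i>)) \<cdot>\<^sub>m (A - transpose_mat A)"

definition phss_half_step ::
  "real \<Rightarrow> complex mat \<Rightarrow> complex mat \<Rightarrow> complex vec \<Rightarrow> complex vec \<Rightarrow> complex vec \<Rightarrow> bool" where
  "phss_half_step \<alpha> Pinv A b x y \<longleftrightarrow>
     (complex_of_real \<alpha> \<cdot>\<^sub>m 1\<^sub>m (dim_row A) + Pinv * Re_mat A) *\<^sub>v y =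
     (complex_of_real \<alpha> \<cdot>\<^sub>m 1\<^sub>m (dim_row A) - Pinv * (\<i> \<cdot>\<^sub>m Im_mat A)) *\<^sub>v x + Pinv *\<^sub>v b"

definition phss_full_step ::
  "real \<Rightarrow> complex mat \<Rightarrow> complex mat \<Rightarrow> complex vec \<Rightarrow> complex vec \<Rightarrow> complex vec \<Rightarrow> bool" where
  "phss_full_step \<alpha> Pinv A b y z \<longleftrightarrow>
     (complex_of_real \<alpha> \<cdot>\<^sub>m 1\<^sub>m (dim_row A) + Pinv * (\<i> \<cdot>\<^sub>m Im_mat A)) *\<^sub>v z =
     (complex_of_real \<alpha> \<cdot>\<^sub>m 1\<^sub>m (dim_row A) - Pinv * Re_mat A) *\<^sub>v y + Pinv *\<^sub>v b"

text \<open>\<^term>\<open>x\<close> and \<^term>\<open>y\<close> are the sequences of full iterates and of half-step iterates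
  started at \<^term>\<open>x0\<close>; in particular \<^term>\<open>P\<close> is invertible.\<close>

definition phss_iterates ::
  "real \<Rightarrow> complex mat \<Rightarrow> complex mat \<Rightarrow> complex vec \<Rightarrow> complex vec \<Rightarrow>
   (nat \<Rightarrow> complex vec) \<Rightarrow> (nat \<Rightarrow> complex vec) \<Rightarrow> bool" where
  "phss_iterates \<alpha> P A b x0 x y \<longleftrightarrow>
     (\<exists>Pinv. mat_inverse P = Some Pinv \<and> x 0 = x0 \<and>
       (\<forall>k. x k \<in> carrier_vec (dim_row A) \<and> y k \<in> carrier_vec (dim_row A) \<and>
            phss_half_step \<alpha> Pinv A b (x k) (y k) \<and>
            phss_full_step \<alpha> Pinv A b (y k) (x (Suc k))))"

definition vec_norm2 :: "complex vec \<Rightarrow> real" where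
  "vec_norm2 v = L2_set (\<lambda>i. cmod (v $ i)) {..<dim_vec v}"

text \<open>Every linear system has a unique solution and the method is well defined for every initial
  guess.\<close>

definition phss_well_defined ::
  "real \<Rightarrow> (nat \<Rightarrow> complex mat) \<Rightarrow> (nat \<Rightarrow> complex mat) \<Rightarrow> (nat \<Rightarrow> complex vec) \<Rightarrow> bool" where
  "phss_well_defined \<alpha> P A b \<longleftrightarrow>
     (\<forall>m\<ge>1. (\<exists>!s. s \<in> carrier_vec (dim_row (A m)) \<and> A m *\<^sub>v s = b m) \<and>
        (\<forall>x0\<in>carrier_vec (dim_row (A m)).
           \<exists>!xy. phss_iterates \<alpha> (P m) (A m) (b m) x0 (fst xy) (snd xy)))"

text \<open>Linear convergence with constants that do not depend on the index (hence not on the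
  dimension).\<close>

definition phss_uniformly_linear ::
  "real \<Rightarrow> (nat \<Rightarrow> complex mat) \<Rightarrow> (nat \<Rightarrow> complex mat) \<Rightarrow> (nat \<Rightarrow> complex vec) \<Rightarrow> bool" where
  "phss_uniformly_linear \<alpha> P A b \<longleftrightarrow>
     (\<exists>C \<rho>. 0 \<le> \<rho> \<and> \<rho> < 1 \<and>
       (\<forall>m\<ge>1. \<forall>s\<in>carrier_vec (dim_row (A m)). \<forall>x0 x y.
          A m *\<^sub>v s = b m \<longrightarrow> phss_iterates \<alpha> (P m) (A m) (b m) x0 x y \<longrightarrow>
          (\<forall>k. vec_norm2 (x k - s) \<le> C * \<rho> ^ k * vec_norm2 (x0 - s))))"

text \<open>For each prescribed accuracy (reduction of the initial error by a factor \<^term>\<open>\<epsilon>\<close>) the number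
  of iterations needed is bounded independently of the index and of the initial guess.\<close>

definition phss_bounded_iterations ::
  "real \<Rightarrow> (nat \<Rightarrow> complex mat) \<Rightarrow> (nat \<Rightarrow> complex mat) \<Rightarrow> (nat \<Rightarrow> complex vec) \<Rightarrow> bool" where
  "phss_bounded_iterations \<alpha> P A b \<longleftrightarrow>
     (\<forall>\<epsilon>>0. \<exists>K. \<forall>m\<ge>1. \<forall>s\<in>carrier_vec (dim_row (A m)). \<forall>x0 x y.
          A m *\<^sub>v s = b m \<longrightarrow> phss_iterates \<alpha> (P m) (A m) (b m) x0 x y \<longrightarrow>
          (\<forall>k\<ge>K. vec_norm2 (x k - s) \<le> \<epsilon> * vec_norm2 (x0 - s)))"

definition phss_optimally_convergent ::
  "real \<Rightarrow> (nat \<Rightarrow> complex mat) \<Rightarrow> (nat \<Rightarrow> complex mat) \<Rightarrow> (nat \<Rightarrow> complex vec) \<Rightarrow> bool" where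
  "phss_optimally_convergent \<alpha> P A b \<longleftrightarrow>
     phss_well_defined \<alpha> P A b \<and> phss_uniformly_linear \<alpha> P A b \<and> phss_bounded_iterations \<alpha> P A b"

end

theory Submission
  imports Defs "Jordan_Normal_Form.Determinant"
begin

text \<open>
  Write \<open>R\<close> and \<open>K\<close> for the symmetric and the skew part of the system matrix,
  \<open>P\<close> for the preconditioner and \<open>h = 1 / (m + 1)\<close>. All matrices are real and
  \<open>K = i Im A\<close>, so the real and imaginary parts of the error can be treated separately.

  In the norm of \<open>P\<close> the iteration with parameter 1 is the product of the Cayley transform of
  \<open>inv P K\<close>, an isometry in suitable coordinates, and of the Cayley transform of \<open>inv P
  R\<close>, a contraction whose rate depends only on the constants in the comparison of \<open>R\<close>
  with \<open>P\<close> (\<open>energy_contraction\<close>). The claim, however, concerns the Euclidean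
  norm, and the condition number of \<open>P\<close> grows like the inverse square of \<open>h\<close>, so
  the change of norm costs a factor \<open>1/h\<close>. It is recovered by smoothing. Since the diffusion
  coefficient is twice continuously differentiable, \<open>R - P\<close> has Euclidean operator norm
  \<open>O(h\<^sup>2)\<close>, the same order as the smallest eigenvalue of \<open>P\<close>; therefore the
  first iteration maps an error of Euclidean norm 1 to an error of \<open>P\<close>-norm \<open>O(h)\<close>
  (\<open>half_step_stable\<close>, \<open>full_step_smoothing\<close>), and the two factors cancel
  (\<open>errors_decay\<close>).

  The remaining work is to verify, with constants independent of \<open>h\<close>, the four hypotheses of
  this argument. Coercivity of \<open>P\<close> is a discrete Poincare inequality
  (\<open>stiff_coercive\<close>). The bound for \<open>R - P\<close> has two sources. The symmetric part of
  the convection matrix is a mass matrix weighted with half the divergence, by integration by parts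
  (\<open>C1_field_integration_by_parts\<close>); it has entries of order \<open>h\<^sup>2\<close> and is
  positive semidefinite. The diffusion matrix has entries that agree up to \<open>O(h\<^sup>2)\<close> with
  those for the constant coefficient 1 times the value of the coefficient at the midpoint of the two nodes,
  because the mesh is symmetric about that point (\<open>stiff_midpoint\<close>); the diagonal scaling in
  \<open>P\<close> has the same effect up to \<open>O(h\<^sup>2)\<close> (\<open>precond_close\<close>).
  Comparability of \<open>P\<close> and \<open>R\<close> follows from these two bounds, and the bound for
  \<open>K\<close> expresses that convection is a first-order term (\<open>convect_form_bound\<close>).
\<close>

unbundle no vec_syntax

section \<open>Bilinear forms on coordinate vectors\<close>

definition bform :: "nat \<Rightarrow> (nat \<Rightarrow> nat \<Rightarrow> real) \<Rightarrow> (nat \<Rightarrow> real) \<Rightarrow> (nat \<Rightarrow> real) \<Rightarrow> real" where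
  "bform n M u v = (\<Sum>i<n. \<Sum>j<n. u i * M i j * v j)"

definition sqnorm :: "nat \<Rightarrow> (nat \<Rightarrow> real) \<Rightarrow> real" where
  "sqnorm n v = (\<Sum>i<n. (v i)\<^sup>2)"

lemma bform_add_left: "bform n M (\<lambda>i. u i + u' i) v = bform n M u v + bform n M u' v"
  by (simp add: bform_def sum.distrib algebra_simps)

lemma bform_add_right: "bform n M u (\<lambda>i. v i + v' i) = bform n M u v + bform n M u v'"
  by (simp add: bform_def sum.distrib algebra_simps)

lemma bform_diff_left: "bform n M (\<lambda>i. u i - u' i) v = bform n M u v - bform n M u' v"
  by (simp add: bform_def sum_subtractf algebra_simps)

lemma bform_diff_right: "bform n M u (\<lambda>i. v i - v' i) = bform n M u v - bform n M u v'"
  by (simp add: bform_def sum_subtractf algebra_simps)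

lemma bform_scale_left: "bform n M (\<lambda>i. c * u i) v = c * bform n M u v"
  by (simp add: bform_def sum_distrib_left algebra_simps)

lemma bform_scale_right: "bform n M u (\<lambda>i. c * v i) = c * bform n M u v"
  by (simp add: bform_def sum_distrib_left algebra_simps)

lemmas bform_linear = bform_add_left bform_add_right bform_diff_left bform_diff_right
  bform_scale_left bform_scale_right

lemma bform_add_matrix: "bform n (\<lambda>i j. M i j + M' i j) u v = bform n M u v + bform n M' u v"
  by (simp add: bform_def sum.distrib algebra_simps)

lemma bform_transpose: "bform n (\<lambda>i j. M j i) u v = bform n M v u"
  unfolding bform_def by (subst sum.swap) (simp add: mult_ac)

lemma bform_cong:
  assumes "\<And>i j. i < n \<Longrightarrow> j < n \<Longrightarrow> M i j = M' i j"
  shows "bform n M u v = bform n M' u v"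
  unfolding bform_def by (intro sum.cong refl) (simp only: assms lessThan_iff)

lemma bform_commute:
  assumes "\<And>i j. i < n \<Longrightarrow> j < n \<Longrightarrow> M j i = s * M i j"
  shows "bform n M u v = s * bform n M v u"
proof -
  have "bform n M u v = bform n (\<lambda>i j. M j i) v u"
    by (rule bform_transpose[symmetric])
  also have "\<dots> = bform n (\<lambda>i j. s * M i j) v u"
    by (intro bform_cong) (rule assms)
  also have "\<dots> = s * bform n M v u"
    by (simp add: bform_def sum_distrib_left mult_ac)
  finally show ?thesis .
qed

lemma sqnorm_nonneg [simp]: "0 \<le> sqnorm n v"
  by (simp add: sqnorm_def sum_nonneg)

lemma sqnorm_scale: "sqnorm n (\<lambda>i. c * v i) = c\<^sup>2 * sqnorm n v"
  by (simp add: sqnorm_def sum_distrib_left power_mult_distrib)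

lemma sqnorm_add_le: "sqnorm n (\<lambda>i. u i + v i) \<le> 2 * sqnorm n u + 2 * sqnorm n v"
proof -
  have "(u i + v i)\<^sup>2 \<le> 2 * (u i)\<^sup>2 + 2 * (v i)\<^sup>2" for i
    using zero_le_power2[of "u i - v i"] by (simp add: power2_eq_square algebra_simps)
  then show ?thesis
    unfolding sqnorm_def sum_distrib_left sum.distrib[symmetric] by (intro sum_mono) auto
qed

lemma bform_Cauchy_Schwarz:
  assumes sym: "\<And>i j. i < n \<Longrightarrow> j < n \<Longrightarrow> M j i = M i j"
    and pos: "\<And>v. 0 \<le> bform n M v v"
  shows "(bform n M u v)\<^sup>2 \<le> bform n M u u * bform n M v v"
proof -
  have comm: "bform n M v u = bform n M u v"
    using bform_commute[of n M 1 v u] sym by simp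
  have quad: "0 \<le> bform n M u u + 2 * t * bform n M u v + t\<^sup>2 * bform n M v v" for t
    using pos[of "\<lambda>i. u i + t * v i"]
    by (simp add: bform_linear comm power2_eq_square algebra_simps)
  show ?thesis
  proof (cases "bform n M v v = 0")
    case True
    have "bform n M u v = 0"
    proof (rule ccontr)
      assume nz: "bform n M u v \<noteq> 0"
      show False
        using quad[of "- (bform n M u u + 1) / (2 * bform n M u v)"] nz True
        by (simp add: field_simps)
    qed
    then show ?thesis using True by simp
  next
    case False
    then have "bform n M v v > 0" using pos[of v] by simp
    then show ?thesis
      using quad[of "- bform n M u v / bform n M v v"]
      by (simp add: field_simps power2_eq_square)
  qed
qed

lemma le_of_square_le_mult:
  fixes a b :: real
  assumes "a\<^sup>2 \<le> b * a" "0 \<le> b"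
  shows "a \<le> b"
proof (rule ccontr)
  assume "\<not> a \<le> b"
  then have "b * a < a * a" using assms by (intro mult_strict_right_mono) auto
  then show False using assms by (simp add: power2_eq_square)
qed

section \<open>Nonsingular matrices\<close>

lemma mult_mat_vec_index:
  assumes "A \<in> carrier_mat n n" "v \<in> carrier_vec n" "i < n"
  shows "(A *\<^sub>v v) $ i = (\<Sum>j<n. A $$ (i, j) * v $ j)"
  using assms by (auto simp: scalar_prod_def lessThan_atLeast0 intro!: sum.cong)

text \<open>The matrices that have to be inverted are not all symmetric; positivity of the quadratic form is
  enough, because a kernel vector would annihilate it.\<close>

lemma det_nonzero_of_positive_form:
  fixes A :: "real mat"
  assumes A: "A \<in> carrier_mat n n"
    and pos: "\<And>v. sqnorm n v > 0 \<Longrightarrow> bform n (\<lambda>i j. A $$ (i, j)) v v > 0"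
  shows "Determinant.det A \<noteq> 0"
proof
  assume "Determinant.det A = 0"
  then obtain v where v: "v \<in> carrier_vec n" "v \<noteq> 0\<^sub>v n" "A *\<^sub>v v = 0\<^sub>v n"
    using det_0_iff_vec_prod_zero_field[OF A] by blast
  have "bform n (\<lambda>i j. A $$ (i, j)) (($) v) (($) v) = (\<Sum>i<n. v $ i * (A *\<^sub>v v) $ i)"
    unfolding bform_def using mult_mat_vec_index[OF A v(1)]
    by (intro sum.cong) (auto simp: sum_distrib_left mult_ac)
  also have "\<dots> = 0" using v(3) by simp
  finally have "\<not> sqnorm n (($) v) > 0" using pos[of "($) v"] by auto
  then have "sqnorm n (($) v) = 0" using sqnorm_nonneg[of n "($) v"] by linarith
  then have "\<forall>i<n. v $ i = 0" by (simp add: sqnorm_def sum_nonneg_eq_0_iff)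
  then have "v = 0\<^sub>v n" using v(1) by (intro eq_vecI) auto
  with v(2) show False by blast
qed

lemma unique_solution_of_det_nonzero:
  fixes A :: "'a::field mat"
  assumes A: "A \<in> carrier_mat n n" and d: "Determinant.det A \<noteq> 0" and b: "b \<in> carrier_vec n"
  shows "\<exists>!v. v \<in> carrier_vec n \<and> A *\<^sub>v v = b"
proof -
  obtain B where B: "B \<in> carrier_mat n n" "B * A = 1\<^sub>m n" "A * B = 1\<^sub>m n"
    using det_non_zero_imp_unit[OF A d, of "()"] unfolding Units_def ring_mat_def by auto
  show ?thesis
  proof (rule ex1I[of _ "B *\<^sub>v b"])
    show "B *\<^sub>v b \<in> carrier_vec n \<and> A *\<^sub>v (B *\<^sub>v b) = b"
      using A B b by (simp flip: assoc_mult_mat_vec)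
    fix v assume "v \<in> carrier_vec n \<and> A *\<^sub>v v = b"
    then show "v = B *\<^sub>v b" using A B by (auto simp flip: assoc_mult_mat_vec)
  qed
qed

section \<open>The energy argument\<close>

text \<open>The interface between the linear algebra and the finite element estimates. Here \<^term>\<open>R\<close> and \<^term>\<open>K\<close>
  are the symmetric and the skew part of the system matrix and \<^term>\<open>lam\<close> is a lower bound for the
  eigenvalues of \<^term>\<open>P\<close>. The perturbation is of the order of \<^term>\<open>lam\<close>: this is what makes one iteration
  smooth the error. The first-order bound says that \<^term>\<open>K\<close> behaves like a first derivative.\<close>

locale phss_forms =
  fixes n :: nat and P R K :: "nat \<Rightarrow> nat \<Rightarrow> real" and lam c :: real
  assumes lam_pos: "0 < lam" and c_ge: "1 \<le> c"
    and sym_P: "i < n \<Longrightarrow> j < n \<Longrightarrow> P j i = P i j"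
    and sym_R: "i < n \<Longrightarrow> j < n \<Longrightarrow> R j i = R i j"
    and skew_K: "i < n \<Longrightarrow> j < n \<Longrightarrow> K j i = - K i j"
    and coercive: "lam * sqnorm n v \<le> bform n P v v"
    and perturbation: "(bform n R u v - bform n P u v)\<^sup>2 \<le> (c * lam)\<^sup>2 * sqnorm n u * sqnorm n v"
    and P_le_R: "bform n P v v \<le> c * bform n R v v"
    and first_order: "(bform n K u v)\<^sup>2 \<le> c\<^sup>2 * lam * sqnorm n u * bform n P v v"
begin

lemma P_commute: "bform n P u v = bform n P v u"
  using bform_commute[of n P 1 u v] sym_P by simp

lemma K_skew: "bform n K u v = - bform n K v u"
  using bform_commute[where n = n and M = K and s = "-1" and u = u and v = v]
  by (metis mult_minus1 skew_K)

lemma K_self: "bform n K v v = 0"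
  using K_skew[of v v] by simp

lemma P_nonneg: "0 \<le> bform n P v v"
  using coercive[of v] lam_pos sqnorm_nonneg[of n v]
  by (meson less_imp_le mult_nonneg_nonneg order_trans)

lemma R_nonneg: "0 \<le> bform n R v v"
proof -
  have "0 \<le> c * bform n R v v" using P_le_R[of v] P_nonneg[of v] by linarith
  then show ?thesis using c_ge by (simp add: zero_le_mult_iff)
qed

lemma perturbation_energy:
  "(bform n R u v - bform n P u v)\<^sup>2 \<le> c\<^sup>2 * lam * sqnorm n v * bform n P u u"
proof -
  have "(bform n R u v - bform n P u v)\<^sup>2 \<le> c\<^sup>2 * lam * sqnorm n v * (lam * sqnorm n u)"
    using perturbation[of u v] by (simp add: power2_eq_square mult_ac)
  also have "\<dots> \<le> c\<^sup>2 * lam * sqnorm n v * bform n P u u"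
    using coercive[of u] lam_pos by (intro mult_left_mono) auto
  finally show ?thesis .
qed

lemma R_le_P: "bform n R v v \<le> (1 + c) * bform n P v v"
proof -
  have "(bform n R v v - bform n P v v)\<^sup>2 \<le> c\<^sup>2 * (lam * sqnorm n v) * bform n P v v"
    using perturbation_energy[of v v] by (simp add: mult_ac)
  also have "\<dots> \<le> c\<^sup>2 * bform n P v v * bform n P v v"
    using coercive[of v] P_nonneg[of v] by (intro mult_left_mono mult_right_mono) auto
  finally have "(bform n R v v - bform n P v v)\<^sup>2 \<le> (c * bform n P v v)\<^sup>2"
    by (simp add: power2_eq_square mult_ac)
  then have "bform n R v v - bform n P v v \<le> c * bform n P v v"
    by (rule power2_le_imp_le) (use c_ge P_nonneg[of v] in auto)
  then show ?thesis by (simp add: algebra_simps)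
qed

lemma R_Cauchy_Schwarz: "(bform n R u v)\<^sup>2 \<le> bform n R u u * bform n R v v"
  by (intro bform_Cauchy_Schwarz sym_R R_nonneg)

lemma P_pos: "sqnorm n v > 0 \<Longrightarrow> bform n P v v > 0"
  using coercive[of v] lam_pos by (meson less_le_trans mult_pos_pos)

lemma R_pos: "sqnorm n v > 0 \<Longrightarrow> bform n R v v > 0"
  using P_pos[of v] P_le_R[of v] c_ge by (smt (verit) zero_less_mult_pos)

lemma solvable: "\<exists>u. \<forall>i<n. (\<Sum>j<n. P i j * u j) = f i"
proof -
  let ?P = "Matrix.mat n n (\<lambda>(i, j). P i j)"
  have "bform n (\<lambda>i j. ?P $$ (i, j)) v v = bform n P v v" for v
    by (intro bform_cong) simp
  then have "Determinant.det ?P \<noteq> 0"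
    by (intro det_nonzero_of_positive_form[where n = n]) (auto intro: P_pos)
  then obtain v where v: "v \<in> carrier_vec n" "?P *\<^sub>v v = Matrix.vec n f"
    using unique_solution_of_det_nonzero[of ?P n "Matrix.vec n f"] by auto
  have "(\<Sum>j<n. P i j * v $ j) = f i" if "i < n" for i
  proof -
    have "f i = (?P *\<^sub>v v) $ i" using v(2) that by simp
    also have "\<dots> = (\<Sum>j<n. P i j * v $ j)"
      using mult_mat_vec_index[of ?P n v i] v(1) that by simp
    finally show ?thesis by simp
  qed
  then show ?thesis by blast
qed

lemma solution_exists: "\<exists>u. \<forall>e. bform n P e u = bform n M e v"
proof -
  obtain u where "\<forall>i<n. (\<Sum>j<n. P i j * u j) = (\<Sum>j<n. M i j * v j)"
    using solvable[of "\<lambda>i. \<Sum>j<n. M i j * v j"] by blast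
  then have "bform n P e u = bform n M e v" for e
    by (simp add: bform_def mult.assoc sum_distrib_left[symmetric])
  then show ?thesis by blast
qed

text \<open>The half step returns half of the error plus a correction, which solves a problem with the form
  \<open>P + R\<close> and with the data \<open>(P - R) x / 2 - K x\<close>. Tested against itself, the correction is controlled by
  the Euclidean norm of \<open>x\<close>, since \<open>K\<close> is skew and its derivative can be moved to the other argument.\<close>

lemma half_step_stable:
  assumes step: "\<And>e. bform n P e y + bform n R e y = bform n P e x - bform n K e x"
  shows "sqnorm n y \<le> (1 + 8 * c\<^sup>2) * sqnorm n x"
proof -
  define e where "e = (\<lambda>i. y i - (1/2) * x i)"
  define p where "p = bform n P e e"
  have p0: "0 \<le> p" by (simp add: p_def P_nonneg)
  have "bform n P e e + bform n R e e
      = (bform n P e x - bform n R e x) / 2 + bform n K x e"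
  proof -
    have "bform n M e e = bform n M e y - (1/2) * bform n M e x" for M
      using bform_diff_right[of n M e y "\<lambda>i. (1/2) * x i"] bform_scale_right[of n M e "1/2" x]
      by (simp only: e_def[symmetric])
    from this[of P] this[of R] show ?thesis using step[of e] K_skew[of e x] by argo
  qed
  then have p_le: "p \<le> \<bar>bform n R e x - bform n P e x\<bar> / 2 + \<bar>bform n K x e\<bar>"
    using R_nonneg[of e] abs_ge_minus_self[of "bform n R e x - bform n P e x"]
      abs_ge_self[of "bform n K x e"] unfolding p_def by argo
  define s where "s = c\<^sup>2 * lam * sqnorm n x"
  have s0: "0 \<le> s" using lam_pos by (simp add: s_def)
  have "\<bar>bform n R e x - bform n P e x\<bar> \<le> sqrt (s * p)"
    using perturbation_energy[of e x] by (intro real_le_rsqrt) (simp add: s_def p_def)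
  moreover have "\<bar>bform n K x e\<bar> \<le> sqrt (s * p)"
    using first_order[of x e] by (intro real_le_rsqrt) (simp add: s_def p_def)
  ultimately have "p \<le> 3 / 2 * sqrt (s * p)" using p_le by argo
  then have "p\<^sup>2 \<le> (3 / 2 * sqrt (s * p))\<^sup>2" using p0 by (intro power_mono) auto
  also have "\<dots> = (9 / 4 * s) * p" using s0 p0 by (simp add: power_mult_distrib)(simp add: power2_eq_square)
  finally have "p \<le> 9 / 4 * s" by (rule le_of_square_le_mult) (use s0 in simp)
  moreover have "lam * sqnorm n e \<le> p" unfolding p_def by (rule coercive)
  ultimately have "lam * sqnorm n e \<le> lam * (9 / 4 * c\<^sup>2 * sqnorm n x)"
    by (simp add: s_def mult_ac)
  then have e_le: "sqnorm n e \<le> 9 / 4 * c\<^sup>2 * sqnorm n x" using lam_pos by simp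
  have "sqnorm n y = sqnorm n (\<lambda>i. e i + (1/2) * x i)" by (simp add: e_def)
  also have "\<dots> \<le> 2 * sqnorm n e + 2 * sqnorm n (\<lambda>i. (1/2) * x i)" by (rule sqnorm_add_le)
  also have "\<dots> = 2 * sqnorm n e + 1 / 2 * sqnorm n x" unfolding sqnorm_scale by (simp add: power2_eq_square)
  also have "\<dots> \<le> 2 * (9 / 4 * c\<^sup>2 * sqnorm n x) + 1 / 2 * sqnorm n x"
    using e_le by linarith
  also have "\<dots> \<le> (1 + 8 * c\<^sup>2) * sqnorm n x"
    using mult_nonneg_nonneg[OF zero_le_power2[of c] sqnorm_nonneg[of n x]]
      sqnorm_nonneg[of n x] by (simp add: algebra_simps; argo)
  finally show ?thesis .
qed

text \<open>The right-hand side of the full step is \<open>P - R\<close> applied to the half-step error, which is small of order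
  \<^term>\<open>lam\<close>. This gains the factor that is lost when the \<open>P\<close>-norm is compared with the Euclidean norm.\<close>

lemma full_step_smoothing:
  assumes step: "\<And>e. bform n P e z + bform n K e z = bform n P e y - bform n R e y"
  shows "bform n P z z \<le> c\<^sup>2 * lam * sqnorm n y"
proof -
  have "bform n P z z = - (bform n R z y - bform n P z y)"
    using step[of z] K_self[of z] by simp
  then have "(bform n P z z)\<^sup>2 \<le> c\<^sup>2 * lam * sqnorm n y * bform n P z z"
    using perturbation_energy[of z y] by (metis power2_minus)
  then show ?thesis by (rule le_of_square_le_mult) (use lam_pos in simp)
qed

text \<open>The vector \<open>inv P (K x)\<close>, described by its weak form.\<close>

definition rieszK :: "(nat \<Rightarrow> real) \<Rightarrow> nat \<Rightarrow> real" where
  "rieszK x = (SOME q. \<forall>e. bform n P e q = bform n K e x)"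

lemma rieszK: "bform n P e (rieszK x) = bform n K e x"
  using someI_ex[OF solution_exists[of K x]] unfolding rieszK_def by blast

text \<open>The squared \<open>P\<close>-norm of \<open>x + inv P (K x)\<close>, which by skewness is also that of \<open>x - inv P (K x)\<close>. In
  this norm the factor of the iteration that contains \<open>K\<close> is an isometry.\<close>

definition energy :: "(nat \<Rightarrow> real) \<Rightarrow> real" where
  "energy x = bform n P x x + bform n P (rieszK x) (rieszK x)"

lemma energy_le: "energy x \<le> (1 + c\<^sup>2) * bform n P x x"
proof -
  let ?q = "rieszK x"
  have "(bform n P ?q ?q)\<^sup>2 \<le> c\<^sup>2 * (lam * sqnorm n ?q) * bform n P x x"
    using first_order[of ?q x] by (simp add: rieszK mult_ac)
  also have "\<dots> \<le> c\<^sup>2 * bform n P ?q ?q * bform n P x x"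
    using coercive[of ?q] P_nonneg[of x] by (intro mult_left_mono mult_right_mono) auto
  finally have "(bform n P ?q ?q)\<^sup>2 \<le> (c\<^sup>2 * bform n P x x) * bform n P ?q ?q"
    by (simp add: mult_ac)
  then have "bform n P ?q ?q \<le> c\<^sup>2 * bform n P x x"
    by (rule le_of_square_le_mult) (use P_nonneg in simp)
  then show ?thesis by (simp add: energy_def algebra_simps)
qed

text \<open>With \<open>T = inv P R\<close> and the vectors \<open>u = x - inv P (K x)\<close>, \<open>w = z + inv P (K z)\<close>, the two steps read
  \<open>u = y + T y\<close> and \<open>w = y - T y\<close>. Hence the energy drops by exactly four times the \<open>R\<close>-form of \<open>y\<close>, and
  this is a fixed fraction of the energy of \<open>u\<close> because \<open>P\<close> and \<open>R\<close> are comparable.\<close>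

lemma energy_contraction:
  assumes half: "\<And>e. bform n P e y + bform n R e y = bform n P e x - bform n K e x"
    and full: "\<And>e. bform n P e z + bform n K e z = bform n P e y - bform n R e y"
  shows "energy z \<le> (1 - 2 / (1 + 2 * c)) * energy x"
proof -
  obtain t where t: "\<And>e. bform n P e t = bform n R e y"
    using solution_exists[of R y] by blast
  define u where "u = (\<lambda>i. x i - rieszK x i)"
  define w where "w = (\<lambda>i. z i + rieszK z i)"
  have Pu: "bform n P e u = bform n P e y + bform n P e t" for e
    using half[of e] by (simp add: u_def bform_linear rieszK t)
  have Pw: "bform n P e w = bform n P e y - bform n P e t" for e
    using full[of e] by (simp add: w_def bform_linear rieszK t)
  have "energy x = bform n P u u"
    using rieszK[of x x] K_self[of x]
    by (simp add: u_def bform_linear energy_def P_commute[of "rieszK x" x])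
  also have uu: "\<dots> = bform n P y y + bform n P t t + 2 * bform n R y y"
    using Pu[of u] P_commute[of u y] P_commute[of u t] Pu[of y] Pu[of t] P_commute[of t y] t[of y]
    by simp
  finally have Ex: "energy x = bform n P y y + bform n P t t + 2 * bform n R y y" .
  have "energy z = bform n P w w"
    using rieszK[of z z] K_self[of z]
    by (simp add: w_def bform_linear energy_def P_commute[of "rieszK z" z])
  also have "\<dots> = bform n P y y + bform n P t t - 2 * bform n R y y"
    using Pw[of w] P_commute[of w y] P_commute[of w t] Pw[of y] Pw[of t] P_commute[of t y] t[of y]
    by simp
  finally have Ez: "energy z = energy x - 4 * bform n R y y" using Ex by simp
  have "(bform n P t t)\<^sup>2 \<le> bform n R t t * bform n R y y"
    using R_Cauchy_Schwarz[of t y] t[of t] by simp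
  also have "\<dots> \<le> (1 + c) * bform n P t t * bform n R y y"
    using R_le_P[of t] R_nonneg[of y] by (intro mult_right_mono) auto
  finally have "(bform n P t t)\<^sup>2 \<le> (1 + c) * bform n R y y * bform n P t t"
    by (simp add: mult_ac)
  then have "bform n P t t \<le> (1 + c) * bform n R y y"
    by (rule le_of_square_le_mult) (use R_nonneg[of y] c_ge in \<open>simp_all add: mult_ac\<close>)
  then have "energy x \<le> (3 + 2 * c) * bform n R y y"
    using Ex P_le_R[of y] by (simp add: algebra_simps)
  also have "\<dots> \<le> (2 * (1 + 2 * c)) * bform n R y y"
    using R_nonneg[of y] c_ge by (intro mult_right_mono) auto
  finally have "2 / (1 + 2 * c) * energy x \<le> 4 * bform n R y y"
    using c_ge by (simp add: field_simps)
  then show ?thesis using Ez by (simp add: algebra_simps)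
qed

text \<open>Contraction in energy, with the first iteration spent on smoothing: its result has an energy of order
  \<^term>\<open>lam\<close> times the squared Euclidean norm of the initial error, and coercivity at the end divides by
  \<^term>\<open>lam\<close> again. No power of \<^term>\<open>lam\<close> survives.\<close>

lemma errors_decay:
  assumes half: "\<And>k e. bform n P e (y k) + bform n R e (y k) = bform n P e (x k) - bform n K e (x k)"
    and full: "\<And>k e. bform n P e (x (Suc k)) + bform n K e (x (Suc k))
                    = bform n P e (y k) - bform n R e (y k)"
  shows "sqnorm n (x k) \<le> 3 * (1 + c\<^sup>2) * c\<^sup>2 * (1 + 8 * c\<^sup>2) * (1 - 2 / (1 + 2 * c)) ^ k * sqnorm n (x 0)"
proof -
  \<comment> \<open>Since \<open>c \<ge> 1\<close>, the rate is at least 1/3; one factor of it is given away for the smoothing step.\<close>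
  define \<theta> where "\<theta> = 1 - 2 / (1 + 2 * c)"
  have th: "1 / 3 \<le> \<theta>" using c_ge by (simp add: \<theta>_def field_simps)
  define D where "D = (1 + c\<^sup>2) * c\<^sup>2 * (1 + 8 * c\<^sup>2)"
  have c2: "1 \<le> c\<^sup>2" using c_ge by simp
  have "1 * 1 * 1 \<le> D" unfolding D_def using c2 by (intro mult_mono) auto
  then have D1: "1 \<le> D" by simp
  show ?thesis
  proof (cases k)
    case 0
    have "1 * sqnorm n (x 0) \<le> 3 * D * sqnorm n (x 0)"
      using D1 by (intro mult_right_mono) auto
    then show ?thesis using 0 by (simp add: D_def mult_ac del: distrib_left_numeral)
  next
    case (Suc j)
    have en: "energy (x (Suc j)) \<le> \<theta> ^ j * energy (x 1)" for j
    proof (induction j)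
      case (Suc j)
      have "energy (x (Suc (Suc j))) \<le> \<theta> * energy (x (Suc j))"
        unfolding \<theta>_def by (rule energy_contraction[OF half full])
      also have "\<dots> \<le> \<theta> * (\<theta> ^ j * energy (x 1))"
        using Suc th by (intro mult_left_mono) auto
      finally show ?case by simp
    qed simp
    have "lam * sqnorm n (x k) \<le> bform n P (x k) (x k)" by (rule coercive)
    also have "\<dots> \<le> energy (x k)" by (simp add: energy_def P_nonneg)
    also have "\<dots> \<le> \<theta> ^ j * energy (x 1)" using en Suc by simp
    also have "\<dots> \<le> \<theta> ^ j * ((1 + c\<^sup>2) * (c\<^sup>2 * lam * ((1 + 8 * c\<^sup>2) * sqnorm n (x 0))))"
    proof (rule mult_left_mono)
      have "energy (x 1) \<le> (1 + c\<^sup>2) * bform n P (x 1) (x 1)" by (rule energy_le)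
      also have "\<dots> \<le> (1 + c\<^sup>2) * (c\<^sup>2 * lam * sqnorm n (y 0))"
        using full_step_smoothing[of "x 1" "y 0"] full[of _ 0] by (intro mult_left_mono) auto
      also have "\<dots> \<le> (1 + c\<^sup>2) * (c\<^sup>2 * lam * ((1 + 8 * c\<^sup>2) * sqnorm n (x 0)))"
        using half_step_stable[of "y 0" "x 0"] half[of _ 0] lam_pos by (intro mult_left_mono) auto
      finally show "energy (x 1) \<le> (1 + c\<^sup>2) * (c\<^sup>2 * lam * ((1 + 8 * c\<^sup>2) * sqnorm n (x 0)))" .
    qed (use th in simp)
    also have "\<dots> = lam * (D * \<theta> ^ j * sqnorm n (x 0))" by (simp add: D_def mult_ac)
    finally have "sqnorm n (x k) \<le> D * \<theta> ^ j * sqnorm n (x 0)" using lam_pos by simp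
    also have "\<dots> \<le> D * (3 * \<theta> ^ k) * sqnorm n (x 0)"
    proof (intro mult_right_mono mult_left_mono)
      have "\<theta> ^ j * 1 \<le> \<theta> ^ j * (3 * \<theta>)" using th by (intro mult_left_mono) auto
      then show "\<theta> ^ j \<le> 3 * \<theta> ^ k" using Suc by (simp add: mult_ac)
    qed (use D1 in auto)
    finally show ?thesis by (simp add: D_def \<theta>_def mult_ac del: distrib_left_numeral)
  qed
qed

end

section \<open>The complex iteration\<close>

definition sym_entry :: "real mat \<Rightarrow> nat \<Rightarrow> nat \<Rightarrow> real" where
  "sym_entry A i j = (A $$ (i, j) + A $$ (j, i)) / 2"

definition skew_entry :: "real mat \<Rightarrow> nat \<Rightarrow> nat \<Rightarrow> real" where
  "skew_entry A i j = (A $$ (i, j) - A $$ (j, i)) / 2"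

lemma one_plus_left_inverse_mult:
  fixes P :: "complex mat"
  assumes "P \<in> carrier_mat n n" "Q \<in> carrier_mat n n" "M \<in> carrier_mat n n" "Q * P = 1\<^sub>m n"
  shows "complex_of_real 1 \<cdot>\<^sub>m 1\<^sub>m n + Q * M = Q * (P + M)"
    and "complex_of_real 1 \<cdot>\<^sub>m 1\<^sub>m n - Q * M = Q * (P - M)"
proof -
  have one: "complex_of_real 1 \<cdot>\<^sub>m 1\<^sub>m n = (1\<^sub>m n :: complex mat)" by (rule eq_matI) auto
  show "complex_of_real 1 \<cdot>\<^sub>m 1\<^sub>m n + Q * M = Q * (P + M)"
    and "complex_of_real 1 \<cdot>\<^sub>m 1\<^sub>m n - Q * M = Q * (P - M)"
    unfolding one using assms
    by (simp_all add: mult_add_distrib_mat[of Q n n] mult_minus_distrib_mat[of Q n n])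
qed

lemma left_invertible_cancel:
  fixes P :: "complex mat"
  assumes "P \<in> carrier_mat n n" "Q \<in> carrier_mat n n" "P * Q = 1\<^sub>m n"
    "u \<in> carrier_vec n" "v \<in> carrier_vec n"
  shows "Q *\<^sub>v u = Q *\<^sub>v v \<longleftrightarrow> u = v"
proof
  assume "Q *\<^sub>v u = Q *\<^sub>v v"
  then have "(P * Q) *\<^sub>v u = (P * Q) *\<^sub>v v"
    using assms(4,5) by (simp add: assoc_mult_mat_vec[OF assms(1,2)])
  then show "u = v" unfolding assms(3) using assms(4,5) by simp
qed simp

text \<open>Multiplying by \<open>P\<close> removes the preconditioner from a step: both steps become linear systems with the
  matrices \<open>P + R\<close> and \<open>P + K\<close>, whose quadratic forms are positive.\<close>

lemma preconditioned_step_iff: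
  fixes P :: "complex mat"
  assumes P: "P \<in> carrier_mat n n" and Q: "Q \<in> carrier_mat n n"
    and QP: "Q * P = 1\<^sub>m n" and PQ: "P * Q = 1\<^sub>m n"
    and M: "M \<in> carrier_mat n n" and M': "M' \<in> carrier_mat n n"
    and v: "x \<in> carrier_vec n" "y \<in> carrier_vec n" "b \<in> carrier_vec n"
  shows "(complex_of_real 1 \<cdot>\<^sub>m 1\<^sub>m n + Q * M) *\<^sub>v y
       = (complex_of_real 1 \<cdot>\<^sub>m 1\<^sub>m n - Q * M') *\<^sub>v x + Q *\<^sub>v b
     \<longleftrightarrow> (P + M) *\<^sub>v y = (P - M') *\<^sub>v x + b"
proof -
  have c: "(P + M) *\<^sub>v y \<in> carrier_vec n" "(P - M') *\<^sub>v x \<in> carrier_vec n"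
    using M M' v by (auto intro!: mult_mat_vec_carrier minus_carrier_mat)
  have "(complex_of_real 1 \<cdot>\<^sub>m 1\<^sub>m n + Q * M) *\<^sub>v y = Q *\<^sub>v ((P + M) *\<^sub>v y)"
    unfolding one_plus_left_inverse_mult(1)[OF P Q M QP] using P Q M v by (intro assoc_mult_mat_vec) auto
  moreover have "(complex_of_real 1 \<cdot>\<^sub>m 1\<^sub>m n - Q * M') *\<^sub>v x + Q *\<^sub>v b = Q *\<^sub>v ((P - M') *\<^sub>v x + b)"
    unfolding one_plus_left_inverse_mult(2)[OF P Q M' QP] using P Q M' v c
    by (simp only: mult_add_distrib_mat_vec[OF Q c(2) v(3)]
      assoc_mult_mat_vec[OF Q minus_carrier_mat[OF M'] v(1)])
  ultimately show ?thesis
    using left_invertible_cancel[OF P Q PQ, of "(P + M) *\<^sub>v y" "(P - M') *\<^sub>v x + b"] c v by auto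
qed

lemma vec_norm2_split:
  assumes "v \<in> carrier_vec n"
  shows "(vec_norm2 v)\<^sup>2 = sqnorm n (\<lambda>j. Re (v $ j)) + sqnorm n (\<lambda>j. Im (v $ j))"
  using assms by (simp add: vec_norm2_def L2_set_def sum_nonneg sqnorm_def cmod_power2 sum.distrib)

lemma vec_norm2_nonneg [simp]: "0 \<le> vec_norm2 v"
  by (simp add: vec_norm2_def)

locale phss_system =
  fixes n :: nat and A P :: "real mat" and b :: "real vec" and lam c :: real
  assumes A_carrier: "A \<in> carrier_mat n n" and P_carrier: "P \<in> carrier_mat n n"
    and b_carrier: "b \<in> carrier_vec n"
    and forms: "phss_forms n (\<lambda>i j. P $$ (i, j)) (sym_entry A) (skew_entry A) lam c"
begin

sublocale phss_forms n "\<lambda>i j. P $$ (i, j)" "sym_entry A" "skew_entry A" lam c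
  by (rule forms)

abbreviation "cA \<equiv> map_mat complex_of_real A"
abbreviation "cP \<equiv> map_mat complex_of_real P"
abbreviation "cb \<equiv> map_vec complex_of_real b"
definition "symA = Matrix.mat n n (\<lambda>(i, j). sym_entry A i j)"
definition "skewA = Matrix.mat n n (\<lambda>(i, j). skew_entry A i j)"
abbreviation "cR \<equiv> map_mat complex_of_real symA"
abbreviation "cK \<equiv> map_mat complex_of_real skewA"

lemma carriers [simp]:
  "A \<in> carrier_mat n n" "P \<in> carrier_mat n n" "b \<in> carrier_vec n"
  "symA \<in> carrier_mat n n" "skewA \<in> carrier_mat n n"
  using A_carrier P_carrier b_carrier by (simp_all add: symA_def skewA_def)

lemma dims [simp]: "dim_row A = n" "dim_col A = n" "dim_row P = n" "dim_col P = n" "dim_vec b = n"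
  "dim_row symA = n" "dim_col symA = n" "dim_row skewA = n" "dim_col skewA = n"
  using carriers unfolding carrier_mat_def carrier_vec_def by blast+

lemma entry [simp]: "i < n \<Longrightarrow> j < n \<Longrightarrow> symA $$ (i, j) = sym_entry A i j"
  "i < n \<Longrightarrow> j < n \<Longrightarrow> skewA $$ (i, j) = skew_entry A i j"
  by (simp_all add: symA_def skewA_def)

lemma Re_mat_eq: "Re_mat cA = cR"
  by (rule eq_matI) (auto simp: Re_mat_def sym_entry_def)

lemma Im_mat_eq: "\<i> \<cdot>\<^sub>m Im_mat cA = cK"
  by (rule eq_matI) (auto simp: Im_mat_def skew_entry_def field_simps)

lemma A_split: "A = symA + skewA"
  by (rule eq_matI) (auto simp: sym_entry_def skew_entry_def field_simps)

lemma bform_sum: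
  "bform n (\<lambda>i j. (P + symA) $$ (i, j)) u v = bform n (\<lambda>i j. P $$ (i, j)) u v + bform n (sym_entry A) u v"
  "bform n (\<lambda>i j. (P + skewA) $$ (i, j)) u v = bform n (\<lambda>i j. P $$ (i, j)) u v + bform n (skew_entry A) u v"
  "bform n (\<lambda>i j. A $$ (i, j)) u v = bform n (sym_entry A) u v + bform n (skew_entry A) u v"
  unfolding bform_add_matrix[symmetric]
  by (auto intro!: bform_cong simp: sym_entry_def skew_entry_def field_simps)

lemma nonsingular:
  "Determinant.det cA \<noteq> 0" "Determinant.det cP \<noteq> 0" "Determinant.det (cP + cR) \<noteq> 0" "Determinant.det (cP + cK) \<noteq> 0"
proof -
  have eq: "cP + cR = map_mat complex_of_real (P + symA)" "cP + cK = map_mat complex_of_real (P + skewA)"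
    by (auto intro!: eq_matI)
  have "Determinant.det A \<noteq> 0" "Determinant.det P \<noteq> 0" "Determinant.det (P + symA) \<noteq> 0" "Determinant.det (P + skewA) \<noteq> 0"
    by (rule det_nonzero_of_positive_form[of _ n];
        auto simp: bform_sum K_self intro: P_pos R_pos add_pos_pos)+
  then show "Determinant.det cA \<noteq> 0" "Determinant.det cP \<noteq> 0" "Determinant.det (cP + cR) \<noteq> 0" "Determinant.det (cP + cK) \<noteq> 0"
    unfolding eq by simp_all
qed

lemma inverse_exists:
  obtains Q where "mat_inverse cP = Some Q"
    "Q \<in> carrier_mat n n" "Q * cP = 1\<^sub>m n" "cP * Q = 1\<^sub>m n"
proof -
  have cP: "cP \<in> carrier_mat n n" by simp
  show ?thesis
    using that mat_inverse(1)[OF cP, of "()"] mat_inverse(2)[OF cP]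
      det_non_zero_imp_unit[OF cP nonsingular(2), of "()"]
    by (cases "mat_inverse cP") auto
qed

lemma iterates_iff:
  "phss_iterates 1 cP cA cb x0 x y \<longleftrightarrow> x 0 = x0 \<and>
     (\<forall>k. x k \<in> carrier_vec n \<and> y k \<in> carrier_vec n \<and>
        (cP + cR) *\<^sub>v y k = (cP - cK) *\<^sub>v x k + cb \<and>
        (cP + cK) *\<^sub>v x (Suc k) = (cP - cR) *\<^sub>v y k + cb)"
proof -
  obtain Q where Q: "mat_inverse cP = Some Q"
    and Q': "Q \<in> carrier_mat n n" "Q * cP = 1\<^sub>m n" "cP * Q = 1\<^sub>m n"
    by (rule inverse_exists)
  have half: "phss_half_step 1 Q cA cb u v \<longleftrightarrow> (cP + cR) *\<^sub>v v = (cP - cK) *\<^sub>v u + cb"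
    and full: "phss_full_step 1 Q cA cb u v \<longleftrightarrow> (cP + cK) *\<^sub>v v = (cP - cR) *\<^sub>v u + cb"
    if "u \<in> carrier_vec n" "v \<in> carrier_vec n" for u v
    unfolding phss_half_step_def phss_full_step_def Re_mat_eq Im_mat_eq
    using preconditioned_step_iff[of cP n Q cR cK u v cb] preconditioned_step_iff[of cP n Q cK cR u v cb]
      Q' that by simp_all
  show ?thesis
    unfolding phss_iterates_def Q using half full by (simp del: of_real_1) blast
qed

lemma iterates_unique:
  assumes x0: "x0 \<in> carrier_vec n"
  shows "\<exists>!xy. phss_iterates 1 cP cA cb x0 (fst xy) (snd xy)"
proof -
  have Mc: "cP + cR \<in> carrier_mat n n" "cP + cK \<in> carrier_mat n n"
    "cP - cR \<in> carrier_mat n n" "cP - cK \<in> carrier_mat n n"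
    by (simp_all add: minus_carrier_mat)
  define F where "F u = (THE v. v \<in> carrier_vec n \<and> (cP + cR) *\<^sub>v v = (cP - cK) *\<^sub>v u + cb)" for u
  define G where "G u = (THE v. v \<in> carrier_vec n \<and> (cP + cK) *\<^sub>v v = (cP - cR) *\<^sub>v u + cb)" for u
  have F: "v \<in> carrier_vec n \<and> (cP + cR) *\<^sub>v v = (cP - cK) *\<^sub>v u + cb \<longleftrightarrow> v = F u"
    if "u \<in> carrier_vec n" for u v
    unfolding F_def
    by (rule iffI, rule the1_equality[symmetric],
        rule unique_solution_of_det_nonzero[OF Mc(1) nonsingular(3)], use Mc that in simp, simp,
        hypsubst, rule theI', rule unique_solution_of_det_nonzero[OF Mc(1) nonsingular(3)], use Mc that in simp)
  have G: "v \<in> carrier_vec n \<and> (cP + cK) *\<^sub>v v = (cP - cR) *\<^sub>v u + cb \<longleftrightarrow> v = G u"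
    if "u \<in> carrier_vec n" for u v
    unfolding G_def
    by (rule iffI, rule the1_equality[symmetric],
        rule unique_solution_of_det_nonzero[OF Mc(2) nonsingular(4)], use Mc that in simp, simp,
        hypsubst, rule theI', rule unique_solution_of_det_nonzero[OF Mc(2) nonsingular(4)], use Mc that in simp)
  define X where "X k = ((\<lambda>u. G (F u)) ^^ k) x0" for k
  have Xc: "X k \<in> carrier_vec n" for k
  proof (induction k)
    case (Suc k)
    then show ?case using F[of "X k" "F (X k)"] G[of "F (X k)" "G (F (X k))"] by (simp add: X_def)
  qed (use x0 in \<open>simp add: X_def\<close>)
  have Fc: "F (X k) \<in> carrier_vec n" for k using F[OF Xc[of k], of "F (X k)"] by simp
  have iff: "phss_iterates 1 cP cA cb x0 x y \<longleftrightarrow> x = X \<and> y = (\<lambda>k. F (X k))" for x y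
  proof
    assume "x = X \<and> y = (\<lambda>k. F (X k))"
    then show "phss_iterates 1 cP cA cb x0 x y"
      unfolding iterates_iff using F[OF Xc] G[OF Fc] Xc by (auto simp: X_def)
  next
    assume "phss_iterates 1 cP cA cb x0 x y"
    then have it: "x 0 = x0" "\<And>k. x k \<in> carrier_vec n" "\<And>k. y k = F (x k)" "\<And>k. x (Suc k) = G (y k)"
      unfolding iterates_iff using F G by blast+
    have "x k = X k" for k by (induction k) (simp_all add: it X_def)
    then show "x = X \<and> y = (\<lambda>k. F (X k))" using it(3) by auto
  qed
  show ?thesis
    by (rule ex1I[of _ "(X, \<lambda>k. F (X k))"]) (auto simp: iff prod_eq_iff)
qed

text \<open>All matrices are real, so the real and the imaginary parts of the errors satisfy the weak equations
  separately. Symmetric and skew part enter the two steps in opposite roles, hence the abstract splitting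
  into \<^term>\<open>M\<close> and \<^term>\<open>M'\<close>.\<close>

lemma component_equation:
  assumes \<phi>: "\<phi> = Re \<or> \<phi> = Im"
    and M: "M \<in> carrier_mat n n" "M' \<in> carrier_mat n n"
    and split: "A = M + M'"
    and s: "s \<in> carrier_vec n" "cA *\<^sub>v s = cb"
    and v: "x \<in> carrier_vec n" "y \<in> carrier_vec n"
    and eq: "(cP + map_mat complex_of_real M) *\<^sub>v y = (cP - map_mat complex_of_real M') *\<^sub>v x + cb"
  defines "ey \<equiv> \<lambda>j. \<phi> ((y - s) $ j)" and "ex \<equiv> \<lambda>j. \<phi> ((x - s) $ j)"
  shows "bform n (\<lambda>i j. P $$ (i, j)) e ey + bform n (\<lambda>i j. M $$ (i, j)) e ey
       = bform n (\<lambda>i j. P $$ (i, j)) e ex - bform n (\<lambda>i j. M' $$ (i, j)) e ex"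
proof -
  have dimM: "dim_row M = n" "dim_col M = n" "dim_row M' = n" "dim_col M' = n" using M by auto
  have row: "(\<Sum>j<n. P $$ (i, j) * ey j) + (\<Sum>j<n. M $$ (i, j) * ey j)
      = (\<Sum>j<n. P $$ (i, j) * ex j) - (\<Sum>j<n. M' $$ (i, j) * ex j)" if i: "i < n" for i
  proof -
    have s_i: "cb $ i = (\<Sum>j<n. complex_of_real (A $$ (i, j)) * s $ j)"
      using mult_mat_vec_index[of cA n s i] s i by simp
    have "((cP + map_mat complex_of_real M) *\<^sub>v y) $ i
        = (\<Sum>j<n. complex_of_real (P $$ (i, j) + M $$ (i, j)) * y $ j)"
      using mult_mat_vec_index[of "cP + map_mat complex_of_real M" n y i] M v i dimM by simp
    moreover have "((cP - map_mat complex_of_real M') *\<^sub>v x) $ i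
        = (\<Sum>j<n. complex_of_real (P $$ (i, j) - M' $$ (i, j)) * x $ j)"
      using mult_mat_vec_index[of "cP - map_mat complex_of_real M'" n x i] M v i dimM
      by (simp add: minus_carrier_mat)
    moreover have "((cP - map_mat complex_of_real M') *\<^sub>v x + cb) $ i
      = ((cP - map_mat complex_of_real M') *\<^sub>v x) $ i + cb $ i"
      using i by simp
    ultimately have "(\<Sum>j<n. complex_of_real (P $$ (i, j) + M $$ (i, j)) * y $ j)
      = (\<Sum>j<n. complex_of_real (P $$ (i, j) - M' $$ (i, j)) * x $ j)
      + (\<Sum>j<n. complex_of_real (A $$ (i, j)) * s $ j)"
      using arg_cong[OF eq, of "\<lambda>w. w $ i"] s_i by argo
    then have "\<phi> (\<Sum>j<n. complex_of_real (P $$ (i, j) + M $$ (i, j)) * y $ j)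
      = \<phi> ((\<Sum>j<n. complex_of_real (P $$ (i, j) - M' $$ (i, j)) * x $ j)
      + (\<Sum>j<n. complex_of_real (A $$ (i, j)) * s $ j))"
      by (rule arg_cong)
    then have main: "(\<Sum>j<n. (P $$ (i, j) + M $$ (i, j)) * \<phi> (y $ j))
      = (\<Sum>j<n. (P $$ (i, j) - M' $$ (i, j)) * \<phi> (x $ j)) + (\<Sum>j<n. A $$ (i, j) * \<phi> (s $ j))"
      using \<phi> by (elim disjE) simp_all
    have A_ij: "A $$ (i, j) = M $$ (i, j) + M' $$ (i, j)" if "j < n" for j
      unfolding split using i that dimM by simp
    have e: "ey j = \<phi> (y $ j) - \<phi> (s $ j)" "ex j = \<phi> (x $ j) - \<phi> (s $ j)" if "j < n" for j
      using that v s \<phi> by (auto simp: ey_def ex_def)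
    have "(\<Sum>j<n. A $$ (i, j) * \<phi> (s $ j)) = (\<Sum>j<n. (M $$ (i, j) + M' $$ (i, j)) * \<phi> (s $ j))"
      using A_ij by simp
    with main show ?thesis
      by (simp add: e algebra_simps sum.distrib sum_subtractf)
  qed
  have "(\<Sum>i<n. e i * ((\<Sum>j<n. P $$ (i, j) * ey j) + (\<Sum>j<n. M $$ (i, j) * ey j)))
     = (\<Sum>i<n. e i * ((\<Sum>j<n. P $$ (i, j) * ex j) - (\<Sum>j<n. M' $$ (i, j) * ex j)))"
    using row by simp
  then show ?thesis
    by (simp add: bform_def distrib_left right_diff_distrib sum.distrib sum_subtractf sum_distrib_left mult.assoc)
qed

lemma error_bound:
  assumes s: "s \<in> carrier_vec n" "cA *\<^sub>v s = cb" and it: "phss_iterates 1 cP cA cb x0 x y"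
  shows "vec_norm2 (x k - s) \<le> sqrt (3 * (1 + c\<^sup>2) * c\<^sup>2 * (1 + 8 * c\<^sup>2)) * sqrt (1 - 2 / (1 + 2 * c)) ^ k
      * vec_norm2 (x0 - s)"
proof -
  define D where "D = 3 * (1 + c\<^sup>2) * c\<^sup>2 * (1 + 8 * c\<^sup>2)"
  define \<theta> where "\<theta> = 1 - 2 / (1 + 2 * c)"
  have D0: "0 \<le> D" unfolding D_def by (intro mult_nonneg_nonneg add_nonneg_nonneg) auto
  have th: "0 \<le> \<theta>" using c_ge by (simp add: \<theta>_def field_simps)
  have x: "\<And>k. x k \<in> carrier_vec n" and y: "\<And>k. y k \<in> carrier_vec n" and x0: "x 0 = x0"
    and half: "\<And>k. (cP + cR) *\<^sub>v y k = (cP - cK) *\<^sub>v x k + cb"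
    and full: "\<And>k. (cP + cK) *\<^sub>v x (Suc k) = (cP - cR) *\<^sub>v y k + cb"
    using it unfolding iterates_iff by auto
  have A_split': "A = skewA + symA" using A_split comm_add_mat[of symA n n skewA] by simp
  have cong: "bform n (\<lambda>i j. symA $$ (i, j)) e v = bform n (sym_entry A) e v"
    "bform n (\<lambda>i j. skewA $$ (i, j)) e v = bform n (skew_entry A) e v" for e v
    by (auto intro: bform_cong)
  have part: "sqnorm n (\<lambda>j. \<phi> ((x k - s) $ j)) \<le> D * \<theta> ^ k * sqnorm n (\<lambda>j. \<phi> ((x 0 - s) $ j))"
    if "\<phi> = Re \<or> \<phi> = Im" for \<phi> k
    unfolding D_def \<theta>_def
  proof (rule errors_decay[where x = "\<lambda>k j. \<phi> ((x k - s) $ j)" and y = "\<lambda>k j. \<phi> ((y k - s) $ j)"])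
    fix k e
    show "bform n (\<lambda>i j. P $$ (i, j)) e (\<lambda>j. \<phi> ((y k - s) $ j)) + bform n (sym_entry A) e (\<lambda>j. \<phi> ((y k - s) $ j))
      = bform n (\<lambda>i j. P $$ (i, j)) e (\<lambda>j. \<phi> ((x k - s) $ j)) - bform n (skew_entry A) e (\<lambda>j. \<phi> ((x k - s) $ j))"
      using component_equation[OF that _ _ A_split s x y half] by (simp add: cong)
    show "bform n (\<lambda>i j. P $$ (i, j)) e (\<lambda>j. \<phi> ((x (Suc k) - s) $ j)) + bform n (skew_entry A) e (\<lambda>j. \<phi> ((x (Suc k) - s) $ j))
      = bform n (\<lambda>i j. P $$ (i, j)) e (\<lambda>j. \<phi> ((y k - s) $ j)) - bform n (sym_entry A) e (\<lambda>j. \<phi> ((y k - s) $ j))"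
      using component_equation[OF that _ _ A_split' s y x full] by (simp add: cong)
  qed
  have norm: "(vec_norm2 (x k - s))\<^sup>2 = sqnorm n (\<lambda>j. Re ((x k - s) $ j)) + sqnorm n (\<lambda>j. Im ((x k - s) $ j))" for k
    by (rule vec_norm2_split) (use x s in simp)
  have "(vec_norm2 (x k - s))\<^sup>2 \<le> D * \<theta> ^ k * (vec_norm2 (x 0 - s))\<^sup>2"
    unfolding norm using part[of Re k] part[of Im k] by (simp add: distrib_left)
  also have "\<dots> = (sqrt D * sqrt \<theta> ^ k * vec_norm2 (x0 - s))\<^sup>2"
    using D0 th by (simp add: power_mult_distrib x0 flip: power_mult)
      (simp add: mult.commute[of k 2] power_mult)
  finally show ?thesis
    unfolding D_def[symmetric] \<theta>_def[symmetric]
    by (rule power2_le_imp_le) (use D0 th in simp)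
qed

end

lemma phss_optimally_convergent_of_forms:
  assumes sys: "\<And>m. m \<ge> 1 \<Longrightarrow> phss_system (N m) (A m) (P m) (b m) (lam m) c"
  shows "phss_optimally_convergent 1 (\<lambda>m. map_mat complex_of_real (P m))
    (\<lambda>m. map_mat complex_of_real (A m)) (\<lambda>m. map_vec complex_of_real (b m))"
proof -
  have c: "1 \<le> c" using sys[of 1] by (simp add: phss_system_def phss_forms_def)
  define C where "C = sqrt (3 * (1 + c\<^sup>2) * c\<^sup>2 * (1 + 8 * c\<^sup>2))"
  define \<rho> where "\<rho> = sqrt (1 - 2 / (1 + 2 * c))"
  have rho: "0 \<le> \<rho>" "\<rho> < 1" using c by (auto simp: \<rho>_def field_simps)
  have dimA: "dim_row (A m) = N m" if "m \<ge> 1" for m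
    using phss_system.dims(1)[OF sys[OF that]] .
  have bound: "vec_norm2 (x k - s) \<le> C * \<rho> ^ k * vec_norm2 (x0 - s)"
    if "m \<ge> 1" "s \<in> carrier_vec (dim_row (map_mat complex_of_real (A m)))"
      "map_mat complex_of_real (A m) *\<^sub>v s = map_vec complex_of_real (b m)"
      "phss_iterates 1 (map_mat complex_of_real (P m)) (map_mat complex_of_real (A m))
         (map_vec complex_of_real (b m)) x0 x y" for m s x0 x y k
    using phss_system.error_bound[OF sys[OF that(1)] _ that(3,4)] that(1,2) dimA
    by (simp add: C_def \<rho>_def)
  have "phss_well_defined 1 (\<lambda>m. map_mat complex_of_real (P m))
    (\<lambda>m. map_mat complex_of_real (A m)) (\<lambda>m. map_vec complex_of_real (b m))"
    unfolding phss_well_defined_def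
  proof (intro allI impI conjI ballI)
    fix m :: nat assume m: "m \<ge> 1"
    interpret phss_system "N m" "A m" "P m" "b m" "lam m" c by (rule sys[OF m])
    show "\<exists>!s. s \<in> carrier_vec (dim_row cA) \<and> cA *\<^sub>v s = cb"
      using unique_solution_of_det_nonzero[of cA "N m" cb] nonsingular(1) by simp
    show "\<exists>!xy. phss_iterates 1 cP cA cb x0 (fst xy) (snd xy)"
      if "x0 \<in> carrier_vec (dim_row cA)" for x0
      using iterates_unique[of x0] that by simp
  qed
  moreover have "phss_uniformly_linear 1 (\<lambda>m. map_mat complex_of_real (P m))
    (\<lambda>m. map_mat complex_of_real (A m)) (\<lambda>m. map_vec complex_of_real (b m))"
    unfolding phss_uniformly_linear_def using bound rho
    by (intro exI[of _ C] exI[of _ \<rho>]) blast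
  moreover have "phss_bounded_iterations 1 (\<lambda>m. map_mat complex_of_real (P m))
    (\<lambda>m. map_mat complex_of_real (A m)) (\<lambda>m. map_vec complex_of_real (b m))"
    unfolding phss_bounded_iterations_def
  proof (intro allI impI)
    fix \<epsilon> :: real assume eps: "\<epsilon> > 0"
    have "(\<lambda>k. C * \<rho> ^ k) \<longlonglongrightarrow> C * 0"
      using rho by (intro tendsto_mult_left LIMSEQ_power_zero) auto
    then have "eventually (\<lambda>k. C * \<rho> ^ k < \<epsilon>) sequentially"
      using eps by (auto dest: order_tendstoD(2))
    then obtain K where K: "\<And>k. k \<ge> K \<Longrightarrow> C * \<rho> ^ k < \<epsilon>"
      by (auto simp: eventually_sequentially)
    have "vec_norm2 (x k - s) \<le> \<epsilon> * vec_norm2 (x0 - s)"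
      if "m \<ge> 1" "s \<in> carrier_vec (dim_row (map_mat complex_of_real (A m)))"
        "map_mat complex_of_real (A m) *\<^sub>v s = map_vec complex_of_real (b m)"
        "phss_iterates 1 (map_mat complex_of_real (P m)) (map_mat complex_of_real (A m))
         (map_vec complex_of_real (b m)) x0 x y" "k \<ge> K" for m s x0 x y k
      using bound[OF that(1-4), of k] K[OF that(5)]
      by (smt (verit) mult_right_mono vec_norm2_nonneg)
    then show "\<exists>K. \<forall>m\<ge>1. \<forall>s\<in>carrier_vec (dim_row (map_mat complex_of_real (A m))). \<forall>x0 x y.
        map_mat complex_of_real (A m) *\<^sub>v s = map_vec complex_of_real (b m) \<longrightarrow>
        phss_iterates 1 (map_mat complex_of_real (P m)) (map_mat complex_of_real (A m))
         (map_vec complex_of_real (b m)) x0 x y \<longrightarrow>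
        (\<forall>k\<ge>K. vec_norm2 (x k - s) \<le> \<epsilon> * vec_norm2 (x0 - s))"
      by blast
  qed
  ultimately show ?thesis unfolding phss_optimally_convergent_def by blast
qed

section \<open>The hat function on the integer lattice\<close>

text \<open>The Kronecker symbol of the integer lattice: the nodal values of the hat function at the origin.\<close>

definition kron :: "int \<Rightarrow> int \<Rightarrow> real" where
  "kron k l = (if k = 0 \<and> l = 0 then 1 else 0)"

fun hat :: "diagonal \<Rightarrow> real \<Rightarrow> real \<Rightarrow> real" where
  "hat Rising s t = max 0 (min (1 - \<bar>s\<bar>) (min (1 - \<bar>t\<bar>) (1 - \<bar>s - t\<bar>)))"
| "hat Falling s t = max 0 (min (1 - \<bar>s\<bar>) (min (1 - \<bar>t\<bar>) (1 - \<bar>s + t\<bar>)))"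

fun upper :: "diagonal \<Rightarrow> real \<Rightarrow> real \<Rightarrow> bool" where
  "upper Rising s t \<longleftrightarrow> s < t"
| "upper Falling s t \<longleftrightarrow> 1 < s + t"

text \<open>Each triangle has one horizontal and one vertical side. \<open>hrow\<close> is the row of the horizontal side and
  \<open>vcol\<close> the column of the vertical side, relative to the lower left corner of the cell; the gradient of a
  piecewise linear function consists of its increments along these two sides.\<close>

definition hrow :: "diagonal \<Rightarrow> bool \<Rightarrow> int" where
  "hrow d u = (if u then 1 else 0)"

definition vcol :: "diagonal \<Rightarrow> bool \<Rightarrow> int" where
  "vcol d u = (if u = (d = Falling) then 1 else 0)"

lemma max_min_eqI:
  fixes a b c v :: real
  assumes "0 \<le> v \<and> v \<le> a \<and> v \<le> b \<and> v \<le> c \<and> (v = a \<or> v = b \<or> v = c)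
    \<or> v = 0 \<and> (a \<le> 0 \<or> b \<le> 0 \<or> c \<le> 0)"
  shows "max 0 (min a (min b c)) = v"
  using assms by (auto simp: max_def min_def)

lemma hat_Rising_eqI:
  assumes "0 \<le> v \<and> v \<le> 1 - \<bar>s\<bar> \<and> v \<le> 1 - \<bar>t\<bar> \<and> v \<le> 1 - \<bar>s - t\<bar> \<and>
      (v = 1 - \<bar>s\<bar> \<or> v = 1 - \<bar>t\<bar> \<or> v = 1 - \<bar>s - t\<bar>)
    \<or> v = 0 \<and> (1 \<le> \<bar>s\<bar> \<or> 1 \<le> \<bar>t\<bar> \<or> 1 \<le> \<bar>s - t\<bar>)"
  shows "hat Rising s t = v"
  unfolding hat.simps by (rule max_min_eqI) (use assms in argo)

text \<open>Barycentric interpolation on each triangle, of which only the cells touching the origin need checking.\<close>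

lemma hat_Rising_affine:
  assumes "0 \<le> \<sigma>" "\<sigma> \<le> 1" "0 \<le> \<tau>" "\<tau> \<le> 1"
  shows "(\<tau> \<le> \<sigma> \<longrightarrow> hat Rising (of_int k + \<sigma>) (of_int l + \<tau>) =
      kron k l + \<sigma> * (kron (k+1) l - kron k l) + \<tau> * (kron (k+1) (l+1) - kron (k+1) l)) \<and>
    (\<sigma> \<le> \<tau> \<longrightarrow> hat Rising (of_int k + \<sigma>) (of_int l + \<tau>) =
      kron k l + \<sigma> * (kron (k+1) (l+1) - kron k (l+1)) + \<tau> * (kron k (l+1) - kron k l))"
proof -
  consider "k \<le> -2 \<or> k \<ge> 1 \<or> l \<le> -2 \<or> l \<ge> 1" | "k = 0 \<or> k = -1" "l = 0 \<or> l = -1" by linarith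
  then show ?thesis
  proof cases
    case 1
    have "real_of_int k \<le> -2 \<or> real_of_int k \<ge> 1 \<or> real_of_int l \<le> -2 \<or> real_of_int l \<ge> 1"
      using 1 by linarith
    then have "1 \<le> \<bar>of_int k + \<sigma>\<bar> \<or> 1 \<le> \<bar>of_int l + \<tau>\<bar>"
      using assms by linarith
    then have "hat Rising (of_int k + \<sigma>) (of_int l + \<tau>) = 0"
      by (auto simp: max_absorb1 min_le_iff_disj)
    then show ?thesis using 1 by (auto simp: kron_def simp del: hat.simps)
  next
    case 2
    have a: "\<bar>\<sigma>\<bar> = \<sigma>" "\<bar>\<tau>\<bar> = \<tau>" "\<bar>\<sigma> - 1\<bar> = 1 - \<sigma>" "\<bar>\<tau> - 1\<bar> = 1 - \<tau>"
      "\<bar>- 1 + \<sigma>\<bar> = 1 - \<sigma>" "\<bar>- 1 + \<tau>\<bar> = 1 - \<tau>"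
      "\<bar>\<sigma> - 1 - (\<tau> - 1)\<bar> = \<bar>\<sigma> - \<tau>\<bar>" "\<bar>\<sigma> - 1 - \<tau>\<bar> = 1 - \<sigma> + \<tau>" "\<bar>\<sigma> - (\<tau> - 1)\<bar> = 1 + \<sigma> - \<tau>"
      using assms by linarith+
    from 2 show ?thesis
      by (elim disjE; intro conjI impI hat_Rising_eqI)
        (use assms in \<open>simp_all add: kron_def a abs_of_nonneg abs_of_nonpos\<close>)
  qed
qed

lemma hat_Falling: "hat Falling s t = hat Rising s (- t)"
  by simp

lemma hat_affine:
  fixes k l :: int
  assumes "0 \<le> \<sigma>" "\<sigma> \<le> 1" "0 \<le> \<tau>" "\<tau> \<le> 1"
    and u: "(case d of Rising \<Rightarrow> (if u then \<sigma> \<le> \<tau> else \<tau> \<le> \<sigma>) | Falling \<Rightarrow> (if u then 1 \<le> \<sigma> + \<tau> else \<sigma> + \<tau> \<le> 1))"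
  defines "gx \<equiv> kron (k+1) (l + hrow d u) - kron k (l + hrow d u)"
    and "gy \<equiv> kron (k + vcol d u) (l+1) - kron (k + vcol d u) l"
  shows "hat d (of_int k + \<sigma>) (of_int l + \<tau>) =
      kron (k + vcol d u) (l + hrow d u) + (\<sigma> - of_int (vcol d u)) * gx + (\<tau> - of_int (hrow d u)) * gy"
proof (cases d)
  case Rising
  then show ?thesis
    using hat_Rising_affine[OF assms(1-4), of k l] u
    by (cases u) (simp_all add: gx_def gy_def hrow_def vcol_def algebra_simps del: hat.simps)
next
  case Falling
  have kr: "kron i (- l - 1) = kron i (l + 1)" "kron i (- l - 1 + 1) = kron i l" for i
    by (auto simp: kron_def)
  have eq: "hat d (of_int k + \<sigma>) (of_int l + \<tau>) = hat Rising (of_int k + \<sigma>) (of_int (- l - 1) + (1 - \<tau>))"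
    unfolding Falling hat_Falling by simp
  show ?thesis
    unfolding eq using hat_Rising_affine[of \<sigma> "1 - \<tau>" k "-l-1"] u assms(1-4) Falling
    unfolding kr
    by (cases u) (simp_all add: gx_def gy_def hrow_def vcol_def algebra_simps del: hat.simps)
qed

lemma hat_at_int: "hat d (of_int k) (of_int l) = kron k l"
  using hat_affine[where \<sigma> = 0 and \<tau> = 0 and u = False and d = d and k = k and l = l]
  by (cases d) (simp_all add: hrow_def vcol_def del: hat.simps)

lemma hat_nonneg: "0 \<le> hat d s t" by (cases d) simp_all

lemma hat_le_one: "hat d s t \<le> 1" by (cases d) (simp_all add: min_le_iff_disj)

lemma hat_eq_0: "\<bar>s\<bar> \<ge> 1 \<or> \<bar>t\<bar> \<ge> 1 \<Longrightarrow> hat d s t = 0"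
  by (cases d) (auto simp: max_absorb1 min_le_iff_disj)

lemma hat_minus: "hat d (- s) (- t) = hat d s t"
proof -
  have "\<bar>- s - - t\<bar> = \<bar>s - t\<bar>" "\<bar>- s + - t\<bar> = \<bar>s + t\<bar>" by linarith+
  then show ?thesis by (cases d) (simp_all only: hat.simps abs_minus_cancel)
qed

section \<open>The nodal basis\<close>

abbreviation px :: "nat \<Rightarrow> nat \<Rightarrow> nat" where "px m i \<equiv> i mod m + 1"
abbreviation py :: "nat \<Rightarrow> nat \<Rightarrow> nat" where "py m i \<equiv> i div m + 1"

definition hat_fun :: "diagonal \<Rightarrow> nat \<Rightarrow> nat \<Rightarrow> point \<Rightarrow> real" where
  "hat_fun d m i x = hat d (real (m+1) * fst x - real (px m i)) (real (m+1) * snd x - real (py m i))"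

lemma px_le: "m \<ge> 1 \<Longrightarrow> px m i \<le> m"
  by (simp add: Suc_leI)

lemma py_le: "i < m\<^sup>2 \<Longrightarrow> py m i \<le> m"
  by (simp add: Suc_leI less_mult_imp_div_less power2_eq_square)

lemma index_eq_iff: "i = j \<longleftrightarrow> px m i = px m j \<and> py m i = py m j"
  by (metis add_right_cancel mod_div_mult_eq)

lemma closure_Omega: "closure Omega = {0..1} \<times> {0..1}"
  by (simp add: Omega_def closure_Times)

lemma hat_fun_outside:
  assumes "i < m\<^sup>2" "x \<notin> Omega"
  shows "hat_fun d m i x = 0"
proof -
  have m: "m \<ge> 1" using assms(1) by (cases m) auto
  define X Y where "X = real (m+1) * fst x" and "Y = real (m+1) * snd x"
  have p: "1 \<le> real (px m i)" "real (px m i) \<le> m" "1 \<le> real (py m i)" "real (py m i) \<le> m"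
    using px_le[OF m, of i] py_le[OF assms(1)] by linarith+
  consider "fst x \<le> 0" | "1 \<le> fst x" | "snd x \<le> 0" | "1 \<le> snd x"
    using assms(2) by (cases x) (auto simp: Omega_def not_less)
  then have "1 \<le> \<bar>X - real (px m i)\<bar> \<or> 1 \<le> \<bar>Y - real (py m i)\<bar>"
  proof cases
    case 1
    then have "X \<le> 0" by (simp add: X_def mult_nonneg_nonpos)
    then show ?thesis using p by argo
  next
    case 2
    then have "(1 + real m) * 1 \<le> (1 + real m) * fst x" by (intro mult_left_mono) auto
    then have "real m + 1 \<le> X" unfolding X_def by (simp only: mult_1_right of_nat_add of_nat_1 add.commute)
    then show ?thesis using p by argo
  next
    case 3
    then have "Y \<le> 0" by (simp add: Y_def mult_nonneg_nonpos)
    then show ?thesis using p by argo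
  next
    case 4
    then have "(1 + real m) * 1 \<le> (1 + real m) * snd x" by (intro mult_left_mono) auto
    then have "real m + 1 \<le> Y" unfolding Y_def by (simp only: mult_1_right of_nat_add of_nat_1 add.commute)
    then show ?thesis using p by argo
  qed
  then show ?thesis unfolding hat_fun_def X_def Y_def by (rule hat_eq_0)
qed

lemma continuous_hat_fun: "continuous_on S (hat_fun d m i)"
proof -
  have "continuous_on S (\<lambda>x. hat d (f x) (g x))" if "continuous_on S f" "continuous_on S g" for f g :: "point \<Rightarrow> real"
    using that by (cases d) (simp_all, (intro continuous_intros; assumption)+)
  note cont = this
  show ?thesis unfolding hat_fun_def by (rule cont; intro continuous_intros)
qed

lemma hat_fun_node:
  assumes "j < m\<^sup>2"
  shows "hat_fun d m i (node m j) = (if j = i then 1 else 0)"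
proof -
  have "hat_fun d m i (node m j) = hat d (of_int (int (px m j) - int (px m i))) (of_int (int (py m j) - int (py m i)))"
    by (simp add: hat_fun_def node_def grid_point_def del: of_nat_Suc)
  also have "\<dots> = kron (int (px m j) - int (px m i)) (int (py m j) - int (py m i))"
    by (rule hat_at_int)
  also have "\<dots> = (if j = i then 1 else 0)"
    using index_eq_iff[of j i m] by (simp add: kron_def del: of_nat_Suc)
  finally show ?thesis .
qed

fun in_half :: "diagonal \<Rightarrow> bool \<Rightarrow> real \<Rightarrow> real \<Rightarrow> bool" where
  "in_half Rising u \<sigma> \<tau> \<longleftrightarrow> (if u then \<sigma> \<le> \<tau> else \<tau> \<le> \<sigma>)"
| "in_half Falling u \<sigma> \<tau> \<longleftrightarrow> (if u then 1 \<le> \<sigma> + \<tau> else \<sigma> + \<tau> \<le> 1)"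

text \<open>The base point is the common vertex of the horizontal and the vertical side, so that the coefficients are
  the increments along these sides.\<close>

lemma hat_fun_affine:
  fixes k l :: int and i :: nat
  assumes x: "real (m+1) * fst x = of_int k + \<sigma>" "real (m+1) * snd x = of_int l + \<tau>"
    and st: "0 \<le> \<sigma>" "\<sigma> \<le> 1" "0 \<le> \<tau>" "\<tau> \<le> 1" and u: "in_half d u \<sigma> \<tau>"
  defines "k' \<equiv> k - int (px m i)" and "l' \<equiv> l - int (py m i)"
  shows "hat_fun d m i x =
      kron (k' + vcol d u) (l' + hrow d u)
      + (real (m+1) * fst x - of_int (k + vcol d u)) * (kron (k'+1) (l' + hrow d u) - kron k' (l' + hrow d u))
      + (real (m+1) * snd x - of_int (l + hrow d u)) * (kron (k' + vcol d u) (l'+1) - kron (k' + vcol d u) l')"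
proof -
  have "hat_fun d m i x = hat d (of_int k' + \<sigma>) (of_int l' + \<tau>)"
    unfolding hat_fun_def x by (simp add: k'_def l'_def algebra_simps)
  also have "\<dots> = kron (k' + vcol d u) (l' + hrow d u)
      + (\<sigma> - of_int (vcol d u)) * (kron (k'+1) (l' + hrow d u) - kron k' (l' + hrow d u))
      + (\<tau> - of_int (hrow d u)) * (kron (k' + vcol d u) (l'+1) - kron (k' + vcol d u) l')"
    using u by (intro hat_affine st) (cases d; simp)
  finally show ?thesis unfolding x by simp
qed

lemma cell_triangle_coordinates:
  assumes "T \<in> cell_triangles d m p q"
  shows "\<exists>u. \<forall>x\<in>T. \<exists>\<sigma> \<tau>. real (m+1) * fst x = of_int (int p) + \<sigma> \<and>
      real (m+1) * snd x = of_int (int q) + \<tau> \<and> 0 \<le> \<sigma> \<and> \<sigma> \<le> 1 \<and> 0 \<le> \<tau> \<and> \<tau> \<le> 1 \<and> in_half d u \<sigma> \<tau>"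
proof -
  define H where "H = real (m+1)"
  have H: "H > 0" by (simp add: H_def)
  have comb: "H * fst x = of_int (int p) + (a * e1 + b * e2 + c * e3)" "H * snd x = of_int (int q) + (a * f1 + b * f2 + c * f3)"
    if "x = a *\<^sub>R (real (p + e1) / H, real (q + f1) / H) + b *\<^sub>R (real (p + e2) / H, real (q + f2) / H)
        + c *\<^sub>R (real (p + e3) / H, real (q + f3) / H)" "a + b + c = 1" for x and a b c :: real and e1 e2 e3 f1 f2 f3 :: nat
  proof -
    have c: "c = 1 - a - b" using that(2) by simp
    show "H * fst x = of_int (int p) + (a * e1 + b * e2 + c * e3)" "H * snd x = of_int (int q) + (a * f1 + b * f2 + c * f3)"
      unfolding that(1) c using H by (simp_all add: field_simps)
  qed
  have hull: "\<exists>\<sigma> \<tau>. H * fst x = of_int (int p) + \<sigma> \<and> H * snd x = of_int (int q) + \<tau> \<and>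
       0 \<le> \<sigma> \<and> \<sigma> \<le> 1 \<and> 0 \<le> \<tau> \<and> \<tau> \<le> 1 \<and> in_half d u \<sigma> \<tau>"
    if x: "x \<in> convex hull {grid_point m (p + e1) (q + f1), grid_point m (p + e2) (q + f2), grid_point m (p + e3) (q + f3)}"
    and half: "\<And>(a::real) (b::real) (c::real). 0 \<le> a \<Longrightarrow> 0 \<le> b \<Longrightarrow> 0 \<le> c \<Longrightarrow> a + b + c = 1 \<Longrightarrow> in_half d u (a * e1 + b * e2 + c * e3) (a * f1 + b * f2 + c * f3)"
    and le: "e1 \<le> 1" "e2 \<le> 1" "e3 \<le> 1" "f1 \<le> 1" "f2 \<le> 1" "f3 \<le> 1"
    for x u and e1 e2 e3 f1 f2 f3 :: nat
  proof -
    obtain a b c where abc: "0 \<le> a" "0 \<le> b" "0 \<le> c" "a + b + c = 1"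
      "x = a *\<^sub>R (real (p + e1) / H, real (q + f1) / H) + b *\<^sub>R (real (p + e2) / H, real (q + f2) / H)
        + c *\<^sub>R (real (p + e3) / H, real (q + f3) / H)"
      using x unfolding convex_hull_3 grid_point_def H_def by blast
    have le1: "a * e1' + b * e2' + c * e3' \<le> 1" if "e1' \<le> 1" "e2' \<le> 1" "e3' \<le> 1" for e1' e2' e3' :: nat
    proof -
      have "a * e1' + b * e2' + c * e3' \<le> a * 1 + b * 1 + c * 1"
        using abc that by (intro add_mono mult_left_mono) auto
      then show ?thesis using abc by simp
    qed
    let ?s = "a * real e1 + b * real e2 + c * real e3" and ?t = "a * real f1 + b * real f2 + c * real f3"
    have "H * fst x = of_int (int p) + ?s \<and> H * snd x = of_int (int q) + ?t \<and>
       0 \<le> ?s \<and> ?s \<le> 1 \<and> 0 \<le> ?t \<and> ?t \<le> 1 \<and> in_half d u ?s ?t"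
      using comb[OF abc(5,4)] half[OF abc(1-4)] le1[OF le(1-3)] le1[OF le(4-6)] abc(1-3) by simp
    then show ?thesis by blast
  qed
  have "\<exists>u. \<forall>x\<in>T. \<exists>\<sigma> \<tau>. H * fst x = of_int (int p) + \<sigma> \<and> H * snd x = of_int (int q) + \<tau> \<and>
       0 \<le> \<sigma> \<and> \<sigma> \<le> 1 \<and> 0 \<le> \<tau> \<and> \<tau> \<le> 1 \<and> in_half d u \<sigma> \<tau>"
  proof (cases d)
    case Rising
    then consider "T = convex hull {grid_point m (p+0) (q+0), grid_point m (p+1) (q+0), grid_point m (p+1) (q+1)}"
      | "T = convex hull {grid_point m (p+0) (q+0), grid_point m (p+0) (q+1), grid_point m (p+1) (q+1)}"
      using assms by auto
    then show ?thesis
    proof cases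
      case 1
      show ?thesis unfolding 1 by (intro exI[of _ False] ballI, rule hull, assumption) (simp_all add: Rising)
    next
      case 2
      show ?thesis unfolding 2 by (intro exI[of _ True] ballI, rule hull, assumption) (simp_all add: Rising)
    qed
  next
    case Falling
    then consider "T = convex hull {grid_point m (p+0) (q+0), grid_point m (p+1) (q+0), grid_point m (p+0) (q+1)}"
      | "T = convex hull {grid_point m (p+1) (q+0), grid_point m (p+0) (q+1), grid_point m (p+1) (q+1)}"
      using assms by auto
    then show ?thesis
    proof cases
      case 1
      show ?thesis unfolding 1 by (intro exI[of _ False] ballI, rule hull, assumption) (simp_all add: Falling)
    next
      case 2
      show ?thesis unfolding 2 by (intro exI[of _ True] ballI, rule hull, assumption) (simp_all add: Falling)
    qed
  qed
  then show ?thesis unfolding H_def .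
qed

lemma hat_fun_in_fe_space:
  assumes "i < m\<^sup>2"
  shows "hat_fun d m i \<in> fe_space d m"
proof -
  have "\<exists>c w. \<forall>x\<in>T. hat_fun d m i x = c + inner w x" if T: "T \<in> mesh d m" for T
  proof -
    obtain p q where pq: "p \<le> m" "q \<le> m" "T \<in> cell_triangles d m p q"
      using T unfolding mesh_def by blast
    obtain u where u: "\<forall>x\<in>T. \<exists>\<sigma> \<tau>. real (m+1) * fst x = of_int (int p) + \<sigma> \<and>
      real (m+1) * snd x = of_int (int q) + \<tau> \<and> 0 \<le> \<sigma> \<and> \<sigma> \<le> 1 \<and> 0 \<le> \<tau> \<and> \<tau> \<le> 1 \<and> in_half d u \<sigma> \<tau>"
      using cell_triangle_coordinates[OF pq(3)] by (elim exE) (rule that)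
    define k' where "k' = int p - int (px m i)"
    define l' where "l' = int q - int (py m i)"
    define gx where "gx = kron (k'+1) (l' + hrow d u) - kron k' (l' + hrow d u)"
    define gy where "gy = kron (k' + vcol d u) (l'+1) - kron (k' + vcol d u) l'"
    define c where "c = kron (k' + vcol d u) (l' + hrow d u) - of_int (int p + vcol d u) * gx
      - of_int (int q + hrow d u) * gy"
    have "hat_fun d m i x = c + inner (real (m+1) * gx, real (m+1) * gy) x" if xT: "x \<in> T" for x
    proof -
      obtain \<sigma> \<tau> where st: "real (m+1) * fst x = of_int (int p) + \<sigma>" "real (m+1) * snd x = of_int (int q) + \<tau>"
        "0 \<le> \<sigma>" "\<sigma> \<le> 1" "0 \<le> \<tau>" "\<tau> \<le> 1" "in_half d u \<sigma> \<tau>"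
        using bspec[OF u xT] by (elim exE conjE) (rule that, assumption+)
      have "hat_fun d m i x = kron (k' + vcol d u) (l' + hrow d u)
          + (real (m+1) * fst x - of_int (int p + vcol d u)) * gx
          + (real (m+1) * snd x - of_int (int q + hrow d u)) * gy"
        unfolding k'_def l'_def gx_def gy_def by (rule hat_fun_affine[OF st])
      also have "\<dots> = c + inner (real (m+1) * gx, real (m+1) * gy) x"
        unfolding c_def inner_prod_def fst_conv snd_conv inner_real_def left_diff_distrib
        by (simp only: mult.assoc mult.commute[of gx] mult.commute[of gy])
      finally show ?thesis .
    qed
    then have "\<forall>x\<in>T. hat_fun d m i x = c + inner (real (m+1) * gx, real (m+1) * gy) x" by blast
    then have "\<exists>w. \<forall>x\<in>T. hat_fun d m i x = c + inner w x" by (rule exI)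
    then show ?thesis by (rule exI)
  qed
  then show ?thesis
    unfolding fe_space_def mem_Collect_eq
    by (intro conjI continuous_hat_fun ballI allI impI hat_fun_outside[OF assms])
qed

lemma cell_triangle_vertices:
  assumes "T \<in> mesh d m"
  obtains S where "T = convex hull S" "S \<subseteq> {grid_point m p q | p q. p \<le> m + 1 \<and> q \<le> m + 1}"
proof -
  let ?G = "{grid_point m p q | p q. p \<le> m + 1 \<and> q \<le> m + 1}"
  obtain p q where pq: "p \<le> m" "q \<le> m" "T \<in> cell_triangles d m p q"
    using assms unfolding mesh_def by blast
  have gI: "grid_point m r s \<in> ?G" if "r \<le> m + 1" "s \<le> m + 1" for r s
    using that by blast
  have g: "grid_point m p q \<in> ?G" "grid_point m (p+1) q \<in> ?G" "grid_point m p (q+1) \<in> ?G"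
    "grid_point m (p+1) (q+1) \<in> ?G"
    by (intro gI; use pq in simp)+
  let ?F = "{{grid_point m p q, grid_point m (p+1) q, grid_point m (p+1) (q+1)},
     {grid_point m p q, grid_point m p (q+1), grid_point m (p+1) (q+1)},
     {grid_point m p q, grid_point m (p+1) q, grid_point m p (q+1)},
     {grid_point m (p+1) q, grid_point m p (q+1), grid_point m (p+1) (q+1)}}"
  have sub: "\<forall>S\<in>?F. S \<subseteq> ?G"
    by (simp only: ball_simps insert_subset g empty_subsetI simp_thms)
  have "\<exists>S\<in>?F. T = convex hull S"
    using pq(3) by (cases d) auto
  then obtain S where "S \<in> ?F" "T = convex hull S" by (rule bexE)
  then show ?thesis using that bspec[OF sub, of S] by simp
qed

lemma mesh_covers:
  assumes "x \<in> Omega"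
  obtains T where "T \<in> mesh d m" "x \<in> T"
proof -
  define H where "H = real (m+1)"
  have H: "H > 0" and Hm: "real (Suc m) = H" by (simp_all add: H_def)
  have x: "0 < fst x" "fst x < 1" "0 < snd x" "snd x < 1" using assms by (auto simp: Omega_def)
  define p where "p = nat \<lfloor>H * fst x\<rfloor>"
  define q where "q = nat \<lfloor>H * snd x\<rfloor>"
  define \<sigma> where "\<sigma> = H * fst x - p"
  define \<tau> where "\<tau> = H * snd x - q"
  have "0 < H * fst x" "0 < H * snd x" "H * fst x < H" "H * snd x < H" using x H by simp_all
  then have st: "0 \<le> \<sigma>" "\<sigma> \<le> 1" "0 \<le> \<tau>" "\<tau> \<le> 1" and pq: "p \<le> m" "q \<le> m"
    unfolding \<sigma>_def \<tau>_def p_def q_def H_def by linarith+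
  have xeq: "x = ((real p + \<sigma>) / H, (real q + \<tau>) / H)" using H by (simp add: \<sigma>_def \<tau>_def prod_eq_iff)
  have mem: "x \<in> convex hull {grid_point m p1 q1, grid_point m p2 q2, grid_point m p3 q3}"
    if "0 \<le> a" "0 \<le> b" "0 \<le> c" "a + b + c = 1" "a * p1 + b * p2 + c * p3 = p + \<sigma>" "a * q1 + b * q2 + c * q3 = q + \<tau>"
    for a b c p1 q1 p2 q2 p3 q3
    unfolding convex_hull_3 mem_Collect_eq
    by (rule exI[of _ a], rule exI[of _ b], rule exI[of _ c])
      (use that in \<open>simp add: xeq grid_point_def Hm add_divide_distrib[symmetric] del: of_nat_Suc\<close>)
  have "\<exists>T\<in>cell_triangles d m p q. x \<in> T"
  proof (cases d)
    case Rising
    show ?thesis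
    proof (cases "\<tau> \<le> \<sigma>")
      case True
      then have "x \<in> convex hull {grid_point m p q, grid_point m (p+1) q, grid_point m (p+1) (q+1)}"
        using st by (intro mem[of "1 - \<sigma>" "\<sigma> - \<tau>" \<tau>]) (auto simp: algebra_simps)
      then show ?thesis using Rising by simp
    next
      case False
      then have "x \<in> convex hull {grid_point m p q, grid_point m p (q+1), grid_point m (p+1) (q+1)}"
        using st by (intro mem[of "1 - \<tau>" "\<tau> - \<sigma>" \<sigma>]) (auto simp: algebra_simps)
      then show ?thesis using Rising by simp
    qed
  next
    case Falling
    show ?thesis
    proof (cases "\<sigma> + \<tau> \<le> 1")
      case True
      then have "x \<in> convex hull {grid_point m p q, grid_point m (p+1) q, grid_point m p (q+1)}"
        using st by (intro mem[of "1 - \<sigma> - \<tau>" \<sigma> \<tau>]) (auto simp: algebra_simps)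
      then show ?thesis using Falling by simp
    next
      case False
      then have "x \<in> convex hull {grid_point m (p+1) q, grid_point m p (q+1), grid_point m (p+1) (q+1)}"
        using st by (intro mem[of "1 - \<tau>" "1 - \<sigma>" "\<sigma> + \<tau> - 1"]) (auto simp: algebra_simps)
      then show ?thesis using Falling by simp
    qed
  qed
  then show ?thesis using that pq by (auto simp: mesh_def)
qed

lemma fe_space_zero: "v \<in> fe_space d m \<Longrightarrow> x \<notin> Omega \<Longrightarrow> v x = 0"
  unfolding fe_space_def by blast

lemma fe_space_affine: "v \<in> fe_space d m \<Longrightarrow> T \<in> mesh d m \<Longrightarrow> \<exists>c w. \<forall>x\<in>T. v x = c + inner w x"
  unfolding fe_space_def by blast

text \<open>A function in the finite element space is determined by its values at the interior nodes: the remaining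
  vertices lie on the boundary, where it vanishes, and an affine function on a triangle is determined by the
  values at the vertices.\<close>

lemma fe_space_eqI:
  assumes v: "v \<in> fe_space d m" and v': "v' \<in> fe_space d m"
    and nodes: "\<And>j. j < m\<^sup>2 \<Longrightarrow> v (node m j) = v' (node m j)"
  shows "v = v'"
proof
  fix x
  have out: "v y = v' y" if "y \<notin> Omega" for y
    using fe_space_zero[OF v that] fe_space_zero[OF v' that] by simp
  have grid: "v (grid_point m p q) = v' (grid_point m p q)" for p q
  proof (cases "1 \<le> p \<and> p \<le> m \<and> 1 \<le> q \<and> q \<le> m")
    case True
    define p' where "p' = p - 1"
    define q' where "q' = q - 1"
    have pq: "p = Suc p'" "q = Suc q'" "p' < m" "q' < m"
      using True unfolding p'_def q'_def by linarith+
    define j where "j = q' * m + p'"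
    have "q' * m + p' < Suc q' * m" using pq by simp
    also have "\<dots> \<le> m * m" using pq by (intro mult_right_mono) auto
    finally have j: "j < m\<^sup>2" by (simp add: j_def power2_eq_square)
    have "j mod m = p'" "j div m = q'" using pq by (simp_all add: j_def)
    then have "node m j = grid_point m p q" using pq by (simp add: node_def)
    then show ?thesis using nodes[OF j] by simp
  next
    case False
    then have "p = 0 \<or> m + 1 \<le> p \<or> q = 0 \<or> m + 1 \<le> q" by linarith
    moreover have "1 \<le> real r / real (m + 1)" if "m + 1 \<le> r" for r
      using that by (simp only: le_divide_eq_1_pos of_nat_0_less_iff of_nat_le_iff)
    ultimately have "fst (grid_point m p q) \<le> 0 \<or> 1 \<le> fst (grid_point m p q) \<or>
        snd (grid_point m p q) \<le> 0 \<or> 1 \<le> snd (grid_point m p q)"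
      unfolding grid_point_def fst_conv snd_conv by (metis div_0 of_nat_0 order_refl)
    then have "grid_point m p q \<notin> Omega"
      unfolding Omega_def mem_Times_iff greaterThanLessThan_iff by linarith
    then show ?thesis by (rule out)
  qed
  show "v x = v' x"
  proof (cases "x \<in> Omega")
    case True
    obtain T where T: "T \<in> mesh d m" "x \<in> T" by (rule mesh_covers[OF True])
    obtain S where S: "T = convex hull S" "S \<subseteq> {grid_point m p q | p q. p \<le> m + 1 \<and> q \<le> m + 1}"
      by (rule cell_triangle_vertices[OF T(1)])
    obtain c w where cw: "\<forall>y\<in>T. v y = c + inner w y" using fe_space_affine[OF v T(1)] by blast
    obtain c' w' where cw': "\<forall>y\<in>T. v' y = c' + inner w' y" using fe_space_affine[OF v' T(1)] by blast
    have "T \<subseteq> {y. inner (w - w') y = c' - c}"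
      unfolding S(1)
    proof (rule hull_minimal)
      show "S \<subseteq> {y. inner (w - w') y = c' - c}"
      proof
        fix y assume "y \<in> S"
        then have "y \<in> T" using S(1) by (simp add: hull_inc)
        moreover obtain p q where "y = grid_point m p q" using \<open>y \<in> S\<close> S(2) by blast
        then have "v y = v' y" using grid by simp
        ultimately show "y \<in> {y. inner (w - w') y = c' - c}"
          using bspec[OF cw, of y] bspec[OF cw', of y] by (simp add: inner_diff_left)
      qed
    qed (rule convex_hyperplane)
    then have "inner (w - w') x = c' - c" using T(2) by blast
    then show ?thesis
      using bspec[OF cw T(2)] bspec[OF cw' T(2)] by (simp add: inner_diff_left)
  qed (rule out)
qed

lemma nodal_basis_eq:
  assumes "i < m\<^sup>2"
  shows "nodal_basis d m i = hat_fun d m i"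
  unfolding nodal_basis_def
proof (rule the_equality)
  show "hat_fun d m i \<in> fe_space d m \<and> (\<forall>j<m\<^sup>2. hat_fun d m i (node m j) = (if j = i then 1 else 0))"
    using assms by (simp add: hat_fun_in_fe_space hat_fun_node)
  show "v = hat_fun d m i" if "v \<in> fe_space d m \<and> (\<forall>j<m\<^sup>2. v (node m j) = (if j = i then 1 else 0))" for v
    using that hat_fun_in_fe_space[OF assms] by (intro fe_space_eqI[of _ d m]) (auto simp: hat_fun_node)
qed

section \<open>Gradients of the basis functions\<close>

text \<open>Points in the interior of a mesh triangle, extended periodically to the whole plane.\<close>

definition off_grid :: "diagonal \<Rightarrow> nat \<Rightarrow> point \<Rightarrow> bool" where
  "off_grid d m x \<longleftrightarrow> real (m+1) * fst x \<notin> \<int> \<and> real (m+1) * snd x \<notin> \<int> \<and>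
     real (m+1) * fst x + (case d of Rising \<Rightarrow> - 1 | Falling \<Rightarrow> 1) * (real (m+1) * snd x) \<notin> \<int>"

text \<open>A version of the gradient of the basis functions that is defined everywhere by an explicit Borel formula; it agrees
  with the gradient off the mesh lines.\<close>

definition hat_grad :: "diagonal \<Rightarrow> nat \<Rightarrow> nat \<Rightarrow> point \<Rightarrow> point" where
  "hat_grad d m i x = (let H = real (m+1); k = \<lfloor>H * fst x\<rfloor> - int (px m i); l = \<lfloor>H * snd x\<rfloor> - int (py m i);
      u = upper d (frac (H * fst x)) (frac (H * snd x))
    in (H * (kron (k+1) (l + hrow d u) - kron k (l + hrow d u)),
        H * (kron (k + vcol d u) (l+1) - kron (k + vcol d u) l)))"

lemma gradient_eqI:
  assumes "(f has_derivative (\<lambda>v. inner w v)) (at x)"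
  shows "gradient f x = w"
proof -
  have "f differentiable (at x)" using assms by (auto simp: differentiable_def)
  then show ?thesis
    unfolding gradient_def frechet_derivative_at[OF assms, symmetric] by (simp add: euclidean_representation)
qed

lemma hat_fun_has_derivative:
  assumes "off_grid d m x"
  shows "(hat_fun d m i has_derivative (\<lambda>v. inner (hat_grad d m i x) v)) (at x)"
proof -
  define H where "H = real (m+1)"
  define k where "k = \<lfloor>H * fst x\<rfloor>"
  define l where "l = \<lfloor>H * snd x\<rfloor>"
  define u where "u = upper d (frac (H * fst x)) (frac (H * snd x))"
  define k' where "k' = k - int (px m i)"
  define l' where "l' = l - int (py m i)"
  define gx where "gx = kron (k'+1) (l' + hrow d u) - kron k' (l' + hrow d u)"
  define gy where "gy = kron (k' + vcol d u) (l'+1) - kron (k' + vcol d u) l'"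
  define U where "U = {y :: point. of_int k < H * fst y \<and> H * fst y < of_int k + 1 \<and> of_int l < H * snd y \<and>
     H * snd y < of_int l + 1 \<and> (case d of
       Rising \<Rightarrow> (if u then H * fst y - k < H * snd y - l else H * snd y - l < H * fst y - k)
     | Falling \<Rightarrow> (if u then 1 < H * fst y - k + (H * snd y - l) else H * fst y - k + (H * snd y - l) < 1))}"
  have grad: "hat_grad d m i x = (H * gx, H * gy)"
    by (simp add: hat_grad_def Let_def H_def k_def l_def u_def k'_def l'_def gx_def gy_def)
  have op: "open {y :: point. a < b * fst y + c * snd y}" for a b c :: real
    by (intro open_Collect_less continuous_on_add continuous_on_mult continuous_on_const continuous_on_fst continuous_on_snd continuous_on_id)
  define V where "V = {y :: point. of_int k < H * fst y + 0 * snd y} \<inter> {y. - of_int k - 1 < (- H) * fst y + 0 * snd y} \<inter>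
     {y. of_int l < 0 * fst y + H * snd y} \<inter> {y. - of_int l - 1 < 0 * fst y + (- H) * snd y}"
  have V: "open V" unfolding V_def by (intro open_Int op)
  have "U = V \<inter> (case d of Rising \<Rightarrow> (if u then {y. real_of_int (l - k) < (- H) * fst y + H * snd y}
       else {y. real_of_int (k - l) < H * fst y + (- H) * snd y})
     | Falling \<Rightarrow> (if u then {y. real_of_int (k + l + 1) < H * fst y + H * snd y}
       else {y. - real_of_int (k + l + 1) < (- H) * fst y + (- H) * snd y}))"
    by (cases d; cases u) (auto simp: U_def V_def)
  then have opU: "open U" by (cases d; cases u; simp only: diagonal.case if_True if_False; intro open_Int V op)
  have xU: "x \<in> U"
  proof -
    have ni: "H * fst x \<notin> \<int>" "H * snd x \<notin> \<int>"
      "H * fst x + (case d of Rising \<Rightarrow> - 1 | Falling \<Rightarrow> 1) * (H * snd x) \<notin> \<int>"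
      using assms by (auto simp: off_grid_def H_def)
    have "of_int k < H * fst x" "of_int l < H * snd x"
    proof -
      have "of_int k \<noteq> H * fst x" "of_int l \<noteq> H * snd x" using ni(1,2) Ints_of_int by metis+
      moreover have "of_int k \<le> H * fst x" "of_int l \<le> H * snd x" by (simp_all add: k_def l_def)
      ultimately show "of_int k < H * fst x" "of_int l < H * snd x" by simp_all
    qed
    moreover have "H * fst x < of_int k + 1" "H * snd x < of_int l + 1"
      unfolding k_def l_def by linarith+
    moreover have "H * fst x - k \<noteq> H * snd x - l" if "d = Rising"
    proof
      assume "H * fst x - k = H * snd x - l"
      then have "H * fst x + (- 1) * (H * snd x) = of_int (k - l)" by simp
      then have "H * fst x + (- 1) * (H * snd x) \<in> \<int>" by (simp only: Ints_of_int)
      then show False using ni(3) that by simp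
    qed
    moreover have "H * fst x - k + (H * snd x - l) \<noteq> 1" if "d = Falling"
    proof
      assume "H * fst x - k + (H * snd x - l) = 1"
      then have "H * fst x + 1 * (H * snd x) = of_int (k + l + 1)" by simp
      then have "H * fst x + 1 * (H * snd x) \<in> \<int>" by (simp only: Ints_of_int)
      then show False using ni(3) that by simp
    qed
    moreover have "u \<longleftrightarrow> upper d (H * fst x - k) (H * snd x - l)"
      by (simp add: u_def frac_def k_def l_def)
    ultimately show ?thesis
      unfolding U_def mem_Collect_eq
      by (cases d; cases u; simp only: upper.simps diagonal.case if_True if_False simp_thms; linarith)
  qed
  have eq: "hat_fun d m i y = kron (k' + vcol d u) (l' + hrow d u)
      + (H * fst y - of_int (k + vcol d u)) * gx + (H * snd y - of_int (l + hrow d u)) * gy" if "y \<in> U" for y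
    unfolding gx_def gy_def k'_def l'_def H_def
  proof (rule hat_fun_affine)
    show "real (m+1) * fst y = of_int k + (H * fst y - k)" "real (m+1) * snd y = of_int l + (H * snd y - l)"
      by (simp_all add: H_def)
    show "0 \<le> H * fst y - k" "H * fst y - k \<le> 1" "0 \<le> H * snd y - l" "H * snd y - l \<le> 1"
      using that by (simp_all add: U_def)
    show "in_half d u (H * fst y - k) (H * snd y - l)"
      using that by (cases d; cases u; simp add: U_def)
  qed
  have der: "((\<lambda>y. kron (k' + vcol d u) (l' + hrow d u)
      + (H * fst y - of_int (k + vcol d u)) * gx + (H * snd y - of_int (l + hrow d u)) * gy)
      has_derivative (\<lambda>v. inner (H * gx, H * gy) v)) (at x)"
    by (auto intro!: derivative_eq_intros simp: inner_prod_def algebra_simps)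
  show ?thesis
    unfolding grad by (rule has_derivative_transform_within_open[OF der opU xU eq[symmetric]])
qed

lemma gradient_hat_fun: "off_grid d m x \<Longrightarrow> gradient (hat_fun d m i) x = hat_grad d m i x"
  by (intro gradient_eqI hat_fun_has_derivative)

section \<open>Integration over the square\<close>

definition area :: "point measure" where
  "area = restrict_space lborel Omega"

lemma open_Omega: "open Omega"
  by (simp add: Omega_def open_Times)

lemma Omega_borel [measurable, simp]: "Omega \<in> sets borel"
  by (rule borel_open[OF open_Omega])

lemma space_area [simp]: "space area = Omega"
  by (simp add: area_def space_restrict_space)

lemma Omega_box: "Omega = box (0, 0) (1, 1)"
  by (auto simp: Omega_def box_def Basis_prod_def)

lemma emeasure_area: "emeasure area Omega = 1"
  unfolding area_def
  by (subst emeasure_restrict_space) (auto simp: Omega_box emeasure_lborel_box_eq Basis_prod_def)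

lemma finite_measure_area: "finite_measure area"
  by (rule finite_measureI) (simp add: emeasure_area)

lemma measurable_area: "F \<in> borel_measurable borel \<Longrightarrow> F \<in> borel_measurable area"
  unfolding area_def by (intro measurable_restrict_space1) simp

lemma measurable_area_continuous: "continuous_on Omega F \<Longrightarrow> F \<in> borel_measurable area"
  using borel_measurable_continuous_on_restrict[of Omega F]
  by (simp add: area_def cong: measurable_cong_sets sets_restrict_space_cong)

lemma integral_area: "integral\<^sup>L area F = (LINT x|lborel. indicator Omega x *\<^sub>R F x)"
  for F :: "point \<Rightarrow> real"
  unfolding area_def by (rule integral_restrict_space) simp

lemma off_grid_AE_lebesgue: "AE x in lebesgue. off_grid d m x"
proof -
  define s :: real where "s = (case d of Rising \<Rightarrow> - 1 | Falling \<Rightarrow> 1)"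
  define H where "H = real (m+1)"
  have H: "H \<noteq> 0" by (simp add: H_def)
  define Z :: "int \<Rightarrow> point set" where "Z z = {x. inner (H, 0) x = of_int z} \<union> {x. inner (0, H) x = of_int z}
      \<union> {x. inner (H, s * H) x = of_int z}" for z
  have "negligible (\<Union>z\<in>UNIV. Z z)"
    unfolding Z_def using H
    by (intro negligible_countable_Union countable_image)
      (auto intro!: negligible_Un negligible_hyperplane simp: prod_eq_iff)
  moreover have "{x. \<not> off_grid d m x} \<subseteq> (\<Union>z\<in>UNIV. Z z)"
  proof
    fix x assume "x \<in> {x. \<not> off_grid d m x}"
    then have "H * fst x \<in> \<int> \<or> H * snd x \<in> \<int> \<or> H * fst x + s * (H * snd x) \<in> \<int>"
      by (simp add: off_grid_def H_def s_def)
    then obtain z where "H * fst x = of_int z \<or> H * snd x = of_int z \<or> H * fst x + s * (H * snd x) = of_int z"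
      by (elim disjE Ints_cases) blast+
    then have "x \<in> Z z" unfolding Z_def by (auto simp: inner_prod_def mult_ac)
    then show "x \<in> (\<Union>z\<in>UNIV. Z z)" by blast
  qed
  ultimately have "{x. \<not> off_grid d m x} \<in> null_sets lebesgue"
    unfolding negligible_iff_null_sets[symmetric] by (rule negligible_subset)
  then show ?thesis by (auto intro: AE_I'[of "{x. \<not> off_grid d m x}"])
qed

lemma off_grid_AE: "AE x in lborel. off_grid d m x"
  using off_grid_AE_lebesgue AE_completion_iff by blast

text \<open>Integrands are exchanged here for Borel functions: measurability of the original integrand is not assumed but
  follows from completeness of Lebesgue measure.\<close>

lemma lebesgue_on_integral_eq:
  fixes F F' :: "point \<Rightarrow> real"
  assumes eq: "\<And>x. x \<in> Omega \<Longrightarrow> off_grid d m x \<Longrightarrow> F x = F' x"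
    and meas: "F' \<in> borel_measurable area"
  shows "(LINT x|lebesgue_on Omega. F x) = (LINT x|area. F' x)"
proof -
  have m': "(\<lambda>x. indicator Omega x *\<^sub>R F' x) \<in> borel_measurable lborel"
    using meas unfolding area_def by (subst (asm) borel_measurable_restrict_space_iff) auto
  have m'': "(\<lambda>x. indicator Omega x *\<^sub>R F' x) \<in> borel_measurable lebesgue"
    using m' by (rule measurable_completion)
  have ae: "AE x in lebesgue. indicator Omega x *\<^sub>R F' x = indicator Omega x *\<^sub>R F x"
    using off_grid_AE_lebesgue[of d m]
  proof (eventually_elim)
    fix x assume "off_grid d m x"
    then show "indicator Omega x *\<^sub>R F' x = indicator Omega x *\<^sub>R F x"
      using eq by (cases "x \<in> Omega") simp_all
  qed
  have m: "(\<lambda>x. indicator Omega x *\<^sub>R F x) \<in> borel_measurable lebesgue"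
    by (rule borel_measurable_AE[OF m'' ae])
  have "(LINT x|lebesgue_on Omega. F x) = (LINT x|lebesgue. indicator Omega x *\<^sub>R F x)"
    by (rule integral_restrict_space) simp
  also have "\<dots> = (LINT x|lebesgue. indicator Omega x *\<^sub>R F' x)"
    using ae by (intro integral_cong_AE m m'') (auto elim: AE_mp)
  also have "\<dots> = (LINT x|lborel. indicator Omega x *\<^sub>R F' x)"
    by (rule integral_completion[OF m'])
  finally show ?thesis unfolding integral_area .
qed

text \<open>Everything that is integrated over the square is a bounded measurable function. This class is closed under the
  ring operations, so integrability becomes a syntactic matter.\<close>

definition bdd_meas :: "(point \<Rightarrow> real) \<Rightarrow> bool" where
  "bdd_meas F \<longleftrightarrow> F \<in> borel_measurable area \<and> (\<exists>B. \<forall>x\<in>Omega. \<bar>F x\<bar> \<le> B)"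

lemma bdd_measI: "F \<in> borel_measurable area \<Longrightarrow> (\<And>x. x \<in> Omega \<Longrightarrow> \<bar>F x\<bar> \<le> B) \<Longrightarrow> bdd_meas F"
  unfolding bdd_meas_def by blast

lemma bdd_meas_measurable: "bdd_meas F \<Longrightarrow> F \<in> borel_measurable area"
  by (simp add: bdd_meas_def)

lemma bdd_meas_integrable: "bdd_meas F \<Longrightarrow> integrable area F"
proof -
  assume "bdd_meas F"
  then obtain B where "F \<in> borel_measurable area" "\<forall>x\<in>Omega. \<bar>F x\<bar> \<le> B" unfolding bdd_meas_def by blast
  then show ?thesis
    by (intro finite_measure.integrable_const_bound[OF finite_measure_area, of _ B] AE_I2) auto
qed

lemma bdd_meas_const: "bdd_meas (\<lambda>x. c)"
  by (rule bdd_measI[of _ "\<bar>c\<bar>"]) auto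

lemma bdd_meas_add: "bdd_meas F \<Longrightarrow> bdd_meas G \<Longrightarrow> bdd_meas (\<lambda>x. F x + G x)"
proof -
  assume "bdd_meas F" "bdd_meas G"
  then obtain A B where m: "F \<in> borel_measurable area" "G \<in> borel_measurable area"
    and b: "\<forall>x\<in>Omega. \<bar>F x\<bar> \<le> A" "\<forall>x\<in>Omega. \<bar>G x\<bar> \<le> B" unfolding bdd_meas_def by blast
  show ?thesis
  proof (rule bdd_measI[of _ "A + B"])
    show "\<bar>F x + G x\<bar> \<le> A + B" if "x \<in> Omega" for x
      using bspec[OF b(1) that] bspec[OF b(2) that] by linarith
  qed (use m in simp)
qed

lemma bdd_meas_mult: "bdd_meas F \<Longrightarrow> bdd_meas G \<Longrightarrow> bdd_meas (\<lambda>x. F x * G x)"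
proof -
  assume "bdd_meas F" "bdd_meas G"
  then obtain A B where m: "F \<in> borel_measurable area" "G \<in> borel_measurable area"
    and b: "\<forall>x\<in>Omega. \<bar>F x\<bar> \<le> A" "\<forall>x\<in>Omega. \<bar>G x\<bar> \<le> B" unfolding bdd_meas_def by blast
  show ?thesis
  proof (rule bdd_measI[of _ "A * B"])
    show "\<bar>F x * G x\<bar> \<le> A * B" if "x \<in> Omega" for x
      unfolding abs_mult using bspec[OF b(1) that] bspec[OF b(2) that] by (intro mult_mono) auto
  qed (use m in simp)
qed

lemma bdd_meas_uminus: "bdd_meas F \<Longrightarrow> bdd_meas (\<lambda>x. - F x)"
  unfolding bdd_meas_def by simp

lemma bdd_meas_diff: "bdd_meas F \<Longrightarrow> bdd_meas G \<Longrightarrow> bdd_meas (\<lambda>x. F x - G x)"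
  using bdd_meas_add[of F "\<lambda>x. - G x"] bdd_meas_uminus[of G] by simp

lemma bdd_meas_power2: "bdd_meas F \<Longrightarrow> bdd_meas (\<lambda>x. (F x)\<^sup>2)"
  unfolding power2_eq_square by (rule bdd_meas_mult)

lemma bdd_meas_abs: "bdd_meas F \<Longrightarrow> bdd_meas (\<lambda>x. \<bar>F x\<bar>)"
  unfolding bdd_meas_def using borel_measurable_abs[of F area] by simp

lemma bdd_meas_sum: "(\<And>i. i \<in> I \<Longrightarrow> bdd_meas (F i)) \<Longrightarrow> bdd_meas (\<lambda>x. \<Sum>i\<in>I. F i x)"
proof (induction I rule: infinite_finite_induct)
  case (insert i I)
  have "bdd_meas (F i)" "bdd_meas (\<lambda>x. \<Sum>j\<in>I. F j x)" using insert by simp_all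
  then have "bdd_meas (\<lambda>x. F i x + (\<Sum>j\<in>I. F j x))" by (rule bdd_meas_add)
  then show ?case using insert by simp
qed (simp_all add: bdd_meas_const)

lemma bdd_meas_continuous:
  assumes "continuous_on (closure Omega) F"
  shows "bdd_meas F"
proof -
  have "compact (closure Omega)" unfolding closure_Omega by (intro compact_Times compact_Icc)
  then have "bounded (F ` closure Omega)" by (intro compact_imp_bounded compact_continuous_image assms)
  then obtain B where "\<forall>x\<in>closure Omega. \<bar>F x\<bar> \<le> B" unfolding bounded_iff by auto
  then have "\<bar>F x\<bar> \<le> B" if "x \<in> Omega" for x using that closure_subset[of Omega] by blast
  then show ?thesis
    by (rule bdd_measI[OF measurable_area_continuous[OF continuous_on_subset[OF assms closure_subset]]])
qed

lemmas bdd_meas_intros = bdd_meas_const bdd_meas_add bdd_meas_diff bdd_meas_mult bdd_meas_uminus bdd_meas_sum bdd_meas_power2 bdd_meas_abs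

lemma bdd_meas_hat_fun: "bdd_meas (hat_fun d m i)"
  by (intro bdd_meas_continuous continuous_hat_fun)

lemma hat_fun_nonneg: "0 \<le> hat_fun d m i x"
  by (simp add: hat_fun_def hat_nonneg)

lemma hat_fun_le_one: "hat_fun d m i x \<le> 1"
  by (simp add: hat_fun_def hat_le_one)

lemma abs_kron_diff: "\<bar>kron a b - kron a' b'\<bar> \<le> 1"
  by (simp add: kron_def)

lemma hat_grad_le: "\<bar>fst (hat_grad d m i x)\<bar> \<le> real (m+1)" "\<bar>snd (hat_grad d m i x)\<bar> \<le> real (m+1)"
  using mult_left_mono[OF abs_kron_diff, of "real (m+1)"]
  by (simp_all add: hat_grad_def Let_def abs_mult del: of_nat_Suc of_nat_add)

text \<open>The gradient depends on the point only through the mesh triangle that contains it, hence through a countable index.\<close>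

lemma measurable_hat_grad: "(\<lambda>x. fst (hat_grad d m i x)) \<in> borel_measurable borel"
   "(\<lambda>x. snd (hat_grad d m i x)) \<in> borel_measurable borel"
proof -
  define H where "H = real (m+1)"
  have f [measurable]: "(\<lambda>x::point. fst x) \<in> borel_measurable borel" "(\<lambda>x::point. snd x) \<in> borel_measurable borel"
    by (intro borel_measurable_continuous_onI continuous_intros)+
  define cell where "cell x = (\<lfloor>H * fst x\<rfloor>, \<lfloor>H * snd x\<rfloor>, upper d (frac (H * fst x)) (frac (H * snd x)))" for x :: point
  have [measurable]: "Measurable.pred borel (\<lambda>x::point. upper d (frac (H * fst x)) (frac (H * snd x)))"
    unfolding frac_def by (cases d; simp only: upper.simps; measurable)
  have "cell \<in> measurable borel (count_space UNIV)"
    unfolding measurable_count_space_eq2_countable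
  proof (intro conjI ballI)
    fix c :: "int \<times> int \<times> bool"
    obtain a b u where c: "c = (a, b, u)" by (cases c)
    have "cell -` {c} \<inter> space borel = {x. (of_int a \<le> H * fst x \<and> H * fst x < of_int a + 1) \<and>
        (of_int b \<le> H * snd x \<and> H * snd x < of_int b + 1) \<and> upper d (frac (H * fst x)) (frac (H * snd x)) = u}"
      by (auto simp: cell_def c floor_eq_iff)
    also have "\<dots> \<in> sets borel" by measurable
    finally show "cell -` {c} \<inter> space borel \<in> sets borel" .
  qed simp_all
  then have comp: "(\<lambda>x. \<Phi> (cell x)) \<in> borel_measurable borel" for \<Phi> :: "int \<times> int \<times> bool \<Rightarrow> real"
    by (rule measurable_compose) simp
  show "(\<lambda>x. fst (hat_grad d m i x)) \<in> borel_measurable borel"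
    using comp[of "\<lambda>(k, l, u). H * (kron (k - int (px m i) + 1) (l - int (py m i) + hrow d u)
      - kron (k - int (px m i)) (l - int (py m i) + hrow d u))"]
    unfolding hat_grad_def Let_def fst_conv cell_def prod.case H_def .
  show "(\<lambda>x. snd (hat_grad d m i x)) \<in> borel_measurable borel"
    using comp[of "\<lambda>(k, l, u). H * (kron (k - int (px m i) + vcol d u) (l - int (py m i) + 1)
      - kron (k - int (px m i) + vcol d u) (l - int (py m i)))"]
    unfolding hat_grad_def Let_def snd_conv cell_def prod.case H_def .
qed

lemma bdd_meas_hat_grad: "bdd_meas (\<lambda>x. fst (hat_grad d m i x))" "bdd_meas (\<lambda>x. snd (hat_grad d m i x))"
  using hat_grad_le by (auto intro!: bdd_measI measurable_area measurable_hat_grad)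

definition patch :: "nat \<Rightarrow> nat \<Rightarrow> point set" where
  "patch m i = {x. \<bar>real (m+1) * fst x - real (px m i)\<bar> \<le> 1 \<and> \<bar>real (m+1) * snd x - real (py m i)\<bar> \<le> 1}"

lemma hat_fun_patch: "x \<notin> patch m i \<Longrightarrow> hat_fun d m i x = 0"
  unfolding hat_fun_def patch_def by (rule hat_eq_0) auto

lemma hat_grad_patch:
  assumes "x \<notin> patch m i"
  shows "hat_grad d m i x = 0"
proof (rule ccontr)
  define H where "H = real (m+1)"
  define k where "k = \<lfloor>H * fst x\<rfloor> - int (px m i)"
  define l where "l = \<lfloor>H * snd x\<rfloor> - int (py m i)"
  define u where "u = upper d (frac (H * fst x)) (frac (H * snd x))"
  assume "hat_grad d m i x \<noteq> 0"
  then have "kron (k+1) (l + hrow d u) - kron k (l + hrow d u) \<noteq> 0 \<or>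
      kron (k + vcol d u) (l+1) - kron (k + vcol d u) l \<noteq> 0"
    by (simp add: hat_grad_def Let_def H_def k_def l_def u_def prod_eq_iff)
  moreover have "hrow d u \<in> {0, 1}" "vcol d u \<in> {0, 1}" by (auto simp: hrow_def vcol_def)
  ultimately have "k \<in> {-1, 0}" "l \<in> {-1, 0}"
    by (auto simp: kron_def split: if_splits)
  then have "-1 \<le> real_of_int k" "real_of_int k \<le> 0" "-1 \<le> real_of_int l" "real_of_int l \<le> 0" by auto
  moreover have "real_of_int k + px m i \<le> H * fst x" "H * fst x \<le> real_of_int k + px m i + 1"
    "real_of_int l + py m i \<le> H * snd x" "H * snd x \<le> real_of_int l + py m i + 1"
    unfolding k_def l_def by linarith+
  ultimately have "x \<in> patch m i" unfolding patch_def H_def[symmetric] by (simp add: abs_le_iff)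
  with assms show False by contradiction
qed

lemma patch_cbox: "patch m i = cbox ((real (px m i) - 1) / real (m+1), (real (py m i) - 1) / real (m+1))
    ((real (px m i) + 1) / real (m+1), (real (py m i) + 1) / real (m+1))"
proof -
  have H: "real (m+1) > 0" by simp
  have eq: "\<bar>real (m+1) * t - p\<bar> \<le> 1 \<longleftrightarrow> (p - 1) / real (m+1) \<le> t \<and> t \<le> (p + 1) / real (m+1)" for t p
    unfolding pos_divide_le_eq[OF H] pos_le_divide_eq[OF H] abs_le_iff mult.commute[of t] by argo
  show ?thesis unfolding patch_def eq by (auto simp: cbox_def Basis_prod_def)
qed

lemma patch_measurable [measurable]: "patch m i \<in> sets borel"
  unfolding patch_cbox by simp

lemma measure_patch: "measure lborel (patch m i) = 4 / (real (m+1))\<^sup>2"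
proof -
  define r where "r = real (m+1)"
  have r: "r > 0" by (simp add: r_def)
  have le: "(p - 1) / r \<le> (p + 1) / r" for p using r by (simp add: divide_right_mono)
  have w: "(p + 1) / r - (p - 1) / r = 2 / r" for p by (simp add: diff_divide_distrib[symmetric])
  have "measure lborel (cbox ((p - 1) / r, (q - 1) / r) ((p + 1) / r, (q + 1) / r)) = 4 / r\<^sup>2" for p q :: real
    by (subst measure_lborel_cbox_eq) (auto simp: Basis_prod_def le w power2_eq_square)
  then show ?thesis unfolding patch_cbox r_def .
qed

text \<open>The bound gains the factor \<open>h\<^sup>2\<close> from the area of the support of a basis function.\<close>

lemma integral_patch_bound:
  assumes F: "bdd_meas F" and b: "\<And>x. x \<in> Omega \<Longrightarrow> \<bar>F x\<bar> \<le> B" and z: "\<And>x. x \<in> Omega \<Longrightarrow> x \<notin> patch m i \<Longrightarrow> F x = 0"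
    and B: "0 \<le> B"
  shows "\<bar>LINT x|area. F x\<bar> \<le> 4 * B / (real (m+1))\<^sup>2"
proof -
  have fin: "emeasure lborel (patch m i) < \<infinity>" unfolding patch_cbox by (rule emeasure_lborel_cbox_finite)
  have "\<bar>LINT x|area. F x\<bar> \<le> (LINT x|area. \<bar>F x\<bar>)" by (rule integral_abs_bound)
  also have "\<dots> = (LINT x|lborel. indicator Omega x *\<^sub>R \<bar>F x\<bar>)" by (rule integral_area)
  also have "\<dots> \<le> (LINT x|lborel. indicator (patch m i) x *\<^sub>R B)"
  proof (rule integral_mono_AE')
    show "integrable lborel (\<lambda>x. indicator (patch m i) x *\<^sub>R B)"
      using fin by (intro integrable_scaleR_left integrable_real_indicator) auto
    show "AE x in lborel. indicator Omega x *\<^sub>R \<bar>F x\<bar> \<le> indicator (patch m i) x *\<^sub>R B"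
      using b z B by (intro AE_I2) (auto simp: indicator_def)
    show "AE x in lborel. 0 \<le> indicator (patch m i) x *\<^sub>R B" using B by (intro AE_I2) simp
  qed
  also have "\<dots> = 4 * B / (real (m+1))\<^sup>2" using measure_patch[of m i] by simp
  finally show ?thesis .
qed

section \<open>Matrix entries and quadratic forms\<close>

definition stiff :: "diagonal \<Rightarrow> nat \<Rightarrow> (point \<Rightarrow> real) \<Rightarrow> nat \<Rightarrow> nat \<Rightarrow> real" where
  "stiff d m a i j = (LINT x|area. a x * inner (hat_grad d m i x) (hat_grad d m j x))"

definition convect :: "diagonal \<Rightarrow> nat \<Rightarrow> (point \<Rightarrow> point) \<Rightarrow> nat \<Rightarrow> nat \<Rightarrow> real" where
  "convect d m \<beta> i j = (LINT x|area. inner (hat_grad d m i x) (\<beta> x) * hat_fun d m j x)"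

lemma bdd_meas_inner: "bdd_meas (\<lambda>x. fst (f x)) \<Longrightarrow> bdd_meas (\<lambda>x. snd (f x)) \<Longrightarrow> bdd_meas (\<lambda>x. fst (g x)) \<Longrightarrow> bdd_meas (\<lambda>x. snd (g x))
  \<Longrightarrow> bdd_meas (\<lambda>x. inner (f x) (g x))" for f g :: "point \<Rightarrow> point"
  unfolding inner_prod_def inner_real_def by (intro bdd_meas_intros)

lemma bdd_meas_stiff: "bdd_meas a \<Longrightarrow> bdd_meas (\<lambda>x. a x * inner (hat_grad d m i x) (hat_grad d m j x))"
  by (intro bdd_meas_mult bdd_meas_inner bdd_meas_hat_grad)

lemma bdd_meas_convect: "bdd_meas (\<lambda>x. fst (\<beta> x)) \<Longrightarrow> bdd_meas (\<lambda>x. snd (\<beta> x)) \<Longrightarrow> bdd_meas (\<lambda>x. inner (hat_grad d m i x) (\<beta> x) * hat_fun d m j x)"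
  by (intro bdd_meas_mult bdd_meas_inner bdd_meas_hat_grad bdd_meas_hat_fun)

lemma Theta_entry:
  assumes "bdd_meas a" "i < m\<^sup>2" "j < m\<^sup>2"
  shows "Theta d m a $$ (i, j) = stiff d m a i j"
proof -
  have "Theta d m a $$ (i, j) = (LINT x|lebesgue_on Omega. a x * inner (gradient (hat_fun d m i) x) (gradient (hat_fun d m j) x))"
    using assms(2,3) by (simp add: Theta_def nodal_basis_eq)
  also have "\<dots> = stiff d m a i j"
    unfolding stiff_def
    by (rule lebesgue_on_integral_eq[where d = d and m = m])
      (simp_all only: gradient_hat_fun bdd_meas_measurable[OF bdd_meas_stiff[OF assms(1)]])
  finally show ?thesis .
qed

lemma Psi_entry:
  assumes "bdd_meas (\<lambda>x. fst (\<beta> x))" "bdd_meas (\<lambda>x. snd (\<beta> x))" "i < m\<^sup>2" "j < m\<^sup>2"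
  shows "Psi d m \<beta> $$ (i, j) = - convect d m \<beta> i j"
proof -
  have "Psi d m \<beta> $$ (i, j) = - (LINT x|lebesgue_on Omega. inner (gradient (hat_fun d m i) x) (\<beta> x) * hat_fun d m j x)"
    using assms(3,4) by (simp add: Psi_def nodal_basis_eq)
  also have "(LINT x|lebesgue_on Omega. inner (gradient (hat_fun d m i) x) (\<beta> x) * hat_fun d m j x) = convect d m \<beta> i j"
    unfolding convect_def
    by (rule lebesgue_on_integral_eq[where d = d and m = m])
      (simp_all only: gradient_hat_fun bdd_meas_measurable[OF bdd_meas_convect[OF assms(1,2)]])
  finally show ?thesis .
qed

lemma stiff_commute: "stiff d m a i j = stiff d m a j i"
  by (simp add: stiff_def inner_commute)

definition fe_fun :: "diagonal \<Rightarrow> nat \<Rightarrow> (nat \<Rightarrow> real) \<Rightarrow> point \<Rightarrow> real" where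
  "fe_fun d m v x = (\<Sum>i<m\<^sup>2. v i * hat_fun d m i x)"

definition fe_grad :: "diagonal \<Rightarrow> nat \<Rightarrow> (nat \<Rightarrow> real) \<Rightarrow> point \<Rightarrow> point" where
  "fe_grad d m v x = (\<Sum>i<m\<^sup>2. v i *\<^sub>R hat_grad d m i x)"

lemma bdd_meas_fe_fun: "bdd_meas (fe_fun d m v)"
  unfolding fe_fun_def by (intro bdd_meas_intros bdd_meas_hat_fun)

lemma bdd_meas_fe_grad: "bdd_meas (\<lambda>x. fst (fe_grad d m v x))" "bdd_meas (\<lambda>x. snd (fe_grad d m v x))"
  unfolding fe_grad_def fst_sum snd_sum fst_scaleR snd_scaleR real_scaleR_def
  by (intro bdd_meas_intros bdd_meas_hat_grad)+

lemma bform_integral: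
  assumes "\<And>i j. bdd_meas (F i j)"
  shows "bform n (\<lambda>i j. LINT x|area. F i j x) u v = (LINT x|area. (\<Sum>i<n. \<Sum>j<n. u i * F i j x * v j))"
proof -
  have int: "integrable area (\<lambda>x. u i * F i j x * v j)" for i j
    by (intro bdd_meas_integrable bdd_meas_mult bdd_meas_const assms)
  have "(LINT x|area. (\<Sum>i<n. \<Sum>j<n. u i * F i j x * v j)) = (\<Sum>i<n. LINT x|area. (\<Sum>j<n. u i * F i j x * v j))"
    by (intro Bochner_Integration.integral_sum Bochner_Integration.integrable_sum int)
  also have "\<dots> = (\<Sum>i<n. \<Sum>j<n. LINT x|area. u i * F i j x * v j)"
    by (intro sum.cong refl Bochner_Integration.integral_sum int)
  finally show ?thesis by (simp add: bform_def)
qed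

lemma bform_stiff:
  assumes "bdd_meas a"
  shows "bform (m\<^sup>2) (stiff d m a) u v = (LINT x|area. a x * inner (fe_grad d m u x) (fe_grad d m v x))"
proof -
  have "stiff d m a = (\<lambda>i j. LINT x|area. a x * inner (hat_grad d m i x) (hat_grad d m j x))"
    by (intro ext) (simp add: stiff_def)
  then have "bform (m\<^sup>2) (stiff d m a) u v =
     (LINT x|area. (\<Sum>i<m\<^sup>2. \<Sum>j<m\<^sup>2. u i * (a x * inner (hat_grad d m i x) (hat_grad d m j x)) * v j))"
    using bform_integral[of "\<lambda>i j x. a x * inner (hat_grad d m i x) (hat_grad d m j x)" "m\<^sup>2" u v]
      bdd_meas_stiff[OF assms] by simp
  also have "\<dots> = (LINT x|area. a x * inner (fe_grad d m u x) (fe_grad d m v x))"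
    unfolding fe_grad_def inner_sum_left unfolding inner_sum_right
    by (intro Bochner_Integration.integral_cong refl) (simp add: sum_distrib_left mult_ac)
  finally show ?thesis .
qed

lemma bform_convect:
  assumes "bdd_meas (\<lambda>x. fst (\<beta> x))" "bdd_meas (\<lambda>x. snd (\<beta> x))"
  shows "bform (m\<^sup>2) (convect d m \<beta>) u v = (LINT x|area. inner (fe_grad d m u x) (\<beta> x) * fe_fun d m v x)"
proof -
  have "convect d m \<beta> = (\<lambda>i j. LINT x|area. inner (hat_grad d m i x) (\<beta> x) * hat_fun d m j x)"
    by (intro ext) (simp add: convect_def)
  then have "bform (m\<^sup>2) (convect d m \<beta>) u v =
     (LINT x|area. (\<Sum>i<m\<^sup>2. \<Sum>j<m\<^sup>2. u i * (inner (hat_grad d m i x) (\<beta> x) * hat_fun d m j x) * v j))"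
    using bform_integral[of "\<lambda>i j x. inner (hat_grad d m i x) (\<beta> x) * hat_fun d m j x" "m\<^sup>2" u v]
      bdd_meas_convect[OF assms] by simp
  also have "\<dots> = (LINT x|area. inner (fe_grad d m u x) (\<beta> x) * fe_fun d m v x)"
    unfolding fe_grad_def fe_fun_def inner_sum_left sum_product
    by (intro Bochner_Integration.integral_cong refl) (simp add: mult_ac)
  finally show ?thesis .
qed

lemma bform_mass:
  assumes "bdd_meas c"
  shows "bform (m\<^sup>2) (\<lambda>i j. LINT x|area. c x * (hat_fun d m i x * hat_fun d m j x)) u v = (LINT x|area. c x * (fe_fun d m u x * fe_fun d m v x))"
proof -
  have "bform (m\<^sup>2) (\<lambda>i j. LINT x|area. c x * (hat_fun d m i x * hat_fun d m j x)) u v =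
     (LINT x|area. (\<Sum>i<m\<^sup>2. \<Sum>j<m\<^sup>2. u i * (c x * (hat_fun d m i x * hat_fun d m j x)) * v j))"
    by (intro bform_integral bdd_meas_mult assms bdd_meas_hat_fun)
  also have "\<dots> = (LINT x|area. c x * (fe_fun d m u x * fe_fun d m v x))"
    unfolding fe_fun_def sum_product
    by (intro Bochner_Integration.integral_cong refl) (simp add: sum_distrib_left mult_ac)
  finally show ?thesis .
qed

text \<open>A superset of the pairs of nodes whose basis functions have overlapping supports.\<close>

definition near :: "nat \<Rightarrow> nat \<Rightarrow> nat \<Rightarrow> bool" where
  "near m i j \<longleftrightarrow> \<bar>int (px m i) - int (px m j)\<bar> \<le> 2 \<and> \<bar>int (py m i) - int (py m j)\<bar> \<le> 2"

lemma near_commute: "near m i j = near m j i"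
  by (simp add: near_def abs_minus_commute)

lemma patches_meet_near:
  assumes "x \<in> patch m i" "x \<in> patch m j"
  shows "near m i j"
proof -
  have "\<bar>real_of_int (int (px m i) - int (px m j))\<bar> \<le> 2" "\<bar>real_of_int (int (py m i) - int (py m j))\<bar> \<le> 2"
    using assms unfolding patch_def mem_Collect_eq of_int_diff of_int_of_nat_eq by linarith+
  then show ?thesis unfolding near_def by linarith
qed

lemma card_near: "card {j \<in> {..<n}. near m i j} \<le> 25"
proof -
  define f where "f j = (int (px m j), int (py m j))" for j
  let ?B = "{int (px m i) - 2..int (px m i) + 2} \<times> {int (py m i) - 2..int (py m i) + 2}"
  have "card {j \<in> {..<n}. near m i j} \<le> card ?B"
  proof (rule card_inj_on_le[where f = f])
    show "inj_on f {j \<in> {..<n}. near m i j}"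
      unfolding f_def by (intro inj_onI) (metis Pair_inject index_eq_iff of_nat_eq_iff)
    show "f ` {j \<in> {..<n}. near m i j} \<subseteq> ?B"
      unfolding near_def f_def by (intro image_subsetI) (simp only: mem_Times_iff fst_conv snd_conv mem_Collect_eq atLeastAtMost_iff, linarith)
  qed simp
  also have "card ?B = 25" by (simp add: card_cartesian_product)
  finally show ?thesis .
qed

text \<open>Each row and column has at most 25 nonzero entries, so this is Cauchy-Schwarz over the pairs of neighbours.\<close>

lemma banded_form_bound:
  assumes b: "\<And>i j. i < n \<Longrightarrow> j < n \<Longrightarrow> \<bar>M i j\<bar> \<le> \<epsilon>"
    and z: "\<And>i j. i < n \<Longrightarrow> j < n \<Longrightarrow> \<not> near m i j \<Longrightarrow> M i j = 0"
    and eps: "0 \<le> \<epsilon>"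
  shows "(bform n M u v)\<^sup>2 \<le> (25 * \<epsilon>)\<^sup>2 * sqnorm n u * sqnorm n v"
proof -
  define S where "S = Sigma {..<n} (\<lambda>i. {j \<in> {..<n}. near m i j})"
  have finS: "finite S" by (simp add: S_def)
  have "\<bar>bform n M u v\<bar> \<le> (\<Sum>i<n. \<Sum>j<n. \<bar>u i * M i j * v j\<bar>)"
    unfolding bform_def by (intro order_trans[OF sum_abs] sum_mono sum_abs)
  also have "\<dots> \<le> (\<Sum>i<n. \<Sum>j\<in>{j \<in> {..<n}. near m i j}. \<epsilon> * (\<bar>u i\<bar> * \<bar>v j\<bar>))"
  proof (rule sum_mono)
    fix i assume i: "i \<in> {..<n}"
    have "(\<Sum>j<n. \<bar>u i * M i j * v j\<bar>) = (\<Sum>j\<in>{j \<in> {..<n}. near m i j}. \<bar>u i * M i j * v j\<bar>)"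
      using i z by (intro sum.mono_neutral_right) auto
    also have "\<dots> \<le> (\<Sum>j\<in>{j \<in> {..<n}. near m i j}. \<epsilon> * (\<bar>u i\<bar> * \<bar>v j\<bar>))"
    proof (rule sum_mono)
      fix j assume j: "j \<in> {j \<in> {..<n}. near m i j}"
      have "\<bar>M i j\<bar> * (\<bar>u i\<bar> * \<bar>v j\<bar>) \<le> \<epsilon> * (\<bar>u i\<bar> * \<bar>v j\<bar>)"
        using b[of i j] i j by (intro mult_right_mono) auto
      then show "\<bar>u i * M i j * v j\<bar> \<le> \<epsilon> * (\<bar>u i\<bar> * \<bar>v j\<bar>)" by (simp add: abs_mult mult_ac)
    qed
    finally show "(\<Sum>j<n. \<bar>u i * M i j * v j\<bar>) \<le> (\<Sum>j\<in>{j \<in> {..<n}. near m i j}. \<epsilon> * (\<bar>u i\<bar> * \<bar>v j\<bar>))" .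
  qed
  also have "\<dots> = \<epsilon> * (\<Sum>(i, j)\<in>S. \<bar>u i\<bar> * \<bar>v j\<bar>)"
    unfolding S_def by (subst sum.Sigma[symmetric]) (auto simp: sum_distrib_left)
  finally have abs: "\<bar>bform n M u v\<bar> \<le> \<epsilon> * (\<Sum>p\<in>S. \<bar>u (fst p)\<bar> * \<bar>v (snd p)\<bar>)"
    by (simp add: case_prod_beta)
  have rows: "(\<Sum>i<n. \<Sum>j\<in>{j \<in> {..<n}. near m i j}. (w i)\<^sup>2) \<le> 25 * sqnorm n w" for w
  proof -
    have "(\<Sum>i<n. \<Sum>j\<in>{j \<in> {..<n}. near m i j}. (w i)\<^sup>2) = (\<Sum>i<n. real (card {j \<in> {..<n}. near m i j}) * (w i)\<^sup>2)"
      by simp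
    also have "\<dots> \<le> (\<Sum>i<n. 25 * (w i)\<^sup>2)"
    proof (intro sum_mono mult_right_mono)
      show "real (card {j \<in> {..<n}. near m i j}) \<le> 25" for i using card_near[of n m i] by linarith
    qed simp
    finally show ?thesis by (simp add: sqnorm_def sum_distrib_left)
  qed
  have u: "(\<Sum>p\<in>S. \<bar>u (fst p)\<bar>\<^sup>2) \<le> 25 * sqnorm n u"
  proof -
    have "(\<Sum>p\<in>S. \<bar>u (fst p)\<bar>\<^sup>2) = (\<Sum>i<n. \<Sum>j\<in>{j \<in> {..<n}. near m i j}. (u i)\<^sup>2)"
      unfolding S_def by (subst sum.Sigma) (auto simp: case_prod_beta)
    then show ?thesis using rows[of u] by simp
  qed
  have "(\<Sum>p\<in>S. \<bar>v (snd p)\<bar>\<^sup>2) = (\<Sum>i<n. \<Sum>j\<in>{j \<in> {..<n}. near m i j}. (v j)\<^sup>2)"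
    unfolding S_def by (subst sum.Sigma) (auto simp: case_prod_beta)
  also have "\<dots> = (\<Sum>i<n. \<Sum>j<n. if near m i j then (v j)\<^sup>2 else 0)"
    by (simp only: sum.inter_filter[OF finite_lessThan])
  also have "\<dots> = (\<Sum>j<n. \<Sum>i<n. if near m j i then (v j)\<^sup>2 else 0)"
    by (subst sum.swap) (intro sum.cong refl if_cong near_commute)
  also have "\<dots> = (\<Sum>i<n. \<Sum>j\<in>{j \<in> {..<n}. near m i j}. (v i)\<^sup>2)"
    by (simp only: sum.inter_filter[OF finite_lessThan])
  also have "\<dots> \<le> 25 * sqnorm n v" by (rule rows)
  finally have v: "(\<Sum>p\<in>S. \<bar>v (snd p)\<bar>\<^sup>2) \<le> 25 * sqnorm n v" .
  have "(bform n M u v)\<^sup>2 \<le> (\<epsilon> * (\<Sum>p\<in>S. \<bar>u (fst p)\<bar> * \<bar>v (snd p)\<bar>))\<^sup>2"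
    using power_mono[OF abs abs_ge_zero, of 2] unfolding power2_abs .
  also have "\<dots> = \<epsilon>\<^sup>2 * (\<Sum>p\<in>S. \<bar>u (fst p)\<bar> * \<bar>v (snd p)\<bar>)\<^sup>2" by (simp add: power_mult_distrib)
  also have "\<dots> \<le> \<epsilon>\<^sup>2 * ((\<Sum>p\<in>S. \<bar>u (fst p)\<bar>\<^sup>2) * (\<Sum>p\<in>S. \<bar>v (snd p)\<bar>\<^sup>2))"
    by (intro mult_left_mono Cauchy_Schwarz_ineq_sum) simp
  also have "\<dots> \<le> \<epsilon>\<^sup>2 * ((25 * sqnorm n u) * (25 * sqnorm n v))"
    using u v by (intro mult_left_mono mult_mono) (auto intro: sum_nonneg)
  also have "\<dots> = (25 * \<epsilon>)\<^sup>2 * sqnorm n u * sqnorm n v" by (simp add: power2_eq_square)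
  finally show ?thesis .
qed

text \<open>The finite-dimensional inequality, applied to the Gram matrix of the two functions.\<close>

lemma integral_Cauchy_Schwarz:
  assumes F: "bdd_meas F" and G: "bdd_meas G"
  shows "(LINT x|area. F x * G x)\<^sup>2 \<le> (LINT x|area. (F x)\<^sup>2) * (LINT x|area. (G x)\<^sup>2)"
proof -
  define M :: "nat \<Rightarrow> nat \<Rightarrow> point \<Rightarrow> real" where "M i j x = (if i = 0 then F x else G x) * (if j = 0 then F x else G x)" for i j x
  define I where "I = (\<lambda>i j. LINT x|area. M i j x)"
  have bmM: "bdd_meas (M i j)" for i j unfolding M_def using F G by (cases "i = 0"; cases "j = 0") (simp_all add: bdd_meas_mult)
  have "0 \<le> bform 2 I w w" for w
  proof -
    have "bform 2 I w w = (LINT x|area. (\<Sum>i<2. \<Sum>j<2. w i * M i j x * w j))"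
      unfolding I_def by (rule bform_integral[OF bmM])
    also have "\<dots> = (LINT x|area. (w 0 * F x + w 1 * G x)\<^sup>2)"
      by (intro Bochner_Integration.integral_cong refl)
        (simp add: M_def numeral_2_eq_2 power2_eq_square algebra_simps)
    also have "0 \<le> \<dots>" by (intro integral_nonneg_AE AE_I2) simp
    finally show ?thesis .
  qed
  moreover have "I j i = I i j" for i j unfolding I_def M_def by (simp add: mult.commute)
  ultimately have "(bform 2 I (\<lambda>i. if i = 0 then 1 else 0) (\<lambda>i. if i = 0 then 0 else 1))\<^sup>2
     \<le> bform 2 I (\<lambda>i. if i = 0 then 1 else 0) (\<lambda>i. if i = 0 then 1 else 0)
      * bform 2 I (\<lambda>i. if i = 0 then 0 else 1) (\<lambda>i. if i = 0 then 0 else 1)"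
    by (intro bform_Cauchy_Schwarz) auto
  then show ?thesis
    by (simp add: bform_def numeral_2_eq_2 I_def M_def power2_eq_square)
qed

section \<open>The discrete Poincare inequality\<close>

text \<open>The grid function with the given interior values, extended by zero to the whole lattice.\<close>

definition grid_val :: "nat \<Rightarrow> (nat \<Rightarrow> real) \<Rightarrow> int \<Rightarrow> int \<Rightarrow> real" where
  "grid_val m v k l = (\<Sum>i<m\<^sup>2. v i * kron (k - int (px m i)) (l - int (py m i)))"

lemma grid_val_node:
  assumes "j < m\<^sup>2"
  shows "grid_val m v (int (px m j)) (int (py m j)) = v j"
proof -
  have k: "kron (int (px m j) - int (px m i)) (int (py m j) - int (py m i)) = (if i = j then 1 else 0)" for i
    using index_eq_iff[of i j m] by (auto simp: kron_def)
  show ?thesis unfolding grid_val_def k using assms by (simp add: if_distrib[of "\<lambda>c. _ * c"] cong: if_cong)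
qed

lemma grid_val_left: "grid_val m v 0 l = 0"
  by (simp add: grid_val_def kron_def)

lemma fst_fe_grad:
  assumes "\<not> upper d (frac (real (m+1) * fst x)) (frac (real (m+1) * snd x))"
  shows "fst (fe_grad d m v x) = real (m+1) *
     (grid_val m v (\<lfloor>real (m+1) * fst x\<rfloor> + 1) \<lfloor>real (m+1) * snd x\<rfloor> - grid_val m v \<lfloor>real (m+1) * fst x\<rfloor> \<lfloor>real (m+1) * snd x\<rfloor>)"
proof -
  have "fst (hat_grad d m i x) = real (m+1) *
     (kron (\<lfloor>real (m+1) * fst x\<rfloor> + 1 - int (px m i)) (\<lfloor>real (m+1) * snd x\<rfloor> - int (py m i))
      - kron (\<lfloor>real (m+1) * fst x\<rfloor> - int (px m i)) (\<lfloor>real (m+1) * snd x\<rfloor> - int (py m i)))" for i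
    unfolding hat_grad_def Let_def fst_conv hrow_def using assms by (simp add: algebra_simps)
  then show ?thesis
    unfolding fe_grad_def grid_val_def fst_sum fst_scaleR real_scaleR_def
    by (simp only: sum_distrib_left sum_subtractf[symmetric]) (simp only: right_diff_distrib mult_ac)
qed

text \<open>A square inside the lower triangle of a cell. There the first component of the gradient is the difference quotient along
  the bottom edge of the cell, so these boxes see all horizontal increments.\<close>

definition corner_box :: "diagonal \<Rightarrow> nat \<Rightarrow> nat \<Rightarrow> nat \<Rightarrow> point set" where
  "corner_box d m p q = (let s = (case d of Rising \<Rightarrow> 1/2 | Falling \<Rightarrow> 0); H = real (m+1) in
     box ((real p + s) / H, real q / H) ((real p + s + 1/2) / H, (real q + 1/2) / H))"

lemma corner_box_iff:
  "x \<in> corner_box d m p q \<longleftrightarrow> (let s = (case d of Rising \<Rightarrow> 1/2 | Falling \<Rightarrow> 0); H = real (m+1) in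
     real p + s < H * fst x \<and> H * fst x < real p + s + 1/2 \<and> real q < H * snd x \<and> H * snd x < real q + 1/2)"
proof -
  have H: "real (m+1) > 0" by simp
  have box: "x \<in> box (a, b) (c, e) \<longleftrightarrow> a < fst x \<and> fst x < c \<and> b < snd x \<and> snd x < e" for a b c e :: real
    by (cases x) (auto simp: box_def Basis_prod_def)
  show ?thesis
    unfolding corner_box_def Let_def box pos_divide_less_eq[OF H] pos_less_divide_eq[OF H] mult.commute[of _ "real (m+1)"]
    by simp
qed

lemma corner_box_floor:
  assumes "x \<in> corner_box d m p q"
  shows "\<lfloor>real (m+1) * fst x\<rfloor> = int p" "\<lfloor>real (m+1) * snd x\<rfloor> = int q"
    "\<not> upper d (frac (real (m+1) * fst x)) (frac (real (m+1) * snd x))"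
proof -
  define X Y where "X = real (m+1) * fst x" and "Y = real (m+1) * snd x"
  define s :: real where "s = (case d of Rising \<Rightarrow> 1/2 | Falling \<Rightarrow> 0)"
  have s: "0 \<le> s" "s \<le> 1/2" by (auto simp: s_def split: diagonal.split)
  have b: "real p + s < X" "X < real p + s + 1/2" "real q < Y" "Y < real q + 1/2"
    using assms unfolding corner_box_iff Let_def X_def Y_def s_def by auto
  have fl: "\<lfloor>X\<rfloor> = int p" "\<lfloor>Y\<rfloor> = int q" using b s by (auto simp: floor_eq_iff)
  then show "\<lfloor>real (m+1) * fst x\<rfloor> = int p" "\<lfloor>real (m+1) * snd x\<rfloor> = int q" unfolding X_def Y_def .
  have "\<not> upper d (frac X) (frac Y)"
    using b fl by (cases d) (simp_all add: frac_def s_def)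
  then show "\<not> upper d (frac (real (m+1) * fst x)) (frac (real (m+1) * snd x))" unfolding X_def Y_def .
qed

lemma corner_box_subset:
  assumes "p \<le> m" "q \<le> m"
  shows "corner_box d m p q \<subseteq> Omega"
proof
  fix x assume x: "x \<in> corner_box d m p q"
  define H where "H = real (m+1)"
  have H: "H > 0" by (simp add: H_def)
  define s :: real where "s = (case d of Rising \<Rightarrow> 1/2 | Falling \<Rightarrow> 0)"
  have s: "0 \<le> s" "s \<le> 1/2" by (auto simp: s_def split: diagonal.split)
  have "real p + s < H * fst x" "H * fst x < real p + s + 1/2" "real q < H * snd x" "H * snd x < real q + 1/2"
    using x unfolding corner_box_iff Let_def H_def s_def by auto
  moreover have "real p + 1 \<le> H" "real q + 1 \<le> H" using assms by (simp_all add: H_def)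
  ultimately have "0 < H * fst x" "H * fst x < H * 1" "0 < H * snd x" "H * snd x < H * 1"
    using s of_nat_0_le_iff[of p, where 'a = real] of_nat_0_le_iff[of q, where 'a = real] by argo+
  then show "x \<in> Omega"
    unfolding Omega_def using H
    by (simp only: mem_Times_iff greaterThanLessThan_iff zero_less_mult_iff mult_less_cancel_left_pos) auto
qed

lemma measure_corner_box: "measure lborel (corner_box d m p q) = 1 / (4 * (real (m+1))\<^sup>2)"
proof -
  define r where "r = real (m+1)"
  have r: "r > 0" by (simp add: r_def)
  have le: "s / r \<le> (s + 1/2) / r" for s using r by (simp add: divide_right_mono)
  have w: "(s + 1/2) / r - s / r = 1 / (2 * r)" for s by (simp add: diff_divide_distrib[symmetric])
  have "measure lborel (box (s / r, t / r) ((s + 1/2) / r, (t + 1/2) / r)) = 1 / (4 * r\<^sup>2)" for s t :: real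
    by (subst measure_lborel_box_eq) (auto simp: Basis_prod_def le w power2_eq_square)
  then show ?thesis unfolding corner_box_def Let_def r_def .
qed

lemma stiff_ge_differences:
  "(\<Sum>p\<le>m. \<Sum>q\<le>m. (grid_val m v (int p + 1) (int q) - grid_val m v (int p) (int q))\<^sup>2) / 4
    \<le> bform (m\<^sup>2) (stiff d m (\<lambda>_. 1)) v v"
proof -
  define H where "H = real (m+1)"
  have H: "H > 0" by (simp add: H_def)
  define D where "D p q = grid_val m v (int p + 1) (int q) - grid_val m v (int p) (int q)" for p q
  define B where "B = (\<lambda>(p, q). corner_box d m p q)"
  define I where "I = {..m} \<times> {..m}"
  define F where "F x = (\<Sum>pq\<in>I. indicator (B pq) x * (H * D (fst pq) (snd pq))\<^sup>2)" for x
  have bmB: "bdd_meas (\<lambda>x. indicator (B pq) x)" for pq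
  proof (rule bdd_measI[of _ 1])
    have "corner_box d m p q \<in> sets borel" for p q unfolding corner_box_def Let_def by simp
    then have "B pq \<in> sets borel" by (cases pq) (simp add: B_def)
    then show "(\<lambda>x. indicator (B pq) x :: real) \<in> borel_measurable area"
      by (intro measurable_area borel_measurable_indicator)
  qed (simp add: indicator_def)
  have F_le: "F x \<le> 1 * inner (fe_grad d m v x) (fe_grad d m v x)" if "x \<in> Omega" for x
  proof (cases "\<exists>pq\<in>I. x \<in> B pq")
    case True
    then obtain p q where pq: "(p, q) \<in> I" "x \<in> corner_box d m p q" by (auto simp: B_def)
    have "F x = (\<Sum>pq\<in>I. if pq = (p, q) then (H * D p q)\<^sup>2 else 0)"
      unfolding F_def
    proof (rule sum.cong[OF refl])
      fix pq' assume "pq' \<in> I"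
      obtain p' q' where e: "pq' = (p', q')" by (cases pq')
      have "x \<in> B pq' \<longleftrightarrow> pq' = (p, q)"
        using corner_box_floor(1,2)[OF pq(2)] corner_box_floor(1,2)[of x d m p' q'] pq(2)
        unfolding e B_def prod.case by auto
      then show "indicator (B pq') x * (H * D (fst pq') (snd pq'))\<^sup>2 = (if pq' = (p, q) then (H * D p q)\<^sup>2 else 0)"
        by (simp add: indicator_def)
    qed
    also have "\<dots> = (H * D p q)\<^sup>2" using pq(1) by (simp add: I_def)
    also have "H * D p q = fst (fe_grad d m v x)"
      unfolding fst_fe_grad[OF corner_box_floor(3)[OF pq(2)]] corner_box_floor(1,2)[OF pq(2)] D_def H_def ..
    finally show ?thesis by (simp add: inner_prod_def power2_eq_square)
  next
    case False
    then have "F x = 0" unfolding F_def by (intro sum.neutral) (auto simp: indicator_def)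
    then show ?thesis by simp
  qed
  have box_int: "(LINT x|area. indicator (B (p, q)) x * (H * D p q)\<^sup>2) = (D p q)\<^sup>2 / 4" if "p \<le> m" "q \<le> m" for p q
  proof -
    have "(LINT x|area. indicator (B (p, q)) x * (H * D p q)\<^sup>2)
       = (LINT x|lborel. indicator (corner_box d m p q) x *\<^sub>R (H * D p q)\<^sup>2)"
      unfolding integral_area using corner_box_subset[OF that, of d]
      by (intro Bochner_Integration.integral_cong refl) (auto simp: B_def indicator_def)
    also have "\<dots> = measure lborel (corner_box d m p q) * (H * D p q)\<^sup>2" by simp
    also have "\<dots> = (D p q)\<^sup>2 / 4"
      unfolding measure_corner_box H_def[symmetric] using H by (simp add: power_mult_distrib)
    finally show ?thesis .
  qed
  have "(\<Sum>p\<le>m. \<Sum>q\<le>m. (D p q)\<^sup>2) / 4 = (\<Sum>pq\<in>I. (D (fst pq) (snd pq))\<^sup>2 / 4)"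
    unfolding I_def by (simp add: sum.cartesian_product sum_divide_distrib case_prod_beta)
  also have "\<dots> = (\<Sum>pq\<in>I. LINT x|area. indicator (B pq) x * (H * D (fst pq) (snd pq))\<^sup>2)"
  proof (intro sum.cong refl)
    fix pq assume "pq \<in> I"
    then obtain p q where "pq = (p, q)" "p \<le> m" "q \<le> m" by (auto simp: I_def)
    then show "(D (fst pq) (snd pq))\<^sup>2 / 4 = (LINT x|area. indicator (B pq) x * (H * D (fst pq) (snd pq))\<^sup>2)"
      using box_int[of p q] by (simp only: fst_conv snd_conv)
  qed
  also have "\<dots> = (LINT x|area. F x)"
    unfolding F_def
    by (intro Bochner_Integration.integral_sum[symmetric] bdd_meas_integrable bdd_meas_mult bdd_meas_const bmB)
  also have "\<dots> \<le> (LINT x|area. 1 * inner (fe_grad d m v x) (fe_grad d m v x))"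
  proof (rule integral_mono)
    show "integrable area F" unfolding F_def
      by (intro bdd_meas_integrable bdd_meas_sum bdd_meas_mult bdd_meas_const bmB)
    show "integrable area (\<lambda>x. 1 * inner (fe_grad d m v x) (fe_grad d m v x))"
      by (intro bdd_meas_integrable bdd_meas_mult bdd_meas_const bdd_meas_inner bdd_meas_fe_grad)
    show "F x \<le> 1 * inner (fe_grad d m v x) (fe_grad d m v x)" if "x \<in> space area" for x
      using F_le that by simp
  qed
  also have "\<dots> = bform (m\<^sup>2) (stiff d m (\<lambda>_. 1)) v v"
    by (rule bform_stiff[symmetric]) (rule bdd_meas_const)
  finally show ?thesis unfolding D_def .
qed

lemma telescope_square_le:
  fixes f :: "nat \<Rightarrow> real"
  assumes "f 0 = 0" "p \<le> n"
  shows "(f p)\<^sup>2 \<le> real n * (\<Sum>r<n. (f (Suc r) - f r)\<^sup>2)"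
proof -
  have "f p = (\<Sum>r<p. 1 * (f (Suc r) - f r))" using assms(1) by (simp add: sum_lessThan_telescope)
  then have "(f p)\<^sup>2 = (\<Sum>r<p. 1 * (f (Suc r) - f r))\<^sup>2" by (rule arg_cong)
  also have "\<dots> \<le> (\<Sum>r<p. 1\<^sup>2) * (\<Sum>r<p. (f (Suc r) - f r)\<^sup>2)" by (rule Cauchy_Schwarz_ineq_sum)
  also have "\<dots> \<le> real n * (\<Sum>r<n. (f (Suc r) - f r)\<^sup>2)"
    using assms(2) by (intro mult_mono sum_mono2 sum_nonneg) auto
  finally show ?thesis .
qed

text \<open>The discrete Poincare inequality: a grid function that vanishes for \<open>p = 0\<close> is summed up from its horizontal
  increments, and these are controlled by the Dirichlet form.\<close>

lemma stiff_coercive: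
  assumes m: "m \<ge> 1"
  shows "sqnorm (m\<^sup>2) v \<le> 4 * (real (m+1))\<^sup>2 * bform (m\<^sup>2) (stiff d m (\<lambda>_. 1)) v v"
proof -
  define V where "V p q = grid_val m v (int p) (int q)" for p q :: nat
  define S where "S = (\<Sum>q\<le>m. \<Sum>r\<le>m. (V (Suc r) q - V r q)\<^sup>2)"
  have col: "(V p q)\<^sup>2 \<le> real (m+1) * (\<Sum>r\<le>m. (V (Suc r) q - V r q)\<^sup>2)" if "p \<le> m" for p q
    using telescope_square_le[of "\<lambda>p. V p q" p "m+1"] that
    by (simp add: V_def grid_val_left lessThan_Suc_atMost)
  have "sqnorm (m\<^sup>2) v = (\<Sum>i<m\<^sup>2. (\<lambda>(p, q). (V p q)\<^sup>2) (px m i, py m i))"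
    unfolding sqnorm_def V_def prod.case by (intro sum.cong refl) (simp only: grid_val_node lessThan_iff)
  also have "\<dots> = (\<Sum>pq\<in>(\<lambda>i. (px m i, py m i)) ` {..<m\<^sup>2}. (\<lambda>(p, q). (V p q)\<^sup>2) pq)"
    by (rule sum.reindex[symmetric, unfolded o_def]) (intro inj_onI, metis Pair_inject index_eq_iff)
  also have "\<dots> \<le> (\<Sum>pq\<in>{..m} \<times> {..m}. (\<lambda>(p, q). (V p q)\<^sup>2) pq)"
    using px_le[OF m] py_le[of _ m] by (intro sum_mono2) (auto simp del: of_nat_Suc)
  also have "\<dots> = (\<Sum>p\<le>m. \<Sum>q\<le>m. (V p q)\<^sup>2)" by (simp add: sum.cartesian_product)
  also have "\<dots> \<le> (\<Sum>p\<le>m. \<Sum>q\<le>m. real (m+1) * (\<Sum>r\<le>m. (V (Suc r) q - V r q)\<^sup>2))"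
    using col by (intro sum_mono) auto
  also have "\<dots> = (real (m+1))\<^sup>2 * S"
    by (simp add: S_def sum_distrib_left[symmetric] power2_eq_square)
  also have "S = (\<Sum>p\<le>m. \<Sum>q\<le>m. (grid_val m v (int p + 1) (int q) - grid_val m v (int p) (int q))\<^sup>2)"
    unfolding S_def V_def by (subst sum.swap) (simp add: add.commute)
  also have "(real (m+1))\<^sup>2 * \<dots> \<le> (real (m+1))\<^sup>2 * (4 * bform (m\<^sup>2) (stiff d m (\<lambda>_. 1)) v v)"
    using stiff_ge_differences[of m v d] by (intro mult_left_mono) auto
  finally show ?thesis by (simp add: mult_ac)
qed

lemma stiff_diagonal_ge:
  assumes i: "i < m\<^sup>2"
  shows "1 / 4 \<le> stiff d m (\<lambda>_. 1) i i"
proof -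
  have m: "m \<ge> 1" using i by (cases m) auto
  define v :: "nat \<Rightarrow> real" where "v j = (if j = i then 1 else 0)" for j
  define D where "D p q = grid_val m v (int p + 1) (int q) - grid_val m v (int p) (int q)" for p q
  have gv: "grid_val m v k l = kron (k - int (px m i)) (l - int (py m i))" for k l
    unfolding grid_val_def v_def using i by (simp add: if_distrib[of "\<lambda>c. c * _"] cong: if_cong)
  have "D (px m i) (py m i) = -1" unfolding D_def gv by (simp add: kron_def)
  then have "1 = (D (px m i) (py m i))\<^sup>2" by simp
  also have "\<dots> \<le> (\<Sum>q\<le>m. (D (px m i) q)\<^sup>2)"
    using py_le[OF i] by (intro member_le_sum[of _ _ "\<lambda>q. (D (px m i) q)\<^sup>2"]) auto
  also have "\<dots> \<le> (\<Sum>p\<le>m. \<Sum>q\<le>m. (D p q)\<^sup>2)"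
    using px_le[OF m, of i] by (intro member_le_sum[of _ _ "\<lambda>p. \<Sum>q\<le>m. (D p q)\<^sup>2"]) (auto intro: sum_nonneg)
  finally have "1 / 4 \<le> bform (m\<^sup>2) (stiff d m (\<lambda>_. 1)) v v"
    using stiff_ge_differences[of m v d] unfolding D_def by linarith
  also have "\<dots> = stiff d m (\<lambda>_. 1) i i"
    unfolding bform_def v_def using i by (simp add: if_distrib[of "\<lambda>c. c * _"] if_distrib[of "\<lambda>c. _ * c"] cong: if_cong)
  finally show ?thesis .
qed

section \<open>Smooth functions on the square\<close>

lemma convex_Omega: "convex Omega"
  by (simp add: Omega_def convex_Times)

lemma Ck_closure_bounded:
  assumes "Ck_closure k Omega f"
  shows "\<exists>B\<ge>0. \<forall>x\<in>closure Omega. \<bar>f x\<bar> \<le> B"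
proof -
  have "continuous_on (closure Omega) f" using assms by (cases k) simp_all
  moreover have "compact (closure Omega)" unfolding closure_Omega by (intro compact_Times compact_Icc)
  ultimately have "bounded (f ` closure Omega)" by (intro compact_imp_bounded compact_continuous_image)
  then obtain B where "\<forall>x\<in>closure Omega. \<bar>f x\<bar> \<le> B" unfolding bounded_iff by auto
  then show ?thesis by (intro exI[of _ "\<bar>B\<bar>"]) force
qed

lemma onorm_pair_le:
  fixes p q :: real
  shows "onorm (\<lambda>v :: point. p * fst v + q * snd v) \<le> \<bar>p\<bar> + \<bar>q\<bar>"
proof (rule onorm_bound)
  fix v :: point
  have "\<bar>p * fst v\<bar> \<le> \<bar>p\<bar> * norm v" "\<bar>q * snd v\<bar> \<le> \<bar>q\<bar> * norm v"
    unfolding abs_mult using norm_fst_le[of "fst v" "snd v"] norm_snd_le[of "snd v" "fst v"]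
    by (auto intro!: mult_left_mono)
  then show "norm (p * fst v + q * snd v) \<le> (\<bar>p\<bar> + \<bar>q\<bar>) * norm v"
    by (simp add: distrib_right)
qed simp

lemma C1_closure_Lipschitz:
  assumes "Ck_closure (Suc k) Omega f"
  shows "\<exists>L\<ge>0. \<forall>x\<in>Omega. \<forall>y\<in>Omega. \<bar>f y - f x\<bar> \<le> L * norm (y - x)"
proof -
  obtain g h where gh: "Ck_closure k Omega g" "Ck_closure k Omega h"
    and der: "\<And>x. x \<in> Omega \<Longrightarrow> (f has_derivative (\<lambda>v. g x * fst v + h x * snd v)) (at x)"
    using assms by auto
  obtain A where A: "A \<ge> 0" "\<forall>x\<in>closure Omega. \<bar>g x\<bar> \<le> A" using Ck_closure_bounded[OF gh(1)] by blast
  obtain B where B: "B \<ge> 0" "\<forall>x\<in>closure Omega. \<bar>h x\<bar> \<le> B" using Ck_closure_bounded[OF gh(2)] by blast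
  have "\<bar>f y - f x\<bar> \<le> (A + B) * norm (y - x)" if xy: "x \<in> Omega" "y \<in> Omega" for x y
  proof -
    have "norm (f y - f x) \<le> (A + B) * norm (y - x)"
    proof (rule differentiable_bound[OF convex_Omega _ _ xy(2,1)])
      fix z assume z: "z \<in> Omega"
      show "(f has_derivative (\<lambda>v. g z * fst v + h z * snd v)) (at z within Omega)"
        by (rule has_derivative_at_withinI[OF der[OF z]])
      have "z \<in> closure Omega" using z closure_subset[of Omega] by blast
      then have "\<bar>g z\<bar> + \<bar>h z\<bar> \<le> A + B" using A B by (intro add_mono) auto
      then show "onorm (\<lambda>v. g z * fst v + h z * snd v) \<le> A + B"
        by (rule order_trans[OF onorm_pair_le])
    qed
    then show ?thesis by simp
  qed
  then show ?thesis using A(1) B(1) by (intro exI[of _ "A + B"]) auto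
qed

lemma C2_closure_Taylor:
  assumes "Ck_closure 2 Omega a"
  obtains C g h where "C \<ge> 0" and "\<And>x y. x \<in> Omega \<Longrightarrow> y \<in> Omega \<Longrightarrow>
      \<bar>a y - a x - (g x * (fst y - fst x) + h x * (snd y - snd x))\<bar> \<le> C * (norm (y - x))\<^sup>2"
proof -
  obtain g h where gh: "Ck_closure 1 Omega g" "Ck_closure 1 Omega h"
    and der: "\<And>x. x \<in> Omega \<Longrightarrow> (a has_derivative (\<lambda>v. g x * fst v + h x * snd v)) (at x)"
    using assms by (auto simp: numeral_2_eq_2)
  obtain A where A: "A \<ge> 0" "\<forall>x\<in>Omega. \<forall>y\<in>Omega. \<bar>g y - g x\<bar> \<le> A * norm (y - x)"
    using C1_closure_Lipschitz[of 0 g] gh(1) by auto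
  obtain B where B: "B \<ge> 0" "\<forall>x\<in>Omega. \<forall>y\<in>Omega. \<bar>h y - h x\<bar> \<le> B * norm (y - x)"
    using C1_closure_Lipschitz[of 0 h] gh(2) by auto
  have "\<bar>a y - a x - (g x * (fst y - fst x) + h x * (snd y - snd x))\<bar> \<le> (A + B) * (norm (y - x))\<^sup>2"
    if xy: "x \<in> Omega" "y \<in> Omega" for x y
  proof -
    define \<phi> where "\<phi> z = a z - (g x * fst z + h x * snd z)" for z
    have seg: "closed_segment x y \<subseteq> Omega" using xy convex_Omega by (simp add: closed_segment_subset)
    have "norm (\<phi> y - \<phi> x) \<le> ((A + B) * norm (y - x)) * norm (y - x)"
    proof (rule differentiable_bound[OF convex_closed_segment[of x y]])
      fix z assume z: "z \<in> closed_segment x y"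
      then have zO: "z \<in> Omega" using seg by blast
      have "(\<phi> has_derivative (\<lambda>v. (g z * fst v + h z * snd v) - (g x * fst v + h x * snd v))) (at z)"
        unfolding \<phi>_def by (intro has_derivative_diff der[OF zO] has_derivative_add has_derivative_mult_right
            has_derivative_fst has_derivative_snd has_derivative_ident)
      then have "(\<phi> has_derivative (\<lambda>v. (g z - g x) * fst v + (h z - h x) * snd v)) (at z)"
        by (simp add: algebra_simps)
      then show "(\<phi> has_derivative (\<lambda>v. (g z - g x) * fst v + (h z - h x) * snd v)) (at z within closed_segment x y)"
        by (rule has_derivative_at_withinI)
      have zx: "norm (z - x) \<le> norm (y - x)" using segment_bound(1)[OF z] by simp
      have "\<bar>g z - g x\<bar> + \<bar>h z - h x\<bar> \<le> A * norm (z - x) + B * norm (z - x)"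
        using A(2) B(2) xy(1) zO by (intro add_mono) blast+
      also have "\<dots> \<le> A * norm (y - x) + B * norm (y - x)"
        using zx A(1) B(1) by (intro add_mono mult_left_mono)
      finally have "\<bar>g z - g x\<bar> + \<bar>h z - h x\<bar> \<le> (A + B) * norm (y - x)" by (simp add: distrib_right)
      then show "onorm (\<lambda>v. (g z - g x) * fst v + (h z - h x) * snd v) \<le> (A + B) * norm (y - x)"
        by (rule order_trans[OF onorm_pair_le])
    qed simp_all
    then show ?thesis by (simp add: \<phi>_def power2_eq_square algebra_simps)
  qed
  then show ?thesis using that[of "A + B" g h] A(1) B(1) by simp
qed

lemma norm_point_sq: "(norm (x :: point))\<^sup>2 = (fst x)\<^sup>2 + (snd x)\<^sup>2"
  by (cases x) (simp add: norm_Pair)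

section \<open>Central symmetry and the midpoint rule\<close>

text \<open>The midpoint of two nodes, equal to the node itself for equal indices.\<close>

definition edge_mid :: "nat \<Rightarrow> nat \<Rightarrow> nat \<Rightarrow> point" where
  "edge_mid m i j = ((real (px m i) + real (px m j)) / (2 * real (m+1)), (real (py m i) + real (py m j)) / (2 * real (m+1)))"

lemma edge_mid_in_Omega:
  assumes "i < m\<^sup>2" "j < m\<^sup>2"
  shows "edge_mid m i j \<in> Omega"
proof -
  have m: "m \<ge> 1" using assms(1) by (cases m) auto
  have "real (px m i) \<le> m" "real (px m j) \<le> m" "real (py m i) \<le> m" "real (py m j) \<le> m"
    using px_le[OF m] py_le[OF assms(1)] py_le[OF assms(2)] by (simp_all only: of_nat_le_iff)
  moreover have "real (px m i) \<ge> 1" "real (py m i) \<ge> 1" "real (px m j) \<ge> 1" "real (py m j) \<ge> 1" by simp_all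
  moreover have "0 < (p + q) / (2 * real (m+1)) \<and> (p + q) / (2 * real (m+1)) < 1"
    if "1 \<le> p" "1 \<le> q" "p \<le> real m" "q \<le> real m" for p q :: real
    using that by (simp add: field_simps)
  ultimately show ?thesis unfolding edge_mid_def Omega_def mem_Times_iff fst_conv snd_conv greaterThanLessThan_iff
    by blast
qed

definition reflect :: "nat \<Rightarrow> nat \<Rightarrow> nat \<Rightarrow> point \<Rightarrow> point" where
  "reflect m i j x = 2 *\<^sub>R edge_mid m i j - x"

lemma reflect_scaled:
  "real (m+1) * fst (reflect m i j x) = real (px m i) + real (px m j) - real (m+1) * fst x"
  "real (m+1) * snd (reflect m i j x) = real (py m i) + real (py m j) - real (m+1) * snd x"
proof -
  have k: "real (m+1) * (2 * (a / (2 * real (m+1)))) = a" for a by (simp del: of_nat_Suc of_nat_add)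
  show "real (m+1) * fst (reflect m i j x) = real (px m i) + real (px m j) - real (m+1) * fst x"
    "real (m+1) * snd (reflect m i j x) = real (py m i) + real (py m j) - real (m+1) * snd x"
    unfolding reflect_def edge_mid_def fst_diff snd_diff fst_scaleR snd_scaleR fst_conv snd_conv real_scaleR_def right_diff_distrib k
    by (rule refl)+
qed

lemma hat_fun_reflect: "hat_fun d m i (reflect m i j x) = hat_fun d m j x"
proof -
  have "hat_fun d m i (reflect m i j x) = hat d (- (real (m+1) * fst x - real (px m j))) (- (real (m+1) * snd x - real (py m j)))"
    unfolding hat_fun_def reflect_scaled by (simp only: minus_diff_eq) (simp add: algebra_simps)
  then show ?thesis unfolding hat_minus hat_fun_def .
qed

lemma off_grid_reflect:
  assumes "off_grid d m x" shows "off_grid d m (reflect m i j x)"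
proof -
  have ints: "n - t \<in> \<int> \<Longrightarrow> n \<in> \<int> \<Longrightarrow> t \<in> \<int>" for n t :: real
    using Ints_diff[of n "n - t"] by simp
  define s :: real where "s = (case d of Rising \<Rightarrow> - 1 | Falling \<Rightarrow> 1)"
  have s: "s \<in> \<int>" by (cases d) (simp_all add: s_def)
  define A B where "A = real (px m i) + real (px m j)" and "B = real (py m i) + real (py m j)"
  have AB: "A \<in> \<int>" "B \<in> \<int>" "A + s * B \<in> \<int>" using s by (simp_all add: A_def B_def)
  have "A - X + s * (B - Y) = (A + s * B) - (X + s * Y)" for X Y by (simp add: algebra_simps)
  then show ?thesis
    using assms ints[OF _ AB(1)] ints[OF _ AB(2)] ints[OF _ AB(3)]
    unfolding off_grid_def reflect_scaled A_def[symmetric] B_def[symmetric] s_def[symmetric] by metis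
qed

text \<open>The point reflection at the midpoint of two nodes exchanges the two basis functions, because the hat function is
  even.\<close>

lemma hat_grad_reflect:
  assumes "off_grid d m x"
  shows "hat_grad d m i (reflect m i j x) = - hat_grad d m j x"
proof -
  define w where "w = hat_grad d m i (reflect m i j x)"
  have r: "(reflect m i j has_derivative (\<lambda>v. - v)) (at x)"
    unfolding reflect_def[abs_def] by (auto intro!: derivative_eq_intros)
  have "((\<lambda>x. hat_fun d m i (reflect m i j x)) has_derivative (\<lambda>v. inner w (- v))) (at x)"
    unfolding w_def
    by (rule has_derivative_compose[OF r hat_fun_has_derivative[OF off_grid_reflect[OF assms]]])
  then have "(hat_fun d m j has_derivative (\<lambda>v. inner (- w) v)) (at x)"
    unfolding hat_fun_reflect by (simp add: inner_minus_left inner_minus_right)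
  then have "gradient (hat_fun d m j) x = - w" by (rule gradient_eqI)
  then show ?thesis using gradient_hat_fun[OF assms] by (simp add: w_def)
qed

lemma reflect_commute: "reflect m i j = reflect m j i"
  by (simp add: reflect_def[abs_def] edge_mid_def add.commute)

lemma integral_lborel_reflect:
  fixes f :: "point \<Rightarrow> real"
  assumes [measurable]: "f \<in> borel_measurable borel"
  shows "(LINT x|lborel. f x) = (LINT x|lborel. f (t - x))"
proof -
  have "lborel = distr lborel borel (\<lambda>x. t + (- 1) *\<^sub>R x)"
    using lborel_affine[of "-1" t] by (simp add: density_1)
  then have "(LINT x|lborel. f x) = (LINT x|distr lborel borel (\<lambda>x. t + (- 1) *\<^sub>R x). f x)" by simp
  also have "\<dots> = (LINT x|lborel. f (t + (- 1) *\<^sub>R x))"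
    by (rule integral_distr) simp_all
  finally show ?thesis by simp
qed

lemma off_grid_patch_in_Omega:
  assumes "i < m\<^sup>2" "x \<in> patch m i" "off_grid d m x"
  shows "x \<in> Omega"
proof -
  have m: "m \<ge> 1" using assms(1) by (cases m) auto
  define X Y where "X = real (m+1) * fst x" and "Y = real (m+1) * snd x"
  have "real (px m i) \<le> m" "real (py m i) \<le> m" "1 \<le> real (px m i)" "1 \<le> real (py m i)"
    using px_le[OF m, of i] py_le[OF assms(1)] by linarith+
  moreover have "\<bar>X - real (px m i)\<bar> \<le> 1" "\<bar>Y - real (py m i)\<bar> \<le> 1"
    using assms(2) by (simp_all only: patch_def X_def Y_def mem_Collect_eq)
  ultimately have "0 \<le> X" "X \<le> real (m+1)" "0 \<le> Y" "Y \<le> real (m+1)" unfolding abs_le_iff by simp_all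
  moreover have "X \<noteq> 0" "X \<noteq> real (m+1)" "Y \<noteq> 0" "Y \<noteq> real (m+1)"
    using assms(3) unfolding off_grid_def X_def[symmetric] Y_def[symmetric]
    by (auto simp del: of_nat_Suc of_nat_add)
  ultimately have "0 < X" "X < real (m+1) * 1" "0 < Y" "Y < real (m+1) * 1" by simp_all
  then show ?thesis
    unfolding Omega_def X_def Y_def mem_Times_iff greaterThanLessThan_iff
    by (simp only: zero_less_mult_iff mult_less_cancel_left) auto
qed

text \<open>The product of the two gradients is even under the reflection at the midpoint of the nodes, so its first moments
  about that point vanish. This is the cancellation behind the second-order accuracy of \<open>stiff_midpoint\<close>.\<close>

lemma integral_odd_zero:
  assumes i: "i < m\<^sup>2" and j: "j < m\<^sup>2"
  shows "(LINT x|area. (p * (fst x - fst (edge_mid m i j)) + q * (snd x - snd (edge_mid m i j)))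
     * inner (hat_grad d m i x) (hat_grad d m j x)) = 0"
proof -
  define E where "E x = (p * (fst x - fst (edge_mid m i j)) + q * (snd x - snd (edge_mid m i j)))
     * inner (hat_grad d m i x) (hat_grad d m j x)" for x
  have [measurable]: "(\<lambda>x::point. fst x) \<in> borel_measurable borel" "(\<lambda>x::point. snd x) \<in> borel_measurable borel"
    by (intro borel_measurable_continuous_onI continuous_intros)+
  note [measurable] = measurable_hat_grad
  have E_meas: "E \<in> borel_measurable borel"
    unfolding E_def inner_prod_def inner_real_def by measurable
  have "(LINT x|area. E x) = (LINT x|lborel. indicator Omega x *\<^sub>R E x)" by (rule integral_area)
  also have "\<dots> = (LINT x|lborel. E x)"
  proof (rule integral_cong_AE)
    show "AE x in lborel. indicator Omega x *\<^sub>R E x = E x"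
      using off_grid_AE[of d m]
    proof eventually_elim
      fix x assume x: "off_grid d m x"
      show "indicator Omega x *\<^sub>R E x = E x"
      proof (cases "x \<in> Omega")
        case False
        then have "x \<notin> patch m i" using off_grid_patch_in_Omega[OF i _ x] by blast
        then have "E x = 0" unfolding E_def by (simp add: hat_grad_patch)
        then show ?thesis by simp
      qed simp
    qed
    show "(\<lambda>x. indicator Omega x *\<^sub>R E x) \<in> borel_measurable lborel" "E \<in> borel_measurable lborel"
      using E_meas by simp_all
  qed
  finally have area: "(LINT x|area. E x) = (LINT x|lborel. E x)" .
  have "(LINT x|lborel. E x) = (LINT x|lborel. E (reflect m i j x))"
    unfolding reflect_def by (rule integral_lborel_reflect[OF E_meas])
  also have "\<dots> = (LINT x|lborel. - E x)"
  proof (rule integral_cong_AE)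
    show "AE x in lborel. E (reflect m i j x) = - E x"
      using off_grid_AE[of d m]
    proof eventually_elim
      fix x assume x: "off_grid d m x"
      have f: "fst (reflect m i j x) - fst (edge_mid m i j) = - (fst x - fst (edge_mid m i j))"
        "snd (reflect m i j x) - snd (edge_mid m i j) = - (snd x - snd (edge_mid m i j))"
        by (simp_all add: reflect_def)
      have g: "hat_grad d m i (reflect m i j x) = - hat_grad d m j x" "hat_grad d m j (reflect m i j x) = - hat_grad d m i x"
        using hat_grad_reflect[OF x, of i j] hat_grad_reflect[OF x, of j i] by (simp_all only: reflect_commute[of m j i])
      show "E (reflect m i j x) = - E x"
        unfolding E_def f g by (simp add: inner_commute algebra_simps)
    qed
    show "(\<lambda>x. - E x) \<in> borel_measurable lborel" using E_meas by simp
    have "reflect m i j \<in> borel_measurable borel"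
      unfolding reflect_def[abs_def] by (intro borel_measurable_continuous_onI continuous_intros)
    then show "(\<lambda>x. E (reflect m i j x)) \<in> borel_measurable lborel"
      using E_meas by (simp add: measurable_compose[of _ borel borel])
  qed
  also have "\<dots> = - (LINT x|lborel. E x)" by simp
  finally show ?thesis using area by (simp add: E_def)
qed

lemma inner_hat_grad_le: "\<bar>inner (hat_grad d m i x) (hat_grad d m j x)\<bar> \<le> 2 * (real (m+1))\<^sup>2"
proof -
  have "\<bar>fst (hat_grad d m i x) * fst (hat_grad d m j x)\<bar> \<le> real (m+1) * real (m+1)"
    "\<bar>snd (hat_grad d m i x) * snd (hat_grad d m j x)\<bar> \<le> real (m+1) * real (m+1)"
    unfolding abs_mult by (intro mult_mono hat_grad_le; simp)+
  then show ?thesis unfolding inner_prod_def inner_real_def power2_eq_square by linarith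
qed

lemma stiff_one_bound: "\<bar>stiff d m (\<lambda>_. 1) i j\<bar> \<le> 8"
proof -
  have "\<bar>stiff d m (\<lambda>_. 1) i j\<bar> \<le> 4 * (2 * (real (m+1))\<^sup>2) / (real (m+1))\<^sup>2"
    unfolding stiff_def
  proof (rule integral_patch_bound[where m = m and i = i])
    show "bdd_meas (\<lambda>x. 1 * inner (hat_grad d m i x) (hat_grad d m j x))" by (intro bdd_meas_stiff bdd_meas_const)
    show "\<bar>1 * inner (hat_grad d m i x) (hat_grad d m j x)\<bar> \<le> 2 * (real (m+1))\<^sup>2" for x
      using inner_hat_grad_le by simp
    show "1 * inner (hat_grad d m i x) (hat_grad d m j x) = 0" if "x \<notin> patch m i" for x
      using that by (simp add: hat_grad_patch)
  qed simp
  then show ?thesis by simp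
qed

lemma stiff_far:
  assumes "\<not> near m i j"
  shows "stiff d m a i j = 0"
proof -
  have "inner (hat_grad d m i x) (hat_grad d m j x) = 0" for x
    using patches_meet_near[of x m i j] assms hat_grad_patch[of x m i d] hat_grad_patch[of x m j d] by fastforce
  then show ?thesis by (simp add: stiff_def)
qed

lemma edge_mid_close:
  assumes "x \<in> patch m i" "x \<in> patch m j"
  shows "(norm (x - edge_mid m i j))\<^sup>2 \<le> 2 / (real (m+1))\<^sup>2"
proof -
  define H where "H = real (m+1)"
  have H: "H > 0" by (simp add: H_def)
  have k: "H * (t - (p + q) / (2 * H)) = ((H * t - p) + (H * t - q)) / 2" for t p q
    using H by (simp add: field_simps)
  have avg: "\<bar>(s + t) / 2\<bar> \<le> 1" if "\<bar>s\<bar> \<le> 1" "\<bar>t\<bar> \<le> 1" for s t :: real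
    using that unfolding abs_le_iff by argo
  have "\<bar>H * fst (x - edge_mid m i j)\<bar> \<le> 1" "\<bar>H * snd (x - edge_mid m i j)\<bar> \<le> 1"
    using assms unfolding patch_def mem_Collect_eq edge_mid_def H_def[symmetric] fst_diff snd_diff fst_conv snd_conv k
    by (simp_all only: avg)
  then have "(H * fst (x - edge_mid m i j))\<^sup>2 \<le> 1" "(H * snd (x - edge_mid m i j))\<^sup>2 \<le> 1"
    by (simp_all add: abs_square_le_1)
  then have "H\<^sup>2 * (norm (x - edge_mid m i j))\<^sup>2 \<le> 2"
    unfolding norm_point_sq by (simp add: power_mult_distrib distrib_left)
  then show ?thesis unfolding H_def[symmetric] using H by (simp add: field_simps)
qed

text \<open>Replacing the coefficient by its value at the midpoint of the nodes costs only \<open>O(h\<^sup>2)\<close>, although the gradients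
  are of size \<open>1/h\<close> and the coefficient varies by \<open>O(h)\<close> over the supports: the linear Taylor term integrates to zero.\<close>

lemma stiff_midpoint:
  assumes a: "bdd_meas a" and C: "C \<ge> 0" and i: "i < m\<^sup>2" and j: "j < m\<^sup>2"
    and taylor: "\<And>y. y \<in> Omega \<Longrightarrow> \<bar>a y - a (edge_mid m i j) - (p * (fst y - fst (edge_mid m i j)) + q * (snd y - snd (edge_mid m i j)))\<bar>
        \<le> C * (norm (y - edge_mid m i j))\<^sup>2"
  shows "\<bar>stiff d m a i j - a (edge_mid m i j) * stiff d m (\<lambda>_. 1) i j\<bar> \<le> 16 * C / (real (m+1))\<^sup>2"
proof -
  define z where "z = edge_mid m i j"
  define lin where "lin x = p * (fst x - fst z) + q * (snd x - snd z)" for x :: point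
  define I where "I x = inner (hat_grad d m i x) (hat_grad d m j x)" for x
  have bdd_measI: "bdd_meas I" unfolding I_def by (intro bdd_meas_inner bdd_meas_hat_grad)
  have bml: "bdd_meas lin" unfolding lin_def by (intro bdd_meas_continuous continuous_intros)
  have odd: "(LINT x|area. lin x * I x) = 0"
    unfolding lin_def I_def z_def by (rule integral_odd_zero[OF i j])
  have "(LINT x|area. (a x - a z - lin x) * I x) = (LINT x|area. (a x * I x - a z * I x) - lin x * I x)"
    by (simp add: algebra_simps)
  also have "\<dots> = (LINT x|area. a x * I x) - a z * (LINT x|area. I x) - (LINT x|area. lin x * I x)"
    by (subst Bochner_Integration.integral_diff Bochner_Integration.integral_diff;
        (intro bdd_meas_integrable bdd_meas_diff bdd_meas_mult bdd_meas_const a bdd_measI bml)?)+ simp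
  also have "\<dots> = stiff d m a i j - a z * stiff d m (\<lambda>_. 1) i j"
    unfolding odd by (simp add: stiff_def I_def)
  finally have eq: "stiff d m a i j - a z * stiff d m (\<lambda>_. 1) i j = (LINT x|area. (a x - a z - lin x) * I x)" by simp
  have b: "\<bar>(a x - a z - lin x) * I x\<bar> \<le> 4 * C" if x: "x \<in> Omega" for x
  proof (cases "x \<in> patch m i \<and> x \<in> patch m j")
    case True
    have "\<bar>a x - a z - lin x\<bar> \<le> C * (2 / (real (m+1))\<^sup>2)"
      using taylor[OF x] mult_left_mono[OF edge_mid_close[of x m i j] C] True
      unfolding z_def lin_def by linarith
    then have "\<bar>(a x - a z - lin x) * I x\<bar> \<le> (C * (2 / (real (m+1))\<^sup>2)) * (2 * (real (m+1))\<^sup>2)"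
      unfolding abs_mult I_def by (intro mult_mono inner_hat_grad_le) (use C in auto)
    also have "\<dots> = 4 * C" by simp
    finally show ?thesis .
  next
    case False
    then have "I x = 0" unfolding I_def by (auto simp: hat_grad_patch)
    then show ?thesis using C by simp
  qed
  have "\<bar>LINT x|area. (a x - a z - lin x) * I x\<bar> \<le> 4 * (4 * C) / (real (m+1))\<^sup>2"
  proof (rule integral_patch_bound[where m = m and i = i])
    show "bdd_meas (\<lambda>x. (a x - a z - lin x) * I x)" by (intro bdd_meas_diff bdd_meas_mult bdd_meas_const a bdd_measI bml)
    show "(a x - a z - lin x) * I x = 0" if "x \<notin> patch m i" for x
      using that by (simp add: I_def hat_grad_patch)
  qed (use b C in auto)
  then have "\<bar>stiff d m a i j - a z * stiff d m (\<lambda>_. 1) i j\<bar> \<le> 4 * (4 * C) / (real (m+1))\<^sup>2"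
    unfolding eq .
  then show ?thesis unfolding z_def by simp
qed

lemma stiff_ge:
  assumes a: "bdd_meas a" and ge: "\<And>x. x \<in> Omega \<Longrightarrow> a0 \<le> a x"
  shows "a0 * bform (m\<^sup>2) (stiff d m (\<lambda>_. 1)) v v \<le> bform (m\<^sup>2) (stiff d m a) v v"
proof -
  have "a0 * bform (m\<^sup>2) (stiff d m (\<lambda>_. 1)) v v = (LINT x|area. a0 * (1 * inner (fe_grad d m v x) (fe_grad d m v x)))"
    unfolding bform_stiff[OF bdd_meas_const] by simp
  also have "\<dots> \<le> (LINT x|area. a x * inner (fe_grad d m v x) (fe_grad d m v x))"
  proof (rule integral_mono)
    show "a0 * (1 * inner (fe_grad d m v x) (fe_grad d m v x)) \<le> a x * inner (fe_grad d m v x) (fe_grad d m v x)"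
      if "x \<in> space area" for x
      using ge[of x] that by (simp add: mult_right_mono)
  qed (intro bdd_meas_integrable bdd_meas_mult bdd_meas_const a bdd_meas_inner bdd_meas_fe_grad)+
  also have "\<dots> = bform (m\<^sup>2) (stiff d m a) v v" by (rule bform_stiff[OF a, symmetric])
  finally show ?thesis .
qed

lemma stiff_diagonal_ge_a0:
  assumes a: "bdd_meas a" and ge: "\<And>x. x \<in> Omega \<Longrightarrow> a0 \<le> a x"
  shows "a0 * stiff d m (\<lambda>_. 1) i i \<le> stiff d m a i i"
proof -
  have "a0 * stiff d m (\<lambda>_. 1) i i = (LINT x|area. a0 * (1 * inner (hat_grad d m i x) (hat_grad d m i x)))"
    by (simp add: stiff_def)
  also have "\<dots> \<le> stiff d m a i i"
    unfolding stiff_def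
  proof (rule integral_mono)
    show "a0 * (1 * inner (hat_grad d m i x) (hat_grad d m i x)) \<le> a x * inner (hat_grad d m i x) (hat_grad d m i x)"
      if "x \<in> space area" for x
      using ge[of x] that by (simp add: mult_right_mono)
  qed (intro bdd_meas_integrable bdd_meas_mult bdd_meas_const a bdd_meas_inner bdd_meas_hat_grad)+
  finally show ?thesis .
qed

section \<open>Integration by parts\<close>

text \<open>The fundamental theorem of calculus along a line, with finitely many exceptional points where the line meets the
  mesh.\<close>

lemma line_integral_zero:
  fixes U f :: "real \<Rightarrow> real"
  assumes S: "finite S" and cont: "continuous_on {0..1} U" and U: "U 0 = 0" "U 1 = 0"
    and der: "\<And>t. t \<in> {0<..<1} - S \<Longrightarrow> (U has_real_derivative f t) (at t)"
    and int: "integrable lborel (\<lambda>t. indicator {0<..<1} t *\<^sub>R f t)"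
  shows "(LINT t|lborel. indicator {0<..<1} t *\<^sub>R f t) = 0"
proof -
  have "(f has_integral (U 1 - U 0)) {0..1}"
    using der by (intro fundamental_theorem_of_calculus_interior_strong[OF S _ _ cont])
      (auto simp: has_real_derivative_iff_has_vector_derivative)
  then have "(f has_integral 0) {0<..<1}"
    using has_integral_open_interval[of f 0 0 "1::real"] U by simp
  then have "((\<lambda>t. indicator {0<..<1} t *\<^sub>R f t) has_integral 0) UNIV"
  proof -
    have "(\<lambda>t. indicator {0<..<1} t *\<^sub>R f t) = (\<lambda>t. if t \<in> {0<..<1} then f t else 0)"
      by (auto simp: fun_eq_iff)
    then show "(f has_integral 0) {0<..<1} \<Longrightarrow> ((\<lambda>t. indicator {0<..<1} t *\<^sub>R f t) has_integral 0) UNIV"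
      by (simp only: has_integral_restrict_UNIV)
  qed
  then show ?thesis
    using has_integral_integral_lborel[OF int] has_integral_unique by blast
qed

lemma finite_off_grid_line:
  fixes H c :: real
  assumes "H > 0"
  shows "finite {t. 0 < t \<and> t < 1 \<and> H * t + c \<in> \<int>}"
proof (rule finite_subset)
  show "{t. 0 < t \<and> t < 1 \<and> H * t + c \<in> \<int>} \<subseteq> (\<lambda>n. (of_int n - c) / H) ` {\<lfloor>c\<rfloor>..\<lceil>H + c\<rceil>}"
  proof
    fix t assume t: "t \<in> {t. 0 < t \<and> t < 1 \<and> H * t + c \<in> \<int>}"
    then obtain n where n: "H * t + c = of_int n" by (auto elim: Ints_cases)
    have "0 < H * t" "H * t < H * 1" using t assms by simp_all
    then have "n \<in> {\<lfloor>c\<rfloor>..\<lceil>H + c\<rceil>}" using n by (simp, linarith)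
    moreover have "t = (of_int n - c) / H" using n assms by (simp add: field_simps)
    ultimately show "t \<in> (\<lambda>n. (of_int n - c) / H) ` {\<lfloor>c\<rfloor>..\<lceil>H + c\<rceil>}" by blast
  qed
qed simp

lemma AE_off_grid_line:
  assumes "H > 0"
  shows "AE t in lborel. H * t \<notin> (\<int> :: real set)"
proof -
  have "{t. H * t \<in> \<int>} \<subseteq> (\<lambda>n. of_int n / H) ` UNIV"
  proof
    fix t assume "t \<in> {t. H * t \<in> \<int>}"
    then obtain n where "H * t = of_int n" by (auto elim: Ints_cases)
    then have "t = of_int n / H" using assms by (simp add: field_simps)
    then show "t \<in> (\<lambda>n. of_int n / H) ` UNIV" by blast
  qed
  then have "countable {t. H * t \<in> \<int>}" by (rule countable_subset) simp
  then have "{t. H * t \<in> \<int>} \<in> null_sets lborel" by (rule countable_imp_null_set_lborel)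
  then show ?thesis by (rule AE_I') simp
qed

text \<open>The same on a segment crossing the square parallel to an axis with direction \<^term>\<open>w\<close>.\<close>

lemma slice_integral_zero:
  fixes u :: "point \<Rightarrow> real" and e :: "real \<Rightarrow> point"
  assumes cont: "continuous_on (closure Omega) u"
    and zero: "\<And>x. x \<in> closure Omega \<Longrightarrow> x \<notin> Omega \<Longrightarrow> u x = 0"
    and der: "\<And>x. x \<in> Omega \<Longrightarrow> off_grid d m x \<Longrightarrow> (u has_derivative (\<lambda>v. D1 x * fst v + D2 x * snd v)) (at x)"
    and e: "\<And>t. (e has_derivative (\<lambda>s. s *\<^sub>R w)) (at t)"
    and inside: "\<And>t. t \<in> {0<..<1} \<Longrightarrow> e t \<in> Omega"
    and ends: "e 0 \<in> closure Omega - Omega" "e 1 \<in> closure Omega - Omega"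
    and S: "finite S" "\<And>t. t \<in> {0<..<1} - S \<Longrightarrow> off_grid d m (e t)"
    and int: "integrable lborel (\<lambda>t. indicator {0<..<1} t *\<^sub>R (D1 (e t) * fst w + D2 (e t) * snd w))"
  shows "(LINT t|lborel. indicator {0<..<1} t *\<^sub>R (D1 (e t) * fst w + D2 (e t) * snd w)) = 0"
proof (rule line_integral_zero[where U = "\<lambda>t. u (e t)", OF S(1)])
  have "e t \<in> closure Omega" if "t \<in> {0..1}" for t
  proof (cases "t = 0 \<or> t = 1")
    case False
    then have "e t \<in> Omega" using that by (intro inside) simp
    then show ?thesis using closure_subset[of Omega] by blast
  qed (use ends in blast)
  moreover have "continuous_on {0..1} e"
    using has_derivative_continuous[OF e] by (intro continuous_at_imp_continuous_on) blast
  ultimately show "continuous_on {0..1} (\<lambda>t. u (e t))"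
    by (intro continuous_on_compose2[OF cont]) auto
  show "u (e 0) = 0" "u (e 1) = 0" using ends by (simp_all add: zero)
  fix t assume t: "t \<in> {0<..<1} - S"
  have d: "(u has_derivative (\<lambda>v. D1 (e t) * fst v + D2 (e t) * snd v)) (at (e t))"
    using t by (intro der inside S(2)) simp_all
  show "((\<lambda>t. u (e t)) has_real_derivative (D1 (e t) * fst w + D2 (e t) * snd w)) (at t)"
    unfolding has_field_derivative_def
    by (rule has_derivative_eq_rhs[OF has_derivative_compose[OF e d]]) (auto simp: algebra_simps)
qed (rule int)

text \<open>The divergence theorem for a continuous, piecewise smooth function that vanishes on the boundary, by Fubini and
  the one-dimensional case.\<close>

lemma
  fixes u :: "point \<Rightarrow> real"
  assumes cont: "continuous_on (closure Omega) u"
    and zero: "\<And>x. x \<in> closure Omega \<Longrightarrow> x \<notin> Omega \<Longrightarrow> u x = 0"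
    and D: "bdd_meas D1" "bdd_meas D2"
    and der: "\<And>x. x \<in> Omega \<Longrightarrow> off_grid d m x \<Longrightarrow> (u has_derivative (\<lambda>v. D1 x * fst v + D2 x * snd v)) (at x)"
  shows integral_partial1_zero: "(LINT x|area. D1 x) = 0"
    and integral_partial2_zero: "(LINT x|area. D2 x) = 0"
proof -
  define H where "H = real (m+1)"
  have H: "H > 0" by (simp add: H_def)
  define s :: real where "s = (case d of Rising \<Rightarrow> - 1 | Falling \<Rightarrow> 1)"
  have s: "s = 1 \<or> s = -1" by (cases d) (simp_all add: s_def)
  have og: "off_grid d m (p, q) \<longleftrightarrow> H * p \<notin> \<int> \<and> H * q \<notin> \<int> \<and> H * p + s * (H * q) \<notin> \<int>" for p q
    by (simp add: off_grid_def H_def s_def)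
  have og': "off_grid d m (q, p) \<longleftrightarrow> off_grid d m (p, q)" for p q
    using s Ints_minus[of "H * p + s * (H * q)"] Ints_minus[of "H * q + s * (H * p)"]
    unfolding og by (elim disjE) (auto simp: add.commute)
  have curry: "(\<lambda>(p, q). indicator Omega (p, q) *\<^sub>R D (p, q)) = (\<lambda>x. indicator Omega x *\<^sub>R D x)" for D :: "point \<Rightarrow> real"
    by auto
  have prod: "integral\<^sup>L area D = (LINT x|(lborel \<Otimes>\<^sub>M lborel). (\<lambda>(p, q). indicator Omega (p, q) *\<^sub>R D (p, q)) x)" for D :: "point \<Rightarrow> real"
    unfolding integral_area lborel_prod curry ..
  have int: "integrable (lborel \<Otimes>\<^sub>M lborel) (\<lambda>(p, q). indicator Omega (p, q) *\<^sub>R D (p, q))" if "bdd_meas D" for D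
  proof -
    have "integrable area D" by (rule bdd_meas_integrable[OF that])
    then have "integrable lborel (\<lambda>x. indicator Omega x *\<^sub>R D x)"
      unfolding area_def by (subst (asm) integrable_restrict_space) simp_all
    then show ?thesis unfolding lborel_prod curry .
  qed
  have ind: "indicator Omega (p, q) = (indicator {0<..<1} p * indicator {0<..<1} q :: real)" for p q
    by (auto simp: Omega_def indicator_def)
  define S where "S q = {t. 0 < t \<and> t < 1 \<and> H * t + 0 \<in> \<int>} \<union> {t. 0 < t \<and> t < 1 \<and> H * t + s * (H * q) \<in> \<int>}" for q
  have S: "finite (S q)" for q unfolding S_def by (intro finite_UnI finite_off_grid_line H)
  have offS: "off_grid d m (t, q)" if "H * q \<notin> \<int>" "t \<in> {0<..<1} - S q" for t q
    using that unfolding og S_def by auto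
  show "(LINT x|area. D1 x) = 0"
  proof -
    have "(LINT x|area. D1 x) = (LINT q|lborel. LINT p|lborel. indicator Omega (p, q) *\<^sub>R D1 (p, q))"
      unfolding prod by (rule lborel_pair.integral_snd[symmetric]) (rule int[OF D(1)])
    also have "\<dots> = (LINT q|(lborel :: real measure). 0)"
    proof (rule integral_cong_AE)
      show "AE q in lborel. (LINT p|lborel. indicator Omega (p, q) *\<^sub>R D1 (p, q)) = 0"
        using AE_off_grid_line[OF H] lborel_pair.AE_integrable_snd[OF int[OF D(1)]]
      proof eventually_elim
        fix q assume q: "H * q \<notin> \<int>" and iq: "integrable lborel (\<lambda>p. indicator Omega (p, q) *\<^sub>R D1 (p, q))"
        show "(LINT p|lborel. indicator Omega (p, q) *\<^sub>R D1 (p, q)) = 0"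
        proof (cases "q \<in> {0<..<1}")
          case True
          then have eq: "(\<lambda>p. indicator Omega (p, q) *\<^sub>R D1 (p, q))
              = (\<lambda>p. indicator {0<..<1} p *\<^sub>R (D1 (p, q) * fst (1, 0 :: real) + D2 (p, q) * snd (1 :: real, 0)))"
            by (simp add: ind)
          show ?thesis unfolding eq
          proof (rule slice_integral_zero[OF cont])
            show "((\<lambda>p. (p, q)) has_derivative (\<lambda>s. s *\<^sub>R (1, 0 :: real))) (at p)" for p
              by (auto intro!: derivative_eq_intros)
            show "off_grid d m (p, q)" if "p \<in> {0<..<1} - S q" for p
              by (rule offS[OF q that])
            show "integrable lborel (\<lambda>p. indicator {0<..<1} p *\<^sub>R (D1 (p, q) * fst (1, 0 :: real) + D2 (p, q) * snd (1 :: real, 0)))"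
              using iq unfolding eq .
          qed (use True S in \<open>auto simp: Omega_def closure_Omega[unfolded Omega_def] intro!: zero der\<close>)
        qed (simp add: ind)
      qed
      show "(\<lambda>q. LINT p|lborel. indicator Omega (p, q) *\<^sub>R D1 (p, q)) \<in> borel_measurable lborel"
        using lborel_pair.integrable_snd[OF int[OF D(1)]] by (rule borel_measurable_integrable)
    qed simp
    finally show ?thesis by simp
  qed
  show "(LINT x|area. D2 x) = 0"
  proof -
    have "(LINT x|area. D2 x) = (LINT p|lborel. LINT q|lborel. indicator Omega (p, q) *\<^sub>R D2 (p, q))"
      unfolding prod by (rule lborel_pair.integral_fst[symmetric]) (rule int[OF D(2)])
    also have "\<dots> = (LINT p|(lborel :: real measure). 0)"
    proof (rule integral_cong_AE)
      show "AE p in lborel. (LINT q|lborel. indicator Omega (p, q) *\<^sub>R D2 (p, q)) = 0"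
        using AE_off_grid_line[OF H] lborel_pair.AE_integrable_fst[OF int[OF D(2)]]
      proof eventually_elim
        fix p assume p: "H * p \<notin> \<int>" and ip: "integrable lborel (\<lambda>q. indicator Omega (p, q) *\<^sub>R D2 (p, q))"
        show "(LINT q|lborel. indicator Omega (p, q) *\<^sub>R D2 (p, q)) = 0"
        proof (cases "p \<in> {0<..<1}")
          case True
          then have eq: "(\<lambda>q. indicator Omega (p, q) *\<^sub>R D2 (p, q))
              = (\<lambda>q. indicator {0<..<1} q *\<^sub>R (D1 (p, q) * fst (0, 1 :: real) + D2 (p, q) * snd (0 :: real, 1)))"
            by (simp add: ind)
          show ?thesis unfolding eq
          proof (rule slice_integral_zero[OF cont])
            show "((\<lambda>q. (p, q)) has_derivative (\<lambda>s. s *\<^sub>R (0, 1 :: real))) (at q)" for q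
              by (auto intro!: derivative_eq_intros)
            show "off_grid d m (p, q)" if "q \<in> {0<..<1} - S p" for q
              using offS[OF p that] og' by blast
            show "integrable lborel (\<lambda>q. indicator {0<..<1} q *\<^sub>R (D1 (p, q) * fst (0, 1 :: real) + D2 (p, q) * snd (0 :: real, 1)))"
              using ip unfolding eq .
          qed (use True S in \<open>auto simp: Omega_def closure_Omega[unfolded Omega_def] intro!: zero der\<close>)
        qed (simp add: ind)
      qed
      show "(\<lambda>p. LINT q|lborel. indicator Omega (p, q) *\<^sub>R D2 (p, q)) \<in> borel_measurable lborel"
        using lborel_pair.integrable_fst[OF int[OF D(2)]] by (rule borel_measurable_integrable)
    qed simp
    finally show ?thesis by simp
  qed
qed

lemma divergence_eqI:
  assumes "((\<lambda>x. fst (\<beta> x)) has_derivative (\<lambda>v. g1 * fst v + h1 * snd v)) (at x)"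
    and "((\<lambda>x. snd (\<beta> x)) has_derivative (\<lambda>v. g2 * fst v + h2 * snd v)) (at x)"
  shows "divergence \<beta> x = g1 + h2"
proof -
  have "((\<lambda>x. (fst (\<beta> x), snd (\<beta> x))) has_derivative (\<lambda>v. (g1 * fst v + h1 * snd v, g2 * fst v + h2 * snd v))) (at x)"
    by (rule has_derivative_Pair[OF assms])
  then have "(\<beta> has_derivative (\<lambda>v. (g1 * fst v + h1 * snd v, g2 * fst v + h2 * snd v))) (at x)" by simp
  from frechet_derivative_at[OF this, symmetric]
  show ?thesis by (simp add: divergence_def Basis_prod_def)
qed

text \<open>The symmetric part of the convection matrix is a mass matrix weighted with the divergence: it has order \<open>h\<^sup>2\<close> and,
  for nonnegative divergence, a sign.\<close>

lemma C1_field_integration_by_parts: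
  assumes \<beta>: "Ck_closure_field 1 Omega \<beta>"
  obtains c where "bdd_meas c" "\<And>x. x \<in> Omega \<Longrightarrow> c x = divergence \<beta> x"
    "\<And>d m i j. i < m\<^sup>2 \<Longrightarrow> j < m\<^sup>2 \<Longrightarrow>
       convect d m \<beta> i j + convect d m \<beta> j i = - (LINT x|area. c x * (hat_fun d m i x * hat_fun d m j x))"
proof -
  have b1: "Ck_closure (Suc 0) Omega (\<lambda>x. fst (\<beta> x))" and b2: "Ck_closure (Suc 0) Omega (\<lambda>x. snd (\<beta> x))"
    using \<beta> by (simp_all add: Ck_closure_field_def)
  obtain g1 h1 where g1: "Ck_closure 0 Omega g1"
    and d1: "\<forall>x\<in>Omega. ((\<lambda>x. fst (\<beta> x)) has_derivative (\<lambda>v. g1 x * fst v + h1 x * snd v)) (at x)"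
    and h1: "Ck_closure 0 Omega h1"
    using b1 unfolding Ck_closure.simps(2) by blast
  obtain g2 h2 where h2: "Ck_closure 0 Omega h2" and g2: "Ck_closure 0 Omega g2"
    and d2: "\<forall>x\<in>Omega. ((\<lambda>x. snd (\<beta> x)) has_derivative (\<lambda>v. g2 x * fst v + h2 x * snd v)) (at x)"
    using b2 unfolding Ck_closure.simps(2) by blast
  have cb: "continuous_on (closure Omega) (\<lambda>x. fst (\<beta> x))" "continuous_on (closure Omega) (\<lambda>x. snd (\<beta> x))"
    using b1 b2 by simp_all
  have bmb: "bdd_meas (\<lambda>x. fst (\<beta> x))" "bdd_meas (\<lambda>x. snd (\<beta> x))" by (intro bdd_meas_continuous cb)+
  have bmg: "bdd_meas g1" "bdd_meas h1" "bdd_meas g2" "bdd_meas h2" using g1 h1 g2 h2 by (auto intro: bdd_meas_continuous)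
  have parts: "convect d m \<beta> i j + convect d m \<beta> j i = - (LINT x|area. (g1 x + h2 x) * (hat_fun d m i x * hat_fun d m j x))"
    if i: "i < m\<^sup>2" and j: "j < m\<^sup>2" for d m i j
  proof -
    define \<phi> where "\<phi> = hat_fun d m i"
    define \<psi> where "\<psi> = hat_fun d m j"
    define G where "G = hat_grad d m i"
    define F where "F = hat_grad d m j"
    have bmf: "bdd_meas \<phi>" "bdd_meas \<psi>" "bdd_meas (\<lambda>x. fst (G x))" "bdd_meas (\<lambda>x. snd (G x))" "bdd_meas (\<lambda>x. fst (F x))" "bdd_meas (\<lambda>x. snd (F x))"
      unfolding \<phi>_def \<psi>_def G_def F_def by (intro bdd_meas_hat_fun bdd_meas_hat_grad)+
    have cf: "continuous_on (closure Omega) \<phi>" "continuous_on (closure Omega) \<psi>"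
      unfolding \<phi>_def \<psi>_def by (intro continuous_hat_fun)+
    have z: "\<phi> x = 0" if "x \<notin> Omega" for x unfolding \<phi>_def by (rule hat_fun_outside[OF i that])
    have der: "(\<phi> has_derivative (\<lambda>v. inner (G x) v)) (at x)" "(\<psi> has_derivative (\<lambda>v. inner (F x) v)) (at x)"
      if "off_grid d m x" for x
      unfolding \<phi>_def \<psi>_def G_def F_def by (rule hat_fun_has_derivative[OF that])+
    have first: "(LINT x|area. g1 x * (\<phi> x * \<psi> x) + fst (\<beta> x) * (fst (G x) * \<psi> x + fst (F x) * \<phi> x)) = 0"
    proof (rule integral_partial1_zero[where u = "\<lambda>x. fst (\<beta> x) * (\<phi> x * \<psi> x)" and d = d and m = m
          and ?D2.0 = "\<lambda>x. h1 x * (\<phi> x * \<psi> x) + fst (\<beta> x) * (snd (G x) * \<psi> x + snd (F x) * \<phi> x)"])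
      show "continuous_on (closure Omega) (\<lambda>x. fst (\<beta> x) * (\<phi> x * \<psi> x))"
        by (intro continuous_on_mult cb cf)
      fix x assume x: "x \<in> Omega" "off_grid d m x"
      show "((\<lambda>x. fst (\<beta> x) * (\<phi> x * \<psi> x)) has_derivative
        (\<lambda>v. (g1 x * (\<phi> x * \<psi> x) + fst (\<beta> x) * (fst (G x) * \<psi> x + fst (F x) * \<phi> x)) * fst v +
             (h1 x * (\<phi> x * \<psi> x) + fst (\<beta> x) * (snd (G x) * \<psi> x + snd (F x) * \<phi> x)) * snd v)) (at x)"
        by (rule has_derivative_eq_rhs[OF has_derivative_mult[OF bspec[OF d1 x(1)] has_derivative_mult[OF der[OF x(2)]]]])
          (simp add: inner_prod_def algebra_simps)
    qed (use z in \<open>auto intro!: bdd_meas_add bdd_meas_mult bmg bmf bmb\<close>)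
    have second: "(LINT x|area. h2 x * (\<phi> x * \<psi> x) + snd (\<beta> x) * (snd (G x) * \<psi> x + snd (F x) * \<phi> x)) = 0"
    proof (rule integral_partial2_zero[where u = "\<lambda>x. snd (\<beta> x) * (\<phi> x * \<psi> x)" and d = d and m = m
          and ?D1.0 = "\<lambda>x. g2 x * (\<phi> x * \<psi> x) + snd (\<beta> x) * (fst (G x) * \<psi> x + fst (F x) * \<phi> x)"])
      show "continuous_on (closure Omega) (\<lambda>x. snd (\<beta> x) * (\<phi> x * \<psi> x))"
        by (intro continuous_on_mult cb cf)
      fix x assume x: "x \<in> Omega" "off_grid d m x"
      show "((\<lambda>x. snd (\<beta> x) * (\<phi> x * \<psi> x)) has_derivative
        (\<lambda>v. (g2 x * (\<phi> x * \<psi> x) + snd (\<beta> x) * (fst (G x) * \<psi> x + fst (F x) * \<phi> x)) * fst v +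
             (h2 x * (\<phi> x * \<psi> x) + snd (\<beta> x) * (snd (G x) * \<psi> x + snd (F x) * \<phi> x)) * snd v)) (at x)"
        by (rule has_derivative_eq_rhs[OF has_derivative_mult[OF bspec[OF d2 x(1)] has_derivative_mult[OF der[OF x(2)]]]])
          (simp add: inner_prod_def algebra_simps)
    qed (use z in \<open>auto intro!: bdd_meas_add bdd_meas_mult bmg bmf bmb\<close>)
    have i1: "integrable area (\<lambda>x. g1 x * (\<phi> x * \<psi> x) + fst (\<beta> x) * (fst (G x) * \<psi> x + fst (F x) * \<phi> x))"
      "integrable area (\<lambda>x. h2 x * (\<phi> x * \<psi> x) + snd (\<beta> x) * (snd (G x) * \<psi> x + snd (F x) * \<phi> x))"
      "integrable area (\<lambda>x. (g1 x + h2 x) * (\<phi> x * \<psi> x))"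
      "integrable area (\<lambda>x. inner (G x) (\<beta> x) * \<psi> x)" "integrable area (\<lambda>x. inner (F x) (\<beta> x) * \<phi> x)"
      by (intro bdd_meas_integrable bdd_meas_add bdd_meas_mult bdd_meas_inner bmg bmf bmb)+
    have "convect d m \<beta> i j + convect d m \<beta> j i + (LINT x|area. (g1 x + h2 x) * (\<phi> x * \<psi> x))
      = (LINT x|area. inner (G x) (\<beta> x) * \<psi> x + inner (F x) (\<beta> x) * \<phi> x + (g1 x + h2 x) * (\<phi> x * \<psi> x))"
      unfolding convect_def \<phi>_def[symmetric] \<psi>_def[symmetric] G_def[symmetric] F_def[symmetric]
      using i1 by simp
    also have "\<dots> = (LINT x|area. (g1 x * (\<phi> x * \<psi> x) + fst (\<beta> x) * (fst (G x) * \<psi> x + fst (F x) * \<phi> x))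
        + (h2 x * (\<phi> x * \<psi> x) + snd (\<beta> x) * (snd (G x) * \<psi> x + snd (F x) * \<phi> x)))"
      by (intro Bochner_Integration.integral_cong refl) (simp add: inner_prod_def algebra_simps)
    also have "\<dots> = 0" using i1 first second by simp
    finally show ?thesis unfolding \<phi>_def \<psi>_def by linarith
  qed
  show ?thesis
  proof (rule that[of "\<lambda>x. g1 x + h2 x"])
    show "bdd_meas (\<lambda>x. g1 x + h2 x)" by (intro bdd_meas_add bmg)
    show "g1 x + h2 x = divergence \<beta> x" if "x \<in> Omega" for x
      using divergence_eqI[OF bspec[OF d1 that] bspec[OF d2 that]] by simp
  qed (rule parts)
qed

section \<open>The preconditioner\<close>

definition diag_ratio :: "diagonal \<Rightarrow> nat \<Rightarrow> (point \<Rightarrow> real) \<Rightarrow> nat \<Rightarrow> real" where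
  "diag_ratio d m a i = stiff d m a i i / stiff d m (\<lambda>_. 1) i i"

definition precond_entry :: "diagonal \<Rightarrow> nat \<Rightarrow> (point \<Rightarrow> real) \<Rightarrow> nat \<Rightarrow> nat \<Rightarrow> real" where
  "precond_entry d m a i j = sqrt (diag_ratio d m a i) * stiff d m (\<lambda>_. 1) i j * sqrt (diag_ratio d m a j)"

lemma fem_matrix_carrier [simp]: "fem_matrix d m a \<beta> \<in> carrier_mat (m\<^sup>2) (m\<^sup>2)"
  by (simp add: fem_matrix_def Theta_def Psi_def)

lemma fem_matrix_entry:
  assumes "bdd_meas a" "bdd_meas (\<lambda>x. fst (\<beta> x))" "bdd_meas (\<lambda>x. snd (\<beta> x))" "i < m\<^sup>2" "j < m\<^sup>2"
  shows "fem_matrix d m a \<beta> $$ (i, j) = stiff d m a i j - convect d m \<beta> i j"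
proof -
  have "Theta d m a \<in> carrier_mat (m\<^sup>2) (m\<^sup>2)" "Psi d m \<beta> \<in> carrier_mat (m\<^sup>2) (m\<^sup>2)"
    by (simp_all add: Theta_def Psi_def)
  then have "fem_matrix d m a \<beta> $$ (i, j) = Theta d m a $$ (i, j) + Psi d m \<beta> $$ (i, j)"
    using assms(4,5) by (simp add: fem_matrix_def)
  then show ?thesis using Theta_entry[OF assms(1,4,5)] Psi_entry[OF assms(2,3,4,5)] by simp
qed

lemma fem_matrix_entry_no_convection:
  assumes "bdd_meas a" "i < m\<^sup>2" "j < m\<^sup>2"
  shows "fem_matrix d m a (\<lambda>_. 0) $$ (i, j) = stiff d m a i j"
  using fem_matrix_entry[OF assms(1) _ _ assms(2,3), of "\<lambda>_. 0" d] by (simp add: bdd_meas_const convect_def)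

lemma preconditioner_carrier: "preconditioner d m a \<in> carrier_mat (m\<^sup>2) (m\<^sup>2)"
  and preconditioner_entry: "bdd_meas a \<Longrightarrow> i < m\<^sup>2 \<Longrightarrow> j < m\<^sup>2 \<Longrightarrow> preconditioner d m a $$ (i, j) = precond_entry d m a i j"
proof -
  let ?n = "m\<^sup>2"
  let ?L = "fem_matrix d m (\<lambda>_. 1) (\<lambda>_. 0)"
  have dims: "dim_row (fem_matrix d m b \<gamma>) = ?n" "dim_col (fem_matrix d m b \<gamma>) = ?n" for b \<gamma>
    using carrier_matD[OF fem_matrix_carrier[of d m b \<gamma>]] by blast+
  define r where "r k = fem_matrix d m a (\<lambda>_. 0) $$ (k, k) * inverse (?L $$ (k, k))" for k
  have sc: "scaling d m a = mat_diag ?n r"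
    unfolding scaling_def diag_part_def diag_part_inv_def dims mat_diag_diag r_def ..
  have sq: "diag_sqrt (scaling d m a) = mat_diag ?n (\<lambda>k. sqrt (r k))"
    unfolding diag_sqrt_def sc by (rule eq_matI) (auto simp: mat_diag_def)
  have pc: "preconditioner d m a = Matrix.mat ?n ?n (\<lambda>(i, j). sqrt (r i) * ?L $$ (i, j)) * mat_diag ?n (\<lambda>k. sqrt (r k))"
    unfolding preconditioner_def sq by (subst mat_diag_mult_left[OF fem_matrix_carrier]) simp
  also have "\<dots> = Matrix.mat ?n ?n (\<lambda>(i, j). (Matrix.mat ?n ?n (\<lambda>(i, j). sqrt (r i) * ?L $$ (i, j))) $$ (i, j) * sqrt (r j))"
    by (rule mat_diag_mult_right) simp
  finally have p: "preconditioner d m a = Matrix.mat ?n ?n (\<lambda>(i, j). (Matrix.mat ?n ?n (\<lambda>(i, j). sqrt (r i) * ?L $$ (i, j))) $$ (i, j) * sqrt (r j))" .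
  show "preconditioner d m a \<in> carrier_mat ?n ?n" unfolding p by simp
  show "preconditioner d m a $$ (i, j) = precond_entry d m a i j" if "bdd_meas a" "i < ?n" "j < ?n"
  proof -
    have "r k = diag_ratio d m a k" if "k < ?n" for k
      using fem_matrix_entry_no_convection[OF \<open>bdd_meas a\<close> that that] fem_matrix_entry_no_convection[OF bdd_meas_const that that]
      by (simp add: r_def diag_ratio_def divide_inverse)
    then show ?thesis
      unfolding p precond_entry_def
      using that(2,3) fem_matrix_entry_no_convection[OF bdd_meas_const that(2,3), of d 1] by simp
  qed
qed

text \<open>The difference is half the square of the difference of the square roots.\<close>

lemma sqrt_mult_close_to_mean:
  fixes x y r :: real
  assumes r: "0 < r" and x: "r \<le> x" and y: "r \<le> y"
  shows "\<bar>sqrt x * sqrt y - (x + y) / 2\<bar> \<le> (x - y)\<^sup>2 / (8 * r)"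
proof -
  define s t where "s = sqrt x" and "t = sqrt y"
  have st: "s\<^sup>2 = x" "t\<^sup>2 = y" "sqrt r \<le> s" "sqrt r \<le> t" using assms by (auto simp: s_def t_def)
  have "(2 * sqrt r)\<^sup>2 \<le> (s + t)\<^sup>2" using st r by (intro power_mono) auto
  then have ge: "4 * r \<le> (s + t)\<^sup>2" using r by (simp add: power_mult_distrib)
  have "x - y = (s - t) * (s + t)" by (simp add: st(1,2)[symmetric] power2_eq_square algebra_simps)
  then have "(x - y)\<^sup>2 = (s - t)\<^sup>2 * (s + t)\<^sup>2" by (simp add: power_mult_distrib)
  also have "\<dots> \<ge> (s - t)\<^sup>2 * (4 * r)" using ge by (intro mult_left_mono) auto
  finally have "(s - t)\<^sup>2 / 2 \<le> (x - y)\<^sup>2 / (8 * r)" using r by (simp add: field_simps)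
  moreover have "s * t - (x + y) / 2 = - ((s - t)\<^sup>2 / 2)"
    by (simp add: st(1,2)[symmetric] power2_eq_square field_simps)
  ultimately show ?thesis unfolding s_def[symmetric] t_def[symmetric] by simp
qed

lemma precond_far: "\<not> near m i j \<Longrightarrow> precond_entry d m a i j = 0"
  by (simp add: precond_entry_def stiff_far)

lemma precond_commute: "precond_entry d m a i j = precond_entry d m a j i"
  by (simp add: precond_entry_def stiff_commute[of d m _ i j])

lemma node_mid_distance:
  assumes "near m i j"
  shows "(norm (edge_mid m i i - edge_mid m i j))\<^sup>2 \<le> 2 / (real (m+1))\<^sup>2"
proof -
  define H where "H = real (m+1)"
  have H: "H > 0" by (simp add: H_def)
  have k: "H * ((p + p) / (2 * H) - (p + q) / (2 * H)) = (p - q) / 2" for p q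
    using H by (simp add: field_simps)
  have sq: "((p - q) / 2)\<^sup>2 \<le> 1" if "\<bar>p - q\<bar> \<le> 2" for p q :: real
    using that by (simp add: abs_square_le_1)
  have n: "\<bar>real (px m i) - real (px m j)\<bar> \<le> 2" "\<bar>real (py m i) - real (py m j)\<bar> \<le> 2"
    using assms unfolding near_def by linarith+
  have "(H * fst (edge_mid m i i - edge_mid m i j))\<^sup>2 \<le> 1" "(H * snd (edge_mid m i i - edge_mid m i j))\<^sup>2 \<le> 1"
    unfolding edge_mid_def H_def[symmetric] fst_diff snd_diff fst_conv snd_conv k using n by (auto intro: sq)
  then have "H\<^sup>2 * (norm (edge_mid m i i - edge_mid m i j))\<^sup>2 \<le> 2"
    unfolding norm_point_sq by (simp add: power_mult_distrib distrib_left)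
  then show ?thesis unfolding H_def[symmetric] using H by (simp add: field_simps)
qed

lemma edge_mid_average: "edge_mid m i i + edge_mid m j j = 2 *\<^sub>R edge_mid m i j"
proof -
  have k: "(p + p) / (2 * r) + (q + q) / (2 * r) = 2 * ((p + q) / (2 * r))" for p q r :: real
    unfolding add_divide_distrib[symmetric] times_divide_eq_right by (simp add: algebra_simps)
  show ?thesis unfolding edge_mid_def add_Pair scaleR_Pair real_scaleR_def k ..
qed

text \<open>The preconditioner reproduces the diffusion matrix up to entries of order \<open>h\<^sup>2\<close>. By \<open>stiff_midpoint\<close> the entry of
  the diffusion matrix is \<open>a\<close> at the midpoint \<open>z\<close> times the entry \<open>l\<close> for \<open>a = 1\<close>, and the diagonal ratios are \<open>a\<close> at
  the nodes. It remains to compare the geometric mean of the nodal values with the value at the midpoint: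
  geometric and arithmetic mean differ by the square of an \<open>O(h)\<close> difference, and the arithmetic mean is
  symmetric about the midpoint.\<close>

lemma precond_close:
  assumes a: "bdd_meas a" and a0: "0 < a0" and ge: "\<And>x. x \<in> Omega \<Longrightarrow> a0 \<le> a x"
    and C: "0 \<le> C" and taylor: "\<And>x y. x \<in> Omega \<Longrightarrow> y \<in> Omega \<Longrightarrow>
        \<bar>a y - a x - (g x * (fst y - fst x) + h x * (snd y - snd x))\<bar> \<le> C * (norm (y - x))\<^sup>2"
    and L: "0 \<le> L" and lip: "\<And>x y. x \<in> Omega \<Longrightarrow> y \<in> Omega \<Longrightarrow> \<bar>a y - a x\<bar> \<le> L * norm (y - x)"
    and i: "i < m\<^sup>2" and j: "j < m\<^sup>2"
  shows "\<bar>stiff d m a i j - precond_entry d m a i j\<bar> \<le> (16 * C + 8 * (66 * C + (128 * C + 3 * L)\<^sup>2 / (8 * a0))) / (real (m+1))\<^sup>2"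
proof (cases "near m i j")
  case False
  have "0 \<le> (128 * C + 3 * L)\<^sup>2 / (8 * a0)" using a0 by simp
  then show ?thesis using False C by (simp add: stiff_far precond_far)
next
  case near: True
  define H where "H = real (m+1)"
  have H: "H \<ge> 1" by (simp add: H_def)
  then have H2: "H \<le> H\<^sup>2" "H\<^sup>2 > 0" by (simp_all add: power2_eq_square)
  define D where "D = diag_ratio d m a"
  define z where "z = edge_mid m i j"
  define l where "l = stiff d m (\<lambda>_. 1) i j"
  have zO: "z \<in> Omega" unfolding z_def by (rule edge_mid_in_Omega[OF i j])
  have nodeO: "edge_mid m k k \<in> Omega" if "k < m\<^sup>2" for k by (rule edge_mid_in_Omega[OF that that])
  have D_ge: "a0 \<le> D k" if "k < m\<^sup>2" for k
    using stiff_diagonal_ge_a0[OF a ge, of d m k] stiff_diagonal_ge[OF that, of d]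
    unfolding D_def diag_ratio_def by (simp add: field_simps)
  have D_close: "\<bar>D k - a (edge_mid m k k)\<bar> \<le> 64 * C / H\<^sup>2" if k: "k < m\<^sup>2" for k
  proof -
    define lk where "lk = stiff d m (\<lambda>_. 1) k k"
    have lk: "1 / 4 \<le> lk" unfolding lk_def by (rule stiff_diagonal_ge[OF k])
    have "stiff d m a k k = D k * lk" using lk by (simp add: D_def diag_ratio_def lk_def)
    then have "stiff d m a k k - a (edge_mid m k k) * lk = lk * (D k - a (edge_mid m k k))"
      by (simp add: algebra_simps)
    then have "lk * \<bar>D k - a (edge_mid m k k)\<bar> = \<bar>stiff d m a k k - a (edge_mid m k k) * lk\<bar>"
      using lk by (simp add: abs_mult)
    also have "\<dots> \<le> 16 * C / H\<^sup>2"
      unfolding lk_def H_def by (rule stiff_midpoint[OF a C k k taylor[OF nodeO[OF k]]])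
    finally have "lk * \<bar>D k - a (edge_mid m k k)\<bar> \<le> 16 * C / H\<^sup>2" .
    moreover have "1 / 4 * \<bar>D k - a (edge_mid m k k)\<bar> \<le> lk * \<bar>D k - a (edge_mid m k k)\<bar>"
      using lk by (intro mult_right_mono) auto
    ultimately show ?thesis by simp
  qed
  have zi: "(norm (edge_mid m i i - z))\<^sup>2 \<le> 2 / H\<^sup>2" unfolding z_def H_def by (rule node_mid_distance[OF near])
  have "edge_mid m i j = edge_mid m j i" by (simp add: edge_mid_def add.commute)
  then have zj: "(norm (edge_mid m j j - z))\<^sup>2 \<le> 2 / H\<^sup>2"
    using node_mid_distance[of m j i] near near_commute[of m i j] unfolding z_def H_def by simp
  have avg: "edge_mid m i i + edge_mid m j j = 2 *\<^sub>R z" unfolding z_def by (rule edge_mid_average)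
  have mean: "\<bar>(a (edge_mid m i i) + a (edge_mid m j j)) / 2 - a z\<bar> \<le> 2 * C / H\<^sup>2"
  proof -
    define fi where "fi = g z * (fst (edge_mid m i i) - fst z) + h z * (snd (edge_mid m i i) - snd z)"
    define fj where "fj = g z * (fst (edge_mid m j j) - fst z) + h z * (snd (edge_mid m j j) - snd z)"
    have "fst (edge_mid m i i) + fst (edge_mid m j j) = 2 * fst z" "snd (edge_mid m i i) + snd (edge_mid m j j) = 2 * snd z"
      using arg_cong[OF avg, of fst] arg_cong[OF avg, of snd] by simp_all
    then have e: "fst (edge_mid m j j) = 2 * fst z - fst (edge_mid m i i)" "snd (edge_mid m j j) = 2 * snd z - snd (edge_mid m i i)"
      by linarith+
    have f0: "fi + fj = 0" unfolding fi_def fj_def e by (simp add: algebra_simps)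
    have "\<bar>a (edge_mid m i i) - a z - fi\<bar> \<le> C * (2 / H\<^sup>2)" "\<bar>a (edge_mid m j j) - a z - fj\<bar> \<le> C * (2 / H\<^sup>2)"
      unfolding fi_def fj_def
      using taylor[OF zO nodeO[OF i]] taylor[OF zO nodeO[OF j]] mult_left_mono[OF zi C] mult_left_mono[OF zj C]
      by (auto intro: order_trans)
    then have "\<bar>a (edge_mid m i i) + a (edge_mid m j j) - 2 * a z\<bar> \<le> 2 * (C * (2 / H\<^sup>2))"
      using f0 unfolding abs_le_iff by argo
    moreover have "C * (2 / H\<^sup>2) = 2 * C / H\<^sup>2" by simp
    ultimately show ?thesis unfolding abs_le_iff by argo
  qed
  have "(norm (edge_mid m i i - edge_mid m j j))\<^sup>2 \<le> (3 / H)\<^sup>2"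
  proof -
    have "edge_mid m i i - edge_mid m j j = 2 *\<^sub>R (edge_mid m i i - z)"
      using avg by (simp add: scaleR_diff_right scaleR_2 algebra_simps)
    then have "(norm (edge_mid m i i - edge_mid m j j))\<^sup>2 = 4 * (norm (edge_mid m i i - z))\<^sup>2"
      by (simp add: power_mult_distrib)
    also have "\<dots> \<le> 4 * (2 / H\<^sup>2)" using zi by simp
    also have "\<dots> \<le> (3 / H)\<^sup>2" by (simp add: power_divide divide_right_mono)
    finally show ?thesis .
  qed
  then have "norm (edge_mid m i i - edge_mid m j j) \<le> 3 / H"
    by (rule power2_le_imp_le) (use H in simp)
  then have "\<bar>a (edge_mid m i i) - a (edge_mid m j j)\<bar> \<le> L * (3 / H)"
    using lip[OF nodeO[OF j] nodeO[OF i]] mult_left_mono[OF _ L] by (blast intro: order_trans)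
  moreover have "64 * C / H\<^sup>2 \<le> 64 * C / H"
    using C H H2 by (intro divide_left_mono) auto
  ultimately have "\<bar>D i - D j\<bar> \<le> 2 * (64 * C / H) + L * (3 / H)"
    using D_close[OF i] D_close[OF j] unfolding abs_le_iff by argo
  also have "\<dots> = (128 * C + 3 * L) / H" using H by (simp add: field_simps)
  finally have "\<bar>D i - D j\<bar>\<^sup>2 \<le> ((128 * C + 3 * L) / H)\<^sup>2" by (intro power_mono) auto
  then have "(D i - D j)\<^sup>2 / (8 * a0) \<le> ((128 * C + 3 * L) / H)\<^sup>2 / (8 * a0)"
    using a0 by (intro divide_right_mono) auto
  also have "\<dots> = (128 * C + 3 * L)\<^sup>2 / (8 * a0) / H\<^sup>2" by (simp add: power_divide)
  finally have diff: "(D i - D j)\<^sup>2 / (8 * a0) \<le> (128 * C + 3 * L)\<^sup>2 / (8 * a0) / H\<^sup>2" .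
  define q where "q = (128 * C + 3 * L)\<^sup>2 / (8 * a0)"
  have "\<bar>sqrt (D i) * sqrt (D j) - (D i + D j) / 2\<bar> \<le> q / H\<^sup>2"
    using sqrt_mult_close_to_mean[OF a0 D_ge[OF i] D_ge[OF j]] diff unfolding q_def by linarith
  then have "\<bar>a z - sqrt (D i) * sqrt (D j)\<bar> \<le> q / H\<^sup>2 + 64 * C / H\<^sup>2 + 2 * C / H\<^sup>2"
    using D_close[OF i] D_close[OF j] mean unfolding abs_le_iff by argo
  also have "\<dots> = (66 * C + q) / H\<^sup>2" by (simp add: add_divide_distrib)
  finally have close: "\<bar>a z - sqrt (D i) * sqrt (D j)\<bar> \<le> (66 * C + q) / H\<^sup>2" .
  have q0: "0 \<le> q" using a0 by (simp add: q_def)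
  have lb: "\<bar>l\<bar> \<le> 8" unfolding l_def by (rule stiff_one_bound)
  have "\<bar>l * (a z - sqrt (D i) * sqrt (D j))\<bar> \<le> 8 * ((66 * C + q) / H\<^sup>2)"
    unfolding abs_mult using close lb by (intro mult_mono) auto
  moreover have "\<bar>stiff d m a i j - a z * l\<bar> \<le> 16 * C / H\<^sup>2"
    unfolding z_def l_def H_def by (rule stiff_midpoint[OF a C i j taylor[OF zO[unfolded z_def]]])
  moreover have "stiff d m a i j - precond_entry d m a i j = (stiff d m a i j - a z * l) + l * (a z - sqrt (D i) * sqrt (D j))"
    by (simp add: precond_entry_def D_def l_def algebra_simps)
  ultimately have "\<bar>stiff d m a i j - precond_entry d m a i j\<bar> \<le> 16 * C / H\<^sup>2 + 8 * ((66 * C + q) / H\<^sup>2)"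
    by linarith
  also have "\<dots> = (16 * C + 8 * (66 * C + q)) / H\<^sup>2" by (simp add: add_divide_distrib)
  finally show ?thesis unfolding q_def H_def .
qed

lemma mass_bound:
  assumes c: "bdd_meas c" and b: "\<And>x. x \<in> Omega \<Longrightarrow> \<bar>c x\<bar> \<le> B" and B: "0 \<le> B"
  shows "\<bar>LINT x|area. c x * (hat_fun d m i x * hat_fun d m j x)\<bar> \<le> 4 * B / (real (m+1))\<^sup>2"
proof (rule integral_patch_bound[where i = i])
  show "bdd_meas (\<lambda>x. c x * (hat_fun d m i x * hat_fun d m j x))" by (intro bdd_meas_mult c bdd_meas_hat_fun)
  show "\<bar>c x * (hat_fun d m i x * hat_fun d m j x)\<bar> \<le> B" if "x \<in> Omega" for x
  proof -
    have "hat_fun d m i x * hat_fun d m j x \<le> 1 * 1" by (intro mult_mono hat_fun_le_one hat_fun_nonneg) simp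
    then have "\<bar>c x\<bar> * (hat_fun d m i x * hat_fun d m j x) \<le> B * 1"
      using b[OF that] B hat_fun_nonneg by (intro mult_mono) (auto intro: mult_nonneg_nonneg)
    then show ?thesis by (simp add: abs_mult hat_fun_nonneg)
  qed
  show "c x * (hat_fun d m i x * hat_fun d m j x) = 0" if "x \<notin> patch m i" for x
    using hat_fun_patch[OF that] by simp
qed (rule B)

lemma mass_far:
  assumes "\<not> near m i j"
  shows "(LINT x|area. c x * (hat_fun d m i x * hat_fun d m j x)) = 0"
proof -
  have "hat_fun d m i x * hat_fun d m j x = 0" for x
  proof (cases "x \<in> patch m i")
    case True
    then have "x \<notin> patch m j" using patches_meet_near[of x m i j] assms by blast
    then show ?thesis by (simp add: hat_fun_patch)
  qed (simp add: hat_fun_patch)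
  then show ?thesis by (simp only: mult_zero_right Bochner_Integration.integral_zero)
qed

lemma banded_quadratic_bound:
  assumes b: "\<And>i j. i < n \<Longrightarrow> j < n \<Longrightarrow> \<bar>M i j\<bar> \<le> \<epsilon>"
    and z: "\<And>i j. i < n \<Longrightarrow> j < n \<Longrightarrow> \<not> near m i j \<Longrightarrow> M i j = 0"
    and eps: "0 \<le> \<epsilon>"
  shows "\<bar>bform n M v v\<bar> \<le> 25 * \<epsilon> * sqnorm n v"
proof -
  have "(bform n M v v)\<^sup>2 \<le> (25 * \<epsilon> * sqnorm n v)\<^sup>2"
    using banded_form_bound[OF b z eps, where u = v and v = v] by (simp add: power2_eq_square mult_ac)
  then show ?thesis by (rule abs_le_square_iff[THEN iffD2, THEN order_trans]) (use eps in simp)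
qed

section \<open>Uniform convergence\<close>

lemma perturbed_form_le:
  fixes x y s e q :: real
  assumes "\<bar>x - y\<bar> \<le> e * s" "s \<le> q * y" "0 \<le> e"
  shows "x \<le> (1 + e * q) * y"
proof -
  have "e * s \<le> e * (q * y)" using assms(2,3) by (rule mult_left_mono)
  then have "x - y \<le> e * q * y" using assms(1) by (simp add: abs_le_iff mult.assoc)
  then show ?thesis by (simp add: distrib_right)
qed

text \<open>The derivative falls on the first argument, and the Euclidean norm of the second one carries the factor \<open>h\<close>
  that relates it to the \<open>L2\<close> norm of the finite element function.\<close>

lemma convect_form_bound:
  assumes \<beta>: "bdd_meas (\<lambda>x. fst (\<beta> x))" "bdd_meas (\<lambda>x. snd (\<beta> x))"
    and B: "\<And>x. x \<in> Omega \<Longrightarrow> (norm (\<beta> x))\<^sup>2 \<le> B" and B0: "0 \<le> B"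
  shows "(bform (m\<^sup>2) (convect d m \<beta>) v u)\<^sup>2
     \<le> B * bform (m\<^sup>2) (stiff d m (\<lambda>_. 1)) v v * (100 / (real (m+1))\<^sup>2 * sqnorm (m\<^sup>2) u)"
proof -
  define F where "F x = inner (fe_grad d m v x) (\<beta> x)" for x
  have bmF: "bdd_meas F" unfolding F_def by (intro bdd_meas_inner bdd_meas_fe_grad \<beta>)
  have "(bform (m\<^sup>2) (convect d m \<beta>) v u)\<^sup>2 = (LINT x|area. F x * fe_fun d m u x)\<^sup>2"
    unfolding bform_convect[OF \<beta>] F_def ..
  also have "\<dots> \<le> (LINT x|area. (F x)\<^sup>2) * (LINT x|area. (fe_fun d m u x)\<^sup>2)"
    by (rule integral_Cauchy_Schwarz[OF bmF bdd_meas_fe_fun])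
  also have "\<dots> \<le> (B * bform (m\<^sup>2) (stiff d m (\<lambda>_. 1)) v v) * (100 / (real (m+1))\<^sup>2 * sqnorm (m\<^sup>2) u)"
  proof (rule mult_mono)
    have int: "integrable area (\<lambda>x. 1 * inner (fe_grad d m v x) (fe_grad d m v x))"
      by (intro bdd_meas_integrable bdd_meas_mult bdd_meas_const bdd_meas_inner bdd_meas_fe_grad)
    have "(LINT x|area. (F x)\<^sup>2) \<le> (LINT x|area. B * (1 * inner (fe_grad d m v x) (fe_grad d m v x)))"
    proof (rule integral_mono)
      show "integrable area (\<lambda>x. (F x)\<^sup>2)" by (intro bdd_meas_integrable bdd_meas_power2 bmF)
      show "integrable area (\<lambda>x. B * (1 * inner (fe_grad d m v x) (fe_grad d m v x)))" using int by simp
      fix x assume "x \<in> space area"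
      then have b: "(norm (\<beta> x))\<^sup>2 \<le> B" using B by simp
      have "(F x)\<^sup>2 \<le> inner (fe_grad d m v x) (fe_grad d m v x) * inner (\<beta> x) (\<beta> x)"
        unfolding F_def by (rule Cauchy_Schwarz_ineq)
      also have "\<dots> \<le> inner (fe_grad d m v x) (fe_grad d m v x) * B"
        using b by (intro mult_left_mono) (simp_all add: power2_norm_eq_inner)
      finally show "(F x)\<^sup>2 \<le> B * (1 * inner (fe_grad d m v x) (fe_grad d m v x))" by (simp add: mult.commute)
    qed
    also have "\<dots> = B * bform (m\<^sup>2) (stiff d m (\<lambda>_. 1)) v v"
      unfolding bform_stiff[OF bdd_meas_const] by simp
    finally show "(LINT x|area. (F x)\<^sup>2) \<le> B * bform (m\<^sup>2) (stiff d m (\<lambda>_. 1)) v v" .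
    have "(LINT x|area. (fe_fun d m u x)\<^sup>2) = bform (m\<^sup>2) (\<lambda>i j. LINT x|area. 1 * (hat_fun d m i x * hat_fun d m j x)) u u"
      unfolding bform_mass[OF bdd_meas_const] by (simp add: power2_eq_square)
    also have "\<dots> \<le> 25 * (4 * 1 / (real (m+1))\<^sup>2) * sqnorm (m\<^sup>2) u"
    proof (rule order_trans[OF abs_ge_self banded_quadratic_bound[where m = m]])
      show "\<bar>LINT x|area. 1 * (hat_fun d m i x * hat_fun d m j x)\<bar> \<le> 4 * 1 / (real (m+1))\<^sup>2" for i j
        by (rule mass_bound) (auto intro: bdd_meas_const)
      show "(LINT x|area. 1 * (hat_fun d m i x * hat_fun d m j x)) = 0" if "\<not> near m i j" for i j
        by (rule mass_far[OF that])
    qed simp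
    finally show "(LINT x|area. (fe_fun d m u x)\<^sup>2) \<le> 100 / (real (m+1))\<^sup>2 * sqnorm (m\<^sup>2) u" by simp
    show "0 \<le> B * bform (m\<^sup>2) (stiff d m (\<lambda>_. 1)) v v"
      by (intro mult_nonneg_nonneg B0 order_trans[OF _ stiff_ge_differences])
        (simp add: sum_nonneg)
    show "0 \<le> (LINT x|area. (fe_fun d m u x)\<^sup>2)" by (intro integral_nonneg_AE AE_I2) simp
  qed
  finally show ?thesis .
qed

theorem mainTheorem4:
  fixes a f :: "real \<times> real \<Rightarrow> real"
    and \<beta> :: "real \<times> real \<Rightarrow> real \<times> real"
    and a0 :: real
    and d :: diagonal
  assumes "Ck_closure 2 Omega a"
    and "a0 > 0"
    and "\<forall>x\<in>closure Omega. a x \<ge> a0"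
    and "Ck_closure_field 1 Omega \<beta>"
    and "\<forall>x\<in>Omega. divergence \<beta> x \<ge> 0"
    and "L2_on Omega f"
  shows "phss_optimally_convergent 1
           (\<lambda>m. map_mat complex_of_real (preconditioner d m a))
           (\<lambda>m. map_mat complex_of_real (fem_matrix d m a \<beta>))
           (\<lambda>m. map_vec complex_of_real (fem_rhs d m f))"
proof -
  have a0: "0 < a0" by (rule assms(2))
  have a_cont: "continuous_on (closure Omega) a" using assms(1) by (simp add: numeral_2_eq_2)
  have a: "bdd_meas a" by (rule bdd_meas_continuous[OF a_cont])
  have a_ge: "a0 \<le> a x" if "x \<in> Omega" for x
    using assms(3) that closure_subset[of Omega] by blast
  obtain C g h where C: "0 \<le> C" and taylor: "\<And>x y. x \<in> Omega \<Longrightarrow> y \<in> Omega \<Longrightarrow>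
      \<bar>a y - a x - (g x * (fst y - fst x) + h x * (snd y - snd x))\<bar> \<le> C * (norm (y - x))\<^sup>2"
    using C2_closure_Taylor[OF assms(1)] by metis
  obtain L where L: "0 \<le> L" and lip: "\<And>x y. x \<in> Omega \<Longrightarrow> y \<in> Omega \<Longrightarrow> \<bar>a y - a x\<bar> \<le> L * norm (y - x)"
    using C1_closure_Lipschitz[of 1 a] assms(1) by (auto simp: numeral_2_eq_2)
  have b1: "Ck_closure 1 Omega (\<lambda>x. fst (\<beta> x))" and b2: "Ck_closure 1 Omega (\<lambda>x. snd (\<beta> x))"
    using assms(4) by (simp_all add: Ck_closure_field_def)
  have bmb: "bdd_meas (\<lambda>x. fst (\<beta> x))" "bdd_meas (\<lambda>x. snd (\<beta> x))"
    using b1 b2 by (auto intro!: bdd_meas_continuous)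
  obtain B where B: "0 \<le> B" and \<beta>_le: "\<And>x. x \<in> Omega \<Longrightarrow> (norm (\<beta> x))\<^sup>2 \<le> B"
  proof -
    have "bdd_meas (\<lambda>x. (fst (\<beta> x))\<^sup>2 + (snd (\<beta> x))\<^sup>2)" by (intro bdd_meas_add bdd_meas_power2 bmb)
    then obtain B where "\<forall>x\<in>Omega. \<bar>(fst (\<beta> x))\<^sup>2 + (snd (\<beta> x))\<^sup>2\<bar> \<le> B" unfolding bdd_meas_def by blast
    then show thesis by (intro that[of "\<bar>B\<bar>"]) (auto simp: norm_point_sq)
  qed
  obtain c where c: "bdd_meas c" and c_div: "\<And>x. x \<in> Omega \<Longrightarrow> c x = divergence \<beta> x"
    and parts: "\<And>m i j. i < m\<^sup>2 \<Longrightarrow> j < m\<^sup>2 \<Longrightarrow>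
       convect d m \<beta> i j + convect d m \<beta> j i = - (LINT x|area. c x * (hat_fun d m i x * hat_fun d m j x))"
    using C1_field_integration_by_parts[OF assms(4)] by metis
  have c_nonneg: "0 \<le> c x" if "x \<in> Omega" for x using assms(5) c_div that by simp
  obtain M where M: "0 \<le> M" and c_le: "\<And>x. x \<in> Omega \<Longrightarrow> \<bar>c x\<bar> \<le> M"
  proof -
    obtain M where "\<forall>x\<in>Omega. \<bar>c x\<bar> \<le> M" using c unfolding bdd_meas_def by blast
    then show thesis by (intro that[of "\<bar>M\<bar>"]) auto
  qed
  define K where "K = 16 * C + 8 * (66 * C + (128 * C + 3 * L)\<^sup>2 / (8 * a0)) + 2 * M"
  have K: "0 \<le> K" unfolding K_def using C M a0 by (intro add_nonneg_nonneg mult_nonneg_nonneg divide_nonneg_nonneg) auto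
  \<comment> \<open>The relative size of the difference of symmetric part and preconditioner: 25 entries of size \<open>K / H\<^sup>2\<close>
    against the lower bound \<open>a0 / (4 H\<^sup>2)\<close>.\<close>
  define q where "q = 100 * K / a0"
  have q: "0 \<le> q" using K a0 by (simp add: q_def)
  define \<kappa> where "\<kappa> = 200 * B * (1 + q) / a0 + 20000 * M\<^sup>2 / a0"
  have \<kappa>: "0 \<le> \<kappa>" using B q a0 by (simp add: \<kappa>_def)
  \<comment> \<open>The last summand is a bound for the square of the required constant, and squaring only enlarges it.\<close>
  define cc where "cc = 1 + q + 4 * \<kappa> / a0"
  have cc: "1 \<le> cc" "q \<le> cc" "1 + q \<le> cc" "4 * \<kappa> / a0 \<le> cc" using q \<kappa> a0 by (simp_all add: cc_def)
  show ?thesis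
  proof (rule phss_optimally_convergent_of_forms)
    fix m :: nat assume m: "m \<ge> 1"
    define n where "n = m\<^sup>2"
    define H where "H = real (m+1)"
    have H: "1 \<le> H" by (simp add: H_def)
    then have H2: "0 < H\<^sup>2" by simp
    \<comment> \<open>The constant of the Poincare inequality, times the lower bound of the diagonal scaling.\<close>
    define lam where "lam = a0 / (4 * H\<^sup>2)"
    have lam: "0 < lam" using a0 H2 by (simp add: lam_def)
    define A where "A = fem_matrix d m a \<beta>"
    define P where "P = (\<lambda>i j. preconditioner d m a $$ (i, j))"
    define mass where "mass = (\<lambda>i j. LINT x|area. c x * (hat_fun d m i x * hat_fun d m j x))"
    define \<Theta> where "\<Theta> v = bform n (stiff d m a) v v" for v
    define \<Lambda> where "\<Lambda> v = bform n (stiff d m (\<lambda>_. 1)) v v" for v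
    have P_entry: "P i j = precond_entry d m a i j" if "i < n" "j < n" for i j
      unfolding P_def using preconditioner_entry[OF a, of i m j d] that by (simp add: n_def)
    have sym_entry: "sym_entry A i j = stiff d m a i j + mass i j / 2" if ij: "i < n" "j < n" for i j
    proof -
      have "A $$ (i, j) = stiff d m a i j - convect d m \<beta> i j" "A $$ (j, i) = stiff d m a i j - convect d m \<beta> j i"
        using fem_matrix_entry[OF a bmb, of i m j d] fem_matrix_entry[OF a bmb, of j m i d] ij
        unfolding A_def n_def by (simp_all add: stiff_commute[of d m a j i])
      then show ?thesis using parts[of i m j] ij unfolding sym_entry_def mass_def n_def by argo
    qed
    have skew_entry: "skew_entry A i j = convect d m \<beta> j i + mass i j / 2" if ij: "i < n" "j < n" for i j
    proof -
      have "A $$ (i, j) = stiff d m a i j - convect d m \<beta> i j" "A $$ (j, i) = stiff d m a i j - convect d m \<beta> j i"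
        using fem_matrix_entry[OF a bmb, of i m j d] fem_matrix_entry[OF a bmb, of j m i d] ij
        unfolding A_def n_def by (simp_all add: stiff_commute[of d m a j i])
      then show ?thesis using parts[of i m j] ij unfolding skew_entry_def mass_def n_def by argo
    qed
    have mass_commute: "mass i j = mass j i" for i j by (simp add: mass_def mult.commute)
    have mass_le: "\<bar>mass i j\<bar> \<le> 4 * M / H\<^sup>2" for i j
      unfolding mass_def H_def by (rule mass_bound[OF c c_le M])
    have mass_far': "mass i j = 0" if "\<not> near m i j" for i j
      unfolding mass_def by (rule mass_far[OF that])
    have form_R: "bform n (sym_entry A) u v = bform n (stiff d m a) u v + bform n mass u v / 2" for u v
    proof -
      have "bform n (sym_entry A) u v = bform n (\<lambda>i j. stiff d m a i j + (1/2) * mass i j) u v"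
        by (rule bform_cong) (simp add: sym_entry)
      then show ?thesis unfolding bform_add_matrix by (simp add: bform_def sum_divide_distrib mult_ac)
    qed
    have form_K: "bform n (skew_entry A) u v = bform n (convect d m \<beta>) v u + bform n mass v u / 2" for u v
    proof -
      have "bform n (skew_entry A) u v = bform n (\<lambda>i j. convect d m \<beta> j i + (1/2) * mass j i) u v"
        by (rule bform_cong) (simp add: skew_entry mass_commute)
      also have "\<dots> = bform n (\<lambda>i j. convect d m \<beta> i j + (1/2) * mass i j) v u"
        by (rule bform_transpose)
      finally show ?thesis unfolding bform_add_matrix by (simp add: bform_def sum_divide_distrib mult_ac)
    qed
    have mass_nonneg: "0 \<le> bform n mass v v" for v
    proof -
      have "bform n mass v v = (LINT x|area. c x * (fe_fun d m v x * fe_fun d m v x))"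
        unfolding mass_def n_def by (rule bform_mass[OF c])
      also have "0 \<le> \<dots>"
        using c_nonneg by (intro integral_nonneg_AE AE_I2) simp
      finally show ?thesis .
    qed
    have diff_entry: "\<bar>sym_entry A i j - P i j\<bar> \<le> K / H\<^sup>2" if ij: "i < n" "j < n" for i j
    proof -
      have "\<bar>stiff d m a i j - precond_entry d m a i j\<bar> \<le> (K - 2 * M) / H\<^sup>2"
        using precond_close[OF a a0 a_ge C taylor L lip, of i m j d] ij unfolding n_def H_def K_def by simp
      moreover have "\<bar>mass i j / 2\<bar> \<le> 2 * M / H\<^sup>2" using mass_le[of i j] by simp
      ultimately have "\<bar>stiff d m a i j - precond_entry d m a i j + mass i j / 2\<bar> \<le> (K - 2 * M) / H\<^sup>2 + 2 * M / H\<^sup>2"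
        by (rule order_trans[OF abs_triangle_ineq add_mono])
      also have "\<dots> = K / H\<^sup>2" by (simp add: add_divide_distrib[symmetric])
      finally show ?thesis using ij by (simp add: sym_entry P_entry algebra_simps)
    qed
    have diff_far: "sym_entry A i j - P i j = 0" if "i < n" "j < n" "\<not> near m i j" for i j
      using that by (simp add: sym_entry P_entry stiff_far precond_far mass_far')
    have form_diff: "bform n (\<lambda>i j. sym_entry A i j - P i j) u v = bform n (sym_entry A) u v - bform n P u v" for u v
      by (simp add: bform_def sum_subtractf algebra_simps)
    have e0: "0 \<le> K / H\<^sup>2" using K H2 by simp
    have \<Lambda>: "sqnorm n v \<le> 4 * H\<^sup>2 * \<Lambda> v" for v
      unfolding n_def H_def \<Lambda>_def by (rule stiff_coercive[OF m])
    have \<Theta>: "a0 * \<Lambda> v \<le> \<Theta> v" for v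
      unfolding n_def \<Lambda>_def \<Theta>_def by (rule stiff_ge[OF a a_ge])
    have R_ge: "\<Theta> v \<le> bform n (sym_entry A) v v" for v
      using mass_nonneg[of v] by (simp add: form_R \<Theta>_def)
    have R_coercive: "lam * sqnorm n v \<le> bform n (sym_entry A) v v" for v
    proof -
      have "lam * sqnorm n v \<le> lam * (4 * H\<^sup>2 * \<Lambda> v)" using \<Lambda> lam by (intro mult_left_mono) auto
      also have "\<dots> = a0 * \<Lambda> v" using H2 by (simp add: lam_def)
      finally show ?thesis using \<Theta>[of v] R_ge[of v] by linarith
    qed
    have P_coercive: "lam * sqnorm n v \<le> bform n P v v" for v
    proof -
      define D where "D = diag_ratio d m a"
      have D_ge: "a0 \<le> D k" if "k < n" for k
        using stiff_diagonal_ge_a0[OF a a_ge, of d m k] stiff_diagonal_ge[of k m d] that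
        unfolding D_def diag_ratio_def n_def by (simp add: field_simps)
      define w where "w i = sqrt (D i) * v i" for i
      have "a0 * sqnorm n v = (\<Sum>i<n. a0 * (v i)\<^sup>2)" by (simp add: sqnorm_def sum_distrib_left)
      also have "\<dots> \<le> sqnorm n w"
        unfolding sqnorm_def
      proof (rule sum_mono)
        fix i assume "i \<in> {..<n}"
        then have "a0 \<le> D i" by (intro D_ge) simp
        then show "a0 * (v i)\<^sup>2 \<le> (w i)\<^sup>2" using a0 by (simp add: w_def power_mult_distrib mult_right_mono)
      qed
      also have "\<dots> \<le> 4 * H\<^sup>2 * \<Lambda> w" by (rule \<Lambda>)
      also have "\<Lambda> w = bform n (precond_entry d m a) v v"
        unfolding \<Lambda>_def bform_def w_def precond_entry_def D_def by (simp add: mult_ac)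
      also have "\<dots> = bform n P v v" by (rule bform_cong) (simp add: P_entry)
      finally show ?thesis using H2 by (simp add: lam_def field_simps)
    qed
    have close: "\<bar>bform n (sym_entry A) v v - bform n P v v\<bar> \<le> (100 * K / a0 * lam) * sqnorm n v" for v
    proof -
      have "\<bar>bform n (sym_entry A) v v - bform n P v v\<bar> \<le> 25 * (K / H\<^sup>2) * sqnorm n v"
        unfolding form_diff[symmetric] by (rule banded_quadratic_bound[OF diff_entry diff_far e0])
      also have "25 * (K / H\<^sup>2) = 100 * K / a0 * lam" using a0 by (simp add: lam_def)
      finally show ?thesis .
    qed
    have R_le_P: "bform n (sym_entry A) v v \<le> (1 + q) * bform n P v v" for v
      using perturbed_form_le[of "bform n (sym_entry A) v v" "bform n P v v" q "lam * sqnorm n v" 1]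
        close[of v] P_coercive[of v] q by (simp add: q_def mult.assoc)
    have P_le_R: "bform n P v v \<le> (1 + q) * bform n (sym_entry A) v v" for v
      using perturbed_form_le[of "bform n P v v" "bform n (sym_entry A) v v" q "lam * sqnorm n v" 1]
        close[of v] R_coercive[of v] q by (simp add: q_def mult.assoc abs_minus_commute)
    have R_nonneg: "0 \<le> bform n (sym_entry A) v v" for v
      using R_coercive[of v] lam sqnorm_nonneg[of n v] by (meson mult_nonneg_nonneg less_imp_le order_trans)
    have P_nonneg: "0 \<le> bform n P v v" for v
      using P_coercive[of v] lam sqnorm_nonneg[of n v] by (meson mult_nonneg_nonneg less_imp_le order_trans)
    have K_bound: "(bform n (skew_entry A) u v)\<^sup>2 \<le> cc\<^sup>2 * lam * sqnorm n u * bform n P v v" for u v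
    proof -
      let ?s = "bform n (convect d m \<beta>) v u" and ?t = "bform n mass v u"
      have "?s\<^sup>2 \<le> B * \<Lambda> v * (100 / H\<^sup>2 * sqnorm n u)"
        unfolding n_def \<Lambda>_def H_def by (rule convect_form_bound[OF bmb \<beta>_le B])
      also have "\<dots> \<le> B * ((1 + q) / a0 * bform n P v v) * (100 / H\<^sup>2 * sqnorm n u)"
      proof (intro mult_right_mono mult_left_mono)
        have "a0 * \<Lambda> v \<le> (1 + q) * bform n P v v" using \<Theta>[of v] R_ge[of v] R_le_P[of v] by linarith
        then show "\<Lambda> v \<le> (1 + q) / a0 * bform n P v v" using a0 by (simp add: field_simps)
      qed (use B H2 in auto)
      finally have s: "?s\<^sup>2 \<le> B * ((1 + q) / a0 * bform n P v v) * (100 / H\<^sup>2 * sqnorm n u)" .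
      have "?t\<^sup>2 \<le> (25 * (4 * M / H\<^sup>2))\<^sup>2 * sqnorm n v * sqnorm n u"
        by (rule banded_form_bound[where m = m]) (use mass_le mass_far' M H2 in auto)
      also have "\<dots> \<le> (25 * (4 * M / H\<^sup>2))\<^sup>2 * (bform n P v v / lam) * sqnorm n u"
        using P_coercive[of v] lam by (intro mult_right_mono mult_left_mono) (auto simp: pos_le_divide_eq mult.commute)
      finally have t: "?t\<^sup>2 \<le> (25 * (4 * M / H\<^sup>2))\<^sup>2 * (bform n P v v / lam) * sqnorm n u" .
      have "(?s + ?t / 2)\<^sup>2 \<le> 2 * ?s\<^sup>2 + ?t\<^sup>2 / 2"
        using zero_le_power2[of "?s - ?t / 2"] by (simp add: power2_eq_square field_simps)
      also have "\<dots> \<le> 2 * (B * ((1 + q) / a0 * bform n P v v) * (100 / H\<^sup>2 * sqnorm n u))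
          + (25 * (4 * M / H\<^sup>2))\<^sup>2 * (bform n P v v / lam) * sqnorm n u / 2"
        by (intro add_mono mult_left_mono[OF s] divide_right_mono[OF t]) simp_all
      also have "\<dots> = \<kappa> / H\<^sup>2 * (sqnorm n u * bform n P v v)"
        using a0 H2 by (simp add: \<kappa>_def lam_def field_simps power2_eq_square)
      also have "\<dots> = (4 * \<kappa> / a0) * lam * (sqnorm n u * bform n P v v)"
        using a0 by (simp add: lam_def)
      also have "\<dots> \<le> cc\<^sup>2 * lam * (sqnorm n u * bform n P v v)"
      proof (intro mult_right_mono)
        have "4 * \<kappa> / a0 \<le> cc * 1" using cc by simp
        also have "\<dots> \<le> cc * cc" using cc by (intro mult_left_mono) auto
        finally show "4 * \<kappa> / a0 \<le> cc\<^sup>2" by (simp add: power2_eq_square)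
      qed (use lam P_nonneg in auto)
      finally show ?thesis unfolding form_K by (simp add: mult.assoc)
    qed
    have "phss_forms n P (sym_entry A) (skew_entry A) lam cc"
    proof
      show "0 < lam" "1 \<le> cc" by (rule lam, rule cc)
      show "P j i = P i j" if "i < n" "j < n" for i j
        using that by (simp add: P_entry precond_commute[of d m a j i])
      show "sym_entry A j i = sym_entry A i j" for i j by (simp add: sym_entry_def add.commute)
      show "skew_entry A j i = - skew_entry A i j" for i j by (simp add: skew_entry_def field_simps)
      show "lam * sqnorm n v \<le> bform n P v v" for v by (rule P_coercive)
      show "(bform n (sym_entry A) u v - bform n P u v)\<^sup>2 \<le> (cc * lam)\<^sup>2 * sqnorm n u * sqnorm n v" for u v
      proof -
        have "(bform n (sym_entry A) u v - bform n P u v)\<^sup>2 \<le> (25 * (K / H\<^sup>2))\<^sup>2 * sqnorm n u * sqnorm n v"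
          unfolding form_diff[symmetric] by (rule banded_form_bound[OF diff_entry diff_far e0])
        also have "25 * (K / H\<^sup>2) = q * lam" using a0 by (simp add: lam_def q_def)
        also have "(q * lam)\<^sup>2 * sqnorm n u * sqnorm n v \<le> (cc * lam)\<^sup>2 * sqnorm n u * sqnorm n v"
          using cc q lam by (intro mult_right_mono power_mono) auto
        finally show ?thesis .
      qed
      show "bform n P v v \<le> cc * bform n (sym_entry A) v v" for v
        using P_le_R[of v] mult_right_mono[OF cc(3) R_nonneg[of v]] by linarith
      show "(bform n (skew_entry A) u v)\<^sup>2 \<le> cc\<^sup>2 * lam * sqnorm n u * bform n P v v" for u v by (rule K_bound)
    qed
    then show "phss_system (m\<^sup>2) (fem_matrix d m a \<beta>) (preconditioner d m a) (fem_rhs d m f)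
       (a0 / (4 * (real (m+1))\<^sup>2)) cc"
      unfolding phss_system_def n_def A_def P_def lam_def H_def
      by (simp add: preconditioner_carrier fem_rhs_def)
  qed
qed

end
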